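(* With $S_1,S_2$ as in the context, $$S_1(q)=3\frac{(q^6;q^6)_\infty (q^{18},q^{27},q^{45};q^{45})_\infty}{(q^3;q^3)_\infty^2} -\frac{(q^4,q^6,q^{10};q^{10})_\infty(q,q^5,q^{11},q^{19},q^{25},q^{29};q^{30})_\infty}{(q^3;q^3)_\infty (q^3,q^{27};q^{30})_\infty},$$ $$S_2(q)=3q^2\frac{(q^6;q^6)_\infty (q^9,q^{36},q^{45};q^{45})_\infty}{(q^3;q^3)_\infty^2} +\frac{(q^2,q^8,q^{10};q^{10})_\infty (q^5,q^7,q^{13},q^{17},q^{23},q^{25};q^{30})_\infty}{(q^3;q^3)_\infty (q^9,q^{21};q^{30})_\infty}.$$
   Context: Let $|q|<1$ and use standard $q$-Pochhammer notation $(a;q)_n=\prod_{k=0}^{n-1}(1-aq^k)$, $(a;q)_\infty=\prod_{k\ge0}(1-aq^k)$, $(a_1,\dots,a_m;q)_\infty=(a_1;q)_\infty\cdots(a_m;q)_\infty$. Define $$S_1(q)=\sum_{i,j\geq 0}\frac{q^{\frac{1}{2}i^2-ij+2j^2-\frac{1}{2}i+2j}}{(q^3;q^3)_i(q^3;q^3)_j},\qquad S_2(q)=\sum_{i,j\geq 0}\frac{q^{\frac{1}{2}i^2-ij+2j^2+\frac{3}{2}i}}{(q^3;q^3)_i (q^3;q^3)_j}.$$ *)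

theory Defs
  imports "HOL-Analysis.Analysis"
begin

definition qpoch_inf :: "complex \<Rightarrow> complex \<Rightarrow> complex" where
  "qpoch_inf a q = (\<Prod>k. (1 - a * q ^ k))"

definition qpoch :: "complex \<Rightarrow> complex \<Rightarrow> nat \<Rightarrow> complex" where
  "qpoch a q n = (\<Prod>k<n. (1 - a * q ^ k))"

text \<open>Exponents are integers: i^2/2 - i/2 = i(i-1)/2 and i^2/2 + 3i/2 = i(i+3)/2.\<close>
definition S1 :: "complex \<Rightarrow> complex" where
  "S1 q = (\<Sum>\<^sub>\<infinity>(i,j)\<in>(UNIV :: (nat \<times> nat) set).
      q powi ((int i * int i - int i) div 2 - int i * int j + 2 * int j * int j + 2 * int j)
      / (qpoch (q^3) (q^3) i * qpoch (q^3) (q^3) j))"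

definition S2 :: "complex \<Rightarrow> complex" where
  "S2 q = (\<Sum>\<^sub>\<infinity>(i,j)\<in>(UNIV :: (nat \<times> nat) set).
      q powi ((int i * int i + 3 * int i) div 2 - int i * int j + 2 * int j * int j)
      / (qpoch (q^3) (q^3) i * qpoch (q^3) (q^3) j))"

end

theory Submission
  imports Defs
begin

text \<open>
  Put \<open>Q = q\<^sup>3\<close>. With \<open>n = i - j\<close> both exponents split into a function of \<open>n\<close> and
  \<open>3 j (j + 1) / 2\<close>, and the inner sum over \<open>j\<close> is a constant multiple of
  \<open>\<Sum>\<^sub>k Q\<^bsup>(n-2k)(n-2k-1)/2\<^esup> / (Q\<^sup>2;Q\<^sup>2)\<^sub>k\<close>. Writing \<open>q = t\<^sup>2\<close>, \<open>x = t\<^sup>3\<close> and completing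
  squares, \<open>t S\<^sub>1\<close> and \<open>S\<^sub>2\<close> become the odd part of \<open>\<phi>(t) R\<^sub>0(x)\<close> and the even part of
  \<open>\<phi>(t) R\<^sub>1(x)\<close> (up to \<open>(Q;Q)\<^sub>\<infinity>\<close>), where \<open>\<phi>(t) = \<Sum>\<^sub>n t\<^bsup>n*n\<^esup>\<close> and
  \<open>R\<^sub>s(x) = \<Sum>\<^sub>k x\<^bsup>k*k+2sk\<^esup> / (x\<^sup>4;x\<^sup>4)\<^sub>k\<close>. By two identities of Slater, \<open>R\<^sub>0\<close> and \<open>R\<^sub>1\<close> are
  multiples of the Rogers-Ramanujan theta series \<open>G\<close> and \<open>H\<close>, and a Casoratian argument gives
  \<open>R\<^sub>0(x) R\<^sub>1(-x) + R\<^sub>1(x) R\<^sub>0(-x) = 2\<close>.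

  On the product side, the claimed values are, up to the factor \<open>(Q\<^sup>2;Q\<^sup>2)\<^sub>\<infinity> / (Q;Q)\<^sub>\<infinity>\<^sup>2\<close>,
  the theta series \<open>H(q)\<close> and \<open>G(q)\<close> twisted by \<open>\<omega>\<^sup>n + \<omega>\<^bsup>-n\<^esup>\<close> with \<open>\<omega>\<close> a primitive cube root of unity
  (for \<open>G\<close>, by \<open>- \<omega>\<^bsup>n+1\<^esup> - \<omega>\<^bsup>-n-1\<^esup>\<close>); call them \<open>s\<^sub>1\<close> and \<open>s\<^sub>2\<close>. Splitting a twisted theta series in two variables along an index-5
  sublattice yields \<open>G(x) s\<^sub>2 - t H(x) s\<^sub>1 = (x;x)\<^sub>\<infinity> \<phi>(-t)\<close>, a twisted analogue of one of
  Ramanujan's forty identities. This relation for \<open>t\<close> and \<open>-t\<close>, together with the Casoratian,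
  determines \<open>s\<^sub>1\<close> and \<open>s\<^sub>2\<close> and identifies them with \<open>S\<^sub>1\<close> and \<open>S\<^sub>2\<close>.
\<close>

section \<open>Sums over the integers\<close>

text \<open>Rewrites an absolutely convergent sum as an integral over the counting measure, where
  the dominated convergence theorem is available.\<close>

lemma abs_summable_imp_infsetsum:
  fixes f :: "'a \<Rightarrow> complex"
  assumes "(\<lambda>x. norm (f x)) summable_on A"
  shows "integrable (count_space A) f" "infsum f A = lebesgue_integral (count_space A) f"
proof -
  show "integrable (count_space A) f"
    using assms by (simp add: abs_summable_equivalent abs_summable_on_def)
  show "infsum f A = lebesgue_integral (count_space A) f"
    using assms infsetsum_infsum[of f A] by (simp add: infsetsum_def abs_summable_equivalent)
qed

text \<open>Tannery's theorem. Every passage to the limit under a summation sign below (triple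
  product, 1phi1 sum, recurrence limits) goes through it.\<close>

lemma infsum_dominated_convergence:
  fixes f :: "nat \<Rightarrow> 'a \<Rightarrow> complex"
  assumes lim: "\<And>x. (\<lambda>n. f n x) \<longlonglongrightarrow> g x"
    and bd: "\<And>n x. norm (f n x) \<le> h x" and h: "h summable_on UNIV"
  shows "(\<lambda>n. infsum (f n) UNIV) \<longlonglongrightarrow> infsum g UNIV"
proof -
  have hn: "0 \<le> h x" for x using bd[of 0 x] norm_ge_zero order_trans by blast
  have h': "(\<lambda>x. norm (complex_of_real (h x))) summable_on UNIV" using h hn by simp
  have f: "(\<lambda>x. norm (f n x)) summable_on UNIV" for n
    by (rule Infinite_Sum.abs_summable_on_comparison_test'[OF h bd])
  have gb: "norm (g x) \<le> h x" for x
    by (rule Lim_bounded[of "\<lambda>n. norm (f n x)" _ 0]) (auto intro: tendsto_norm lim bd)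
  have g: "(\<lambda>x. norm (g x)) summable_on UNIV"
    by (rule Infinite_Sum.abs_summable_on_comparison_test'[OF h gb])
  have "integrable (count_space UNIV) h"
    using abs_summable_imp_infsetsum(1)[OF h'] by (simp add: complex_of_real_integrable_eq)
  then have "(\<lambda>n. lebesgue_integral (count_space UNIV) (f n)) \<longlonglongrightarrow> lebesgue_integral (count_space UNIV) g"
    by (intro integral_dominated_convergence[where w = h]) (auto intro: lim bd)
  then show ?thesis by (simp add: abs_summable_imp_infsetsum(2)[OF f] abs_summable_imp_infsetsum(2)[OF g])
qed

lemma summable_on_geometric_abs_int:
  fixes r :: real assumes "0 \<le> r" "r < 1"
  shows "(\<lambda>n::int. r ^ nat \<bar>n\<bar>) summable_on UNIV"
proof -
  have g: "(\<lambda>n::nat. r ^ n) summable_on UNIV"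
    using assms by (intro norm_summable_imp_summable_on) (auto intro!: summable_geometric)
  have U: "UNIV = range int \<union> range (\<lambda>n. - int n)"
  proof -
    have "n \<in> range int \<union> range (\<lambda>n. - int n)" for n :: int
      by (cases n rule: int_cases2) auto
    then show ?thesis by blast
  qed
  have "(\<lambda>n::int. r ^ nat \<bar>n\<bar>) summable_on range int"
    using g by (subst summable_on_reindex) (auto simp: o_def inj_def)
  moreover have "(\<lambda>n::int. r ^ nat \<bar>n\<bar>) summable_on range (\<lambda>n. - int n)"
    using g by (subst summable_on_reindex) (auto simp: o_def inj_def)
  ultimately show ?thesis unfolding U by (rule summable_on_union)
qed

lemma summable_on_geometric_abs_int2:
  fixes r :: real assumes "0 \<le> r" "r < 1"
  shows "(\<lambda>(n::int,k::int). r ^ nat \<bar>n\<bar> * r ^ nat \<bar>k\<bar>) summable_on UNIV"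
proof -
  let ?g = "\<lambda>n::int. r ^ nat \<bar>n\<bar>"
  have g: "(?g has_sum infsum ?g UNIV) UNIV"
    using summable_on_geometric_abs_int[OF assms] by simp
  have "(\<lambda>(n,k). ?g n * ?g k) summable_on (UNIV \<times> UNIV)"
  proof (rule summable_on_SigmaI[where g = "\<lambda>n. ?g n * infsum ?g UNIV"])
    show "(\<lambda>n. ?g n * infsum ?g UNIV) summable_on UNIV"
      using summable_on_geometric_abs_int[OF assms] by (rule summable_on_cmult_left)
  qed (use g assms in \<open>auto intro!: has_sum_cmult_right\<close>)
  then show ?thesis by simp
qed

lemma norm_powi_le_geometric:
  fixes x :: complex
  assumes "x \<noteq> 0" "norm x < 1" "int k - c \<le> p" "c \<ge> 0"
  shows "norm (x powi p) \<le> norm x powi (- c) * norm x ^ k"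
proof -
  have "norm (x powi p) = norm x powi p" by (simp add: norm_power_int)
  also have "\<dots> \<le> norm x powi (int k - c)"
    using assms by (intro power_int_decreasing) auto
  also have "\<dots> = norm x powi (- c) * norm x ^ k"
    using assms power_int_add[of "norm x" "- c" "int k"] by simp
  finally show ?thesis .
qed

text \<open>The working summability test. Quadratic exponents outgrow |n|, and \<open>c\<close>
  absorbs the deficit near the origin, so a two-sided geometric series is a majorant.\<close>

lemma abs_summable_powi:
  fixes x :: complex and p :: "int \<Rightarrow> int"
  assumes "x \<noteq> 0" "norm x < 1" "c \<ge> 0"
    and p: "\<And>n. g n \<noteq> 0 \<Longrightarrow> \<bar>n\<bar> - c \<le> p n" and g: "\<And>n. norm (g n) \<le> B"
  shows "(\<lambda>n. norm (g n * x powi p n)) summable_on UNIV"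
proof (rule Infinite_Sum.abs_summable_on_comparison_test')
  show "(\<lambda>n::int. (B * norm x powi (- c)) * norm x ^ nat \<bar>n\<bar>) summable_on UNIV"
    by (intro summable_on_cmult_right summable_on_geometric_abs_int) (use assms in auto)
  have B: "B \<ge> 0" using g[of 0] norm_ge_zero order_trans by blast
  show "norm (g n * x powi p n) \<le> B * norm x powi (- c) * norm x ^ nat \<bar>n\<bar>" for n
  proof (cases "g n = 0")
    case True
    then show ?thesis using B by simp
  next
    case False
    have "norm (g n) * norm (x powi p n) \<le> B * (norm x powi (- c) * norm x ^ nat \<bar>n\<bar>)"
      by (intro mult_mono g norm_powi_le_geometric) (use p[OF False] B assms in auto)
    then show ?thesis by (simp add: norm_mult mult.assoc)
  qed
qed

lemma abs_summable_powi2: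
  fixes x :: complex and p :: "int \<times> int \<Rightarrow> int"
  assumes "x \<noteq> 0" "norm x < 1" "c \<ge> 0"
    and p: "\<And>n k. g (n,k) \<noteq> 0 \<Longrightarrow> \<bar>n\<bar> + \<bar>k\<bar> - c \<le> p (n,k)" and g: "\<And>z. norm (g z) \<le> B"
  shows "(\<lambda>z. norm (g z * x powi p z)) summable_on UNIV"
proof (rule Infinite_Sum.abs_summable_on_comparison_test')
  let ?h = "\<lambda>z::int\<times>int. (B * norm x powi (- c)) * (case z of (n,k) \<Rightarrow> norm x ^ nat \<bar>n\<bar> * norm x ^ nat \<bar>k\<bar>)"
  show "?h summable_on UNIV"
    by (intro summable_on_cmult_right summable_on_geometric_abs_int2) (use assms in auto)
  have B: "B \<ge> 0" using g[of "(0,0)"] norm_ge_zero order_trans by blast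
  show "norm (g z * x powi p z) \<le> ?h z" for z
  proof (cases z)
    case (Pair n k)
    show ?thesis
    proof (cases "g z = 0")
      case True
      then show ?thesis using B by (simp add: Pair)
    next
      case False
      have "norm (g z) * norm (x powi p z) \<le> B * (norm x powi (- c) * norm x ^ (nat \<bar>n\<bar> + nat \<bar>k\<bar>))"
        by (intro mult_mono g norm_powi_le_geometric) (use p[of n k] False Pair B assms in auto)
      then show ?thesis by (simp add: Pair norm_mult mult.assoc power_add)
    qed
  qed
qed

lemma infsum_shift_int:
  fixes f :: "int \<Rightarrow> complex"
  shows "infsum (\<lambda>n. f (n + k)) UNIV = infsum f UNIV"
  by (rule infsum_reindex_bij_witness[of UNIV "\<lambda>n. n - k" "\<lambda>n. n + k"]) auto

lemma infsum_reflect_int: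
  fixes f :: "int \<Rightarrow> complex"
  shows "infsum (\<lambda>n. f (k - n)) UNIV = infsum f UNIV"
  by (rule infsum_reindex_bij_witness[of UNIV "\<lambda>n. k - n" "\<lambda>n. k - n"]) auto

section \<open>Triangular numbers as exponents\<close>

definition tri :: "int \<Rightarrow> int" where "tri n = n * (n - 1) div 2"

text \<open>Removes the integer division. Identities between quadratic exponents are proved later by
  doubling them and inserting this equation for each \<open>tri\<close> that occurs.\<close>

lemma two_tri: "2 * tri n = n * n - n"
  unfolding tri_def by (simp add: algebra_simps)

lemma tri_add: "tri (m + n) = tri m + tri n + m * n"
  using two_tri[of "m + n"] two_tri[of m] two_tri[of n] by (simp add: algebra_simps)

lemma tri_simps [simp]: "tri 0 = 0" "tri 1 = 0" "tri 2 = 1" "tri (-1) = 1"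
  by (simp_all add: tri_def)

lemma tri_minus: "tri (- n) = tri n + n"
  using two_tri[of "- n"] two_tri[of n] by (simp add: algebra_simps)

lemma int_abs_le_square: "\<bar>n\<bar> \<le> n * (n::int)"
proof (cases "n = 0")
  case False
  then have "\<bar>n\<bar> * 1 \<le> \<bar>n\<bar> * \<bar>n\<bar>" by (intro mult_left_mono) auto
  then show ?thesis by (simp add: abs_mult_self_eq)
qed simp

lemma tri_nonneg: "tri n \<ge> 0"
  using two_tri[of n] int_abs_le_square[of n] by linarith

text \<open>Quadratic growth beats every linear slope \<open>m\<close> at the price of a crude
  constant, because the square of 2|n| - 2m - 1 is nonnegative.\<close>

lemma tri_ge: "tri n \<ge> m * \<bar>n\<bar> - m * m - 2 * \<bar>m\<bar> - 2"
proof -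
  have "2 * tri n = \<bar>n\<bar> * \<bar>n\<bar> - n" using two_tri[of n] by (simp add: abs_mult_self_eq)
  moreover have "0 \<le> (2 * \<bar>n\<bar> - 2 * m - 1) * (2 * \<bar>n\<bar> - 2 * m - 1)" by simp
  then have "0 \<le> 4 * (\<bar>n\<bar> * \<bar>n\<bar>) + 4 * (m * m) + 1 - 8 * (m * \<bar>n\<bar>) - 4 * \<bar>n\<bar> + 4 * m"
    by (simp add: left_diff_distrib right_diff_distrib mult.commute[of "\<bar>n\<bar>" m])
  moreover have "0 \<le> m * m" "n \<le> \<bar>n\<bar>" "m \<le> \<bar>m\<bar>" "- m \<le> \<bar>m\<bar>" by auto
  ultimately show ?thesis by linarith
qed

section \<open>q-Pochhammer symbols\<close>

lemma convergent_prod_qpoch: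
  fixes a q :: complex
  assumes "norm q < 1"
  shows "convergent_prod (\<lambda>k. 1 - a * q ^ k)"
proof -
  have "summable (\<lambda>k. norm a * norm q ^ k)"
    using assms by (intro summable_mult summable_geometric) auto
  then have "abs_convergent_prod (\<lambda>k. 1 - a * q ^ k)"
    unfolding abs_convergent_prod_conv_summable by (simp add: norm_mult norm_power)
  then show ?thesis by (rule abs_convergent_prod_imp_convergent_prod)
qed

lemma qpoch_LIMSEQ:
  assumes "norm q < 1"
  shows "qpoch a q \<longlonglongrightarrow> qpoch_inf a q"
proof -
  have "(\<lambda>n. qpoch a q (Suc n)) \<longlonglongrightarrow> qpoch_inf a q"
    using convergent_prod_LIMSEQ[OF convergent_prod_qpoch[OF assms]]
    by (simp add: qpoch_def qpoch_inf_def lessThan_Suc_atMost)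
  then show ?thesis by (simp add: filterlim_sequentially_Suc)
qed

lemma qpoch_inf_eqI: "norm q < 1 \<Longrightarrow> qpoch a q \<longlonglongrightarrow> L \<Longrightarrow> qpoch_inf a q = L"
  using qpoch_LIMSEQ LIMSEQ_unique by blast

lemma qpoch_0 [simp]: "qpoch a q 0 = 1"
  by (simp add: qpoch_def)

lemma qpoch_Suc: "qpoch a q (Suc n) = qpoch a q n * (1 - a * q ^ n)"
  by (simp add: qpoch_def)

lemma mult_power_neq_1:
  fixes a q :: complex
  assumes "norm a < 1" "norm q < 1"
  shows "a * q ^ k \<noteq> 1"
proof
  assume "a * q ^ k = 1"
  then have "1 = norm a * norm q ^ k" by (metis norm_mult norm_one norm_power)
  also have "\<dots> \<le> norm a * 1" using assms by (intro mult_left_mono power_le_one) auto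
  finally show False using assms by simp
qed

lemma qpoch_nonzero: "norm a < 1 \<Longrightarrow> norm q < 1 \<Longrightarrow> qpoch a q n \<noteq> 0"
  using mult_power_neq_1[of a q] by (auto simp: qpoch_def)

lemma qpoch_inf_nonzero: "norm a < 1 \<Longrightarrow> norm q < 1 \<Longrightarrow> qpoch_inf a q \<noteq> 0"
  using mult_power_neq_1[of a q] unfolding qpoch_inf_def
  by (intro prodinf_nonzero convergent_prod_qpoch) auto

lemma norm_power_less_1: "norm (q :: complex) < 1 \<Longrightarrow> n > 0 \<Longrightarrow> norm (q ^ n) < 1"
  by (simp add: norm_power power_less_one_iff)

text \<open>Sort the factors by the residue of their index modulo \<open>m\<close>. Partial products
  of length \<open>m * n\<close> split exactly, and this subsequence already determines the
  limit.\<close>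

lemma qpoch_inf_residues:
  assumes "norm q < 1" "m > 0"
  shows "qpoch_inf a q = (\<Prod>r<m. qpoch_inf (a * q ^ r) (q ^ m))"
proof (rule qpoch_inf_eqI[OF assms(1)])
  have *: "qpoch a q (m * n) = (\<Prod>r<m. qpoch (a * q ^ r) (q ^ m) n)" for n
  proof (induction n)
    case (Suc n)
    have "qpoch a q (m * n + k) = qpoch a q (m * n) * (\<Prod>r<k. 1 - a * q ^ r * (q ^ m) ^ n)" for k
      by (induction k) (simp_all add: qpoch_Suc power_add power_mult mult_ac)
    from this[of m] show ?case by (simp add: Suc qpoch_Suc prod.distrib add.commute)
  qed simp
  have "(\<lambda>n. qpoch a q (m * n)) \<longlonglongrightarrow> (\<Prod>r<m. qpoch_inf (a * q ^ r) (q ^ m))"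
    unfolding * by (intro tendsto_prod qpoch_LIMSEQ norm_power_less_1 assms)
  moreover have "(\<lambda>n. qpoch a q (m * n)) \<longlonglongrightarrow> qpoch_inf a q"
    using LIMSEQ_subseq_LIMSEQ[OF qpoch_LIMSEQ[OF assms(1)], of "\<lambda>n. m * n" a] assms(2)
    by (simp add: o_def strict_mono_def)
  ultimately show "qpoch a q \<longlonglongrightarrow> (\<Prod>r<m. qpoch_inf (a * q ^ r) (q ^ m))"
    using qpoch_LIMSEQ[OF assms(1)] LIMSEQ_unique by metis
qed

lemma qpoch_inf_split:
  assumes "norm q < 1"
  shows "qpoch_inf a q = qpoch a q n * qpoch_inf (a * q ^ n) q"
proof (rule qpoch_inf_eqI[OF assms])
  have "qpoch a q (n + k) = qpoch a q n * qpoch (a * q ^ n) q k" for k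
    by (induction k) (simp_all add: qpoch_Suc power_add mult_ac)
  then have "(\<lambda>k. qpoch a q (k + n)) \<longlonglongrightarrow> qpoch a q n * qpoch_inf (a * q ^ n) q"
    using tendsto_mult_left[OF qpoch_LIMSEQ[OF assms, of "a * q ^ n"], of "qpoch a q n"] by (simp add: add.commute)
  then show "qpoch a q \<longlonglongrightarrow> qpoch a q n * qpoch_inf (a * q ^ n) q"
    by (rule LIMSEQ_offset)
qed

lemma qpoch_inf_mult_minus:
  assumes "norm q < 1"
  shows "qpoch_inf a q * qpoch_inf (- a) q = qpoch_inf (a\<^sup>2) (q\<^sup>2)"
proof -
  have "qpoch a q n * qpoch (- a) q n = qpoch (a\<^sup>2) (q\<^sup>2) n" for n
    by (simp add: qpoch_def power2_eq_square power_mult_distrib algebra_simps flip: prod.distrib)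
  then have "(\<lambda>n. qpoch (a\<^sup>2) (q\<^sup>2) n) \<longlonglongrightarrow> qpoch_inf a q * qpoch_inf (- a) q"
    using tendsto_mult[OF qpoch_LIMSEQ[OF assms, of a] qpoch_LIMSEQ[OF assms, of "- a"]] by simp
  then show ?thesis using assms qpoch_inf_eqI norm_power_less_1 by fastforce
qed

text \<open>Extending \<open>1/(q;q)\<^sub>k\<close> by \<open>0\<close> to negative \<open>k\<close> keeps the recurrence below valid for all
  integers, so that all sums can range over the integers and be shifted freely.\<close>

definition eul :: "complex \<Rightarrow> int \<Rightarrow> complex" where
  "eul q k = (if k < 0 then 0 else 1 / qpoch q q (nat k))"

lemma eul_neg [simp]: "k < 0 \<Longrightarrow> eul q k = 0"
  by (simp add: eul_def)

lemma eul_0 [simp]: "eul q 0 = 1"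
  by (simp add: eul_def)

lemma eul_int: "eul q (int n) = 1 / qpoch q q n"
  by (simp add: eul_def)

text \<open>The recurrence crosses zero without exception: at \<open>k = 0\<close> the factor
  \<open>1 - q powi 0\<close> vanishes, in agreement with the value 0 at -1.\<close>

lemma eul_rec:
  assumes "norm q < 1"
  shows "eul q (k - 1) = (1 - q powi k) * eul q k"
proof (cases "k > 0")
  case True
  then obtain n where k: "k = int (Suc n)" by (metis gr0_implies_Suc zero_less_imp_eq_int)
  have "k - 1 = int n" using k by simp
  moreover have "eul q k = 1 / (qpoch q q n * (1 - q * q ^ n))"
    unfolding k eul_int qpoch_Suc ..
  moreover have "q powi k = q * q ^ n" unfolding k by (simp only: power_int_of_nat power_Suc)
  ultimately show ?thesis
    using mult_power_neq_1[OF assms assms, of n] qpoch_nonzero[OF assms assms, of n]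
    by (simp add: eul_int)
next
  case False
  then show ?thesis by (cases "k = 0") auto
qed

lemma eul_rec':
  assumes "norm q < 1"
  shows "eul q k = (1 - q powi (k + 1)) * eul q (k + 1)"
  using eul_rec[OF assms, of "k + 1"] by simp

lemma eul_bounded:
  assumes "norm q < 1"
  shows "\<exists>B>0. \<forall>k. norm (eul q k) \<le> B"
proof -
  have "(\<lambda>n. eul q (int n)) \<longlonglongrightarrow> 1 / qpoch_inf q q"
    unfolding eul_int by (intro tendsto_divide tendsto_const qpoch_LIMSEQ qpoch_inf_nonzero assms)
  then have "Bseq (\<lambda>n. eul q (int n))" using convergentI convergent_imp_Bseq by blast
  then obtain B where B: "B > 0" "\<And>n. norm (eul q (int n)) \<le> B" unfolding Bseq_def by auto
  have "norm (eul q k) \<le> B" for k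
    using B(1) B(2)[of "nat k"] by (cases "k < 0") auto
  then show ?thesis using B(1) by blast
qed

lemma eul_LIMSEQ:
  assumes "norm q < 1"
  shows "(\<lambda>n. eul q (int n + k)) \<longlonglongrightarrow> 1 / qpoch_inf q q"
proof -
  have "(\<lambda>n. eul q (int n)) \<longlonglongrightarrow> 1 / qpoch_inf q q"
    unfolding eul_int by (intro tendsto_divide tendsto_const qpoch_LIMSEQ qpoch_inf_nonzero assms)
  moreover have "filterlim (\<lambda>n. nat (int n + k)) at_top sequentially"
    unfolding filterlim_at_top
  proof
    show "eventually (\<lambda>n. Z \<le> nat (int n + k)) sequentially" for Z
      using eventually_ge_at_top[of "Z + nat (- k)"] by eventually_elim linarith
  qed
  ultimately have "(\<lambda>n. eul q (int (nat (int n + k)))) \<longlonglongrightarrow> 1 / qpoch_inf q q"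
    by (rule filterlim_compose)
  moreover have "eventually (\<lambda>n. eul q (int (nat (int n + k))) = eul q (int n + k)) sequentially"
    using eventually_ge_at_top[of "nat (- k)"] by eventually_elim auto
  ultimately show ?thesis by (rule Lim_transform_eventually)
qed

section \<open>The Jacobi triple product\<close>

lemma summable_on_bounded_support:
  fixes f :: "int \<Rightarrow> complex"
  assumes "\<And>r. \<bar>r\<bar> > N \<Longrightarrow> f r = 0"
  shows "f summable_on UNIV"
proof (rule finite_nonzero_values_imp_summable_on)
  have "{x \<in> UNIV. f x \<noteq> 0} \<subseteq> {-N..N}"
    using assms by (auto simp: abs_le_iff) (meson assms linorder_not_le abs_le_iff minus_le_iff)+
  then show "finite {x \<in> UNIV. f x \<noteq> 0}" by (rule finite_subset) simp
qed

lemma infsum_only_0: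
  fixes f :: "int \<Rightarrow> complex"
  assumes "\<And>r. r \<noteq> 0 \<Longrightarrow> f r = 0"
  shows "infsum f UNIV = f 0"
proof -
  have "infsum f UNIV = infsum f {0}"
    by (rule infsum_cong_neutral) (use assms in auto)
  then show ?thesis by simp
qed

lemma powi_double: "(x::complex) \<noteq> 0 \<Longrightarrow> x powi (2 * n) = x powi n * x powi n"
  using power_int_add[of x n n] by (simp only: mult_2) simp

definition jterm :: "complex \<Rightarrow> complex \<Rightarrow> int \<Rightarrow> complex" where
  "jterm z q n = (-1) powi n * z powi n * q powi tri n"

definition jtheta :: "complex \<Rightarrow> complex \<Rightarrow> complex" where
  "jtheta z q = (\<Sum>\<^sub>\<infinity>n. jterm z q n)"

lemma jterm_Suc: "q \<noteq> 0 \<Longrightarrow> z \<noteq> 0 \<Longrightarrow> jterm z q (r + 1) = - z * q powi r * jterm z q r"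
  by (simp add: jterm_def power_int_add tri_add)

text \<open>The two bounds on |z| serve the two signs of \<open>n\<close>. For negative
  \<open>n\<close> the factor |z|^n is at most |q|^n, and \<open>tri n + n\<close> is
  \<open>tri (- n)\<close>.\<close>

lemma norm_jterm_le:
  assumes q: "q \<noteq> 0" "norm q < 1" and z: "norm q \<le> norm z" "norm z \<le> 1"
  shows "norm (jterm z q n) \<le> norm q powi (tri \<bar>n\<bar>)"
proof -
  have z0: "z \<noteq> 0" using q z by auto
  have *: "norm (jterm z q n) = norm z powi n * norm q powi tri n"
    by (simp add: jterm_def norm_mult norm_power_int)
  show ?thesis
  proof (cases "n \<ge> 0")
    case True
    have "norm z powi n \<le> 1"
      using True z by (simp add: power_int_def power_le_one)
    then show ?thesis unfolding * using True by (simp add: mult_left_le_one_le)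
  next
    case False
    have "norm z powi n = inverse (norm z ^ nat (- n))" using False by (simp add: power_int_def power_inverse)
    also have "\<dots> \<le> inverse (norm q ^ nat (- n))"
      using z q by (intro le_imp_inverse_le power_mono) auto
    also have "\<dots> = norm q powi n" using False by (simp add: power_int_def power_inverse)
    finally have "norm z powi n * norm q powi tri n \<le> norm q powi n * norm q powi tri n"
      by (intro mult_right_mono) auto
    then show ?thesis unfolding * using False q by (simp add: tri_minus power_int_add mult.commute)
  qed
qed

lemma summable_powi_tri_abs:
  assumes q: "(q::complex) \<noteq> 0" "norm q < 1"
  shows "(\<lambda>n. norm q powi (tri \<bar>n\<bar>)) summable_on UNIV"
proof -
  have "(\<lambda>n. norm (1 * q powi tri \<bar>n\<bar>)) summable_on UNIV"
    by (rule abs_summable_powi[where c = 9 and B = 1]) (use q tri_ge[of 1] in \<open>auto intro: order_trans[OF _ tri_ge[of 1]]\<close>)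
  then show ?thesis by (simp add: norm_power_int)
qed

lemma abs_summable_jterm:
  assumes q: "q \<noteq> 0" "norm q < 1" and z: "norm q \<le> norm z" "norm z \<le> 1"
  shows "(\<lambda>n. norm (jterm z q n)) summable_on UNIV"
  by (rule Infinite_Sum.abs_summable_on_comparison_test'[OF summable_powi_tri_abs[OF q]])
    (rule norm_jterm_le[OF assms])

text \<open>The recurrence behind the finite triple product. Expanding the two left factors gives 1
  + q^(2n+1) and two terms, -z q^n and -q^(n+1)/z, that move the summation index by one in opposite
  directions.\<close>

lemma jterm_eul_sum_rec:
  fixes n :: int
  assumes q: "q \<noteq> 0" "norm q < 1" and z: "z \<noteq> 0"
  defines "A \<equiv> \<lambda>n. \<Sum>\<^sub>\<infinity>r. jterm z q r * eul q (n - r) * eul q (n + r)"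
  shows "(1 - z * q powi n) * (1 - q powi (n + 1) / z) * A n
     = (1 - q powi (2 * n + 1)) * (1 - q powi (2 * n + 2)) * A (n + 1)"
proof -
  let ?y = "jterm z q"
  let ?f = "\<lambda>r. ?y r * eul q (n - r) * eul q (n + r)"
  \<comment> \<open>\<open>?g\<close> and \<open>?h\<close> are the series multiplied by -z q^n and
    by -q^(n+1)/z, after re-indexing so that all three carry the same
    \<open>jterm z q r\<close>.\<close>
  let ?g = "\<lambda>r. q powi (n - r + 1) * ?y r * eul q (n - r + 1) * eul q (n + r - 1)"
  let ?h = "\<lambda>r. q powi (n + r + 1) * ?y r * eul q (n - r - 1) * eul q (n + r + 1)"
  have sf: "?f summable_on UNIV" and sg: "?g summable_on UNIV" and sh: "?h summable_on UNIV"
    by (rule summable_on_bounded_support[of "\<bar>n\<bar> + 2"]; auto simp: eul_def)+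
  have "- z * q powi n * A n = (\<Sum>\<^sub>\<infinity>r. - z * q powi n * ?f r)"
    unfolding A_def by (simp only: infsum_cmult_right')
  also have "\<dots> = (\<Sum>\<^sub>\<infinity>r. ?g (r + 1))"
    by (intro infsum_cong) (simp add: jterm_Suc q z power_int_diff mult_ac)
  also have "\<dots> = infsum ?g UNIV" by (rule infsum_shift_int)
  finally have g: "- z * q powi n * A n = infsum ?g UNIV" .
  have hh: "?h (r + (-1)) = - (q powi (n + 1)) / z * ?f r" for r
  proof -
    have "q powi r * jterm z q (r - 1) = - (q / z) * jterm z q r"
      using jterm_Suc[OF q(1) z, of "r - 1"] q z by (simp add: power_int_diff field_simps)
    then have "?h (r + (-1)) = q powi n * (- (q / z) * jterm z q r) * eul q (n - r) * eul q (n + r)"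
      using q by (simp add: power_int_add mult_ac)
    then show ?thesis using q by (simp add: power_int_add mult_ac)
  qed
  have "- (q powi (n + 1)) / z * A n = (\<Sum>\<^sub>\<infinity>r. - (q powi (n + 1)) / z * ?f r)"
    unfolding A_def by (simp only: infsum_cmult_right')
  also have "\<dots> = (\<Sum>\<^sub>\<infinity>r. ?h (r + (-1)))"
    by (intro infsum_cong) (rule hh[symmetric])
  also have "\<dots> = infsum ?h UNIV" by (rule infsum_shift_int)
  finally have h: "- (q powi (n + 1)) / z * A n = infsum ?h UNIV" .
  have "(1 - z * q powi n) * (1 - q powi (n + 1) / z) * A n
      = (1 + q powi (2 * n + 1)) * A n + (- z * q powi n * A n) + (- (q powi (n + 1)) / z * A n)"
  proof -
    have "q powi (2 * n + 1) = q * (q powi n * q powi n)" "q powi (n + 1) = q * q powi n"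
      using q by (simp_all add: power_int_add powi_double)
    moreover have "(1 - z * a) * (1 - q * a / z) * A n
        = (1 + q * (a * a)) * A n + (- z * a * A n) + (- (q * a) / z * A n)" for a
    proof -
      define w where "w = q * a / z"
      have "q * a = z * w" using z by (simp add: w_def)
      then show ?thesis by (simp add: algebra_simps flip: w_def)
    qed
    ultimately show ?thesis by simp
  qed
  also have "\<dots> = (1 + q powi (2 * n + 1)) * infsum ?f UNIV + infsum ?g UNIV + infsum ?h UNIV"
    unfolding g h by (simp add: A_def)
  also have "\<dots> = (\<Sum>\<^sub>\<infinity>r. (1 + q powi (2 * n + 1)) * ?f r + ?g r + ?h r)"
    by (intro infsumI[symmetric] has_sum_add has_sum_cmult_right has_sum_infsum sf sg sh)
  also have "\<dots> = (\<Sum>\<^sub>\<infinity>r. (1 - q powi (2 * n + 1)) * (1 - q powi (2 * n + 2)) *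
      (?y r * eul q (n + 1 - r) * eul q (n + 1 + r)))"
  proof (rule infsum_cong)
    fix r
    \<comment> \<open>Every \<open>eul\<close> value is expressed through the largest indices, as a
      multiple of \<open>E\<close> or \<open>F\<close>. What remains is a polynomial identity in
      \<open>q\<close>, \<open>a\<close>, \<open>b\<close>.\<close>
    define a b where "a = q powi (n - r)" and "b = q powi (n + r)"
    define E F where "E = eul q (n + 1 - r)" and "F = eul q (n + 1 + r)"
    have e1: "eul q (n - r) = (1 - q * a) * E" "eul q (n + r) = (1 - q * b) * F"
      using eul_rec'[OF q(2), of "n - r"] eul_rec'[OF q(2), of "n + r"] q
      by (simp_all add: a_def b_def E_def F_def algebra_simps power_int_add power_int_diff)
    have e2: "eul q (n - r - 1) = (1 - a) * ((1 - q * a) * E)" "eul q (n + r - 1) = (1 - b) * ((1 - q * b) * F)"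
      using eul_rec[OF q(2), of "n - r"] eul_rec[OF q(2), of "n + r"] e1
      by (simp_all add: a_def b_def)
    have e3: "eul q (n - r + 1) = E" "eul q (n + r + 1) = F"
      by (simp_all add: E_def F_def algebra_simps)
    have e4: "q powi (2 * n + 1) = q * (a * b)" "q powi (2 * n + 2) = q * q * (a * b)"
         "q powi (n - r + 1) = q * a" "q powi (n + r + 1) = q * b"
      using q by (simp_all add: a_def b_def power_int_add power_int_diff powi_double power2_eq_square)
    show "(1 + q powi (2 * n + 1)) * ?f r + ?g r + ?h r
      = (1 - q powi (2 * n + 1)) * (1 - q powi (2 * n + 2)) * (?y r * eul q (n + 1 - r) * eul q (n + 1 + r))"
      unfolding e1 e2 e3 e4 E_def[symmetric] F_def[symmetric] by (simp add: algebra_simps)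
  qed
  also have "\<dots> = (1 - q powi (2 * n + 1)) * (1 - q powi (2 * n + 2)) * A (n + 1)"
    unfolding A_def by (simp add: infsum_cmult_right')
  finally show ?thesis .
qed

text \<open>The finite Jacobi triple product, a centred q-binomial theorem. The zeros of
  \<open>eul\<close> restrict the sum to |r| at most \<open>n\<close>.\<close>

lemma jterm_eul_sum:
  assumes q: "q \<noteq> 0" "norm q < 1" and z: "z \<noteq> 0"
  shows "(\<Sum>\<^sub>\<infinity>r. jterm z q r * eul q (int n - r) * eul q (int n + r)) * qpoch q q (2 * n)
    = qpoch z q n * qpoch (q / z) q n"
proof (induction n)
  case 0
  have "(\<Sum>\<^sub>\<infinity>r. jterm z q r * eul q (int 0 - r) * eul q (int 0 + r)) = 1"
    by (subst infsum_only_0) (auto simp: jterm_def eul_def)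
  then show ?case by simp
next
  case (Suc n)
  define A where "A = (\<lambda>n. \<Sum>\<^sub>\<infinity>r. jterm z q r * eul q (n - r) * eul q (n + r))"
  have p: "q powi int n = q ^ n" "q powi (int n + 1) = q * q ^ n"
    "q powi (2 * int n + 1) = q * q ^ (2 * n)" "q powi (2 * int n + 2) = q * q * q ^ (2 * n)"
    using q by (simp_all add: power_int_add power_mult power_int_mult power2_eq_square)
  have rec: "(1 - z * q ^ n) * (1 - q * q ^ n / z) * A (int n)
      = (1 - q * q ^ (2 * n)) * (1 - q * q * q ^ (2 * n)) * A (int n + 1)"
    using jterm_eul_sum_rec[OF q z, of "int n"] unfolding p A_def .
  have "A (int (Suc n)) * qpoch q q (2 * Suc n)
     = (1 - q * q ^ (2 * n)) * (1 - q * q * q ^ (2 * n)) * A (int n + 1) * qpoch q q (2 * n)"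
    by (simp add: qpoch_Suc add.commute mult_ac)
  also have "\<dots> = (1 - z * q ^ n) * (1 - q * q ^ n / z) * (A (int n) * qpoch q q (2 * n))"
    unfolding rec[symmetric] by simp
  also have "A (int n) * qpoch q q (2 * n) = qpoch z q n * qpoch (q / z) q n"
    using Suc by (simp add: A_def)
  finally show ?case by (simp add: A_def qpoch_Suc mult_ac)
qed

text \<open>Let \<open>n\<close> tend to infinity in the finite form. Both reciprocal factorials
  tend to 1/(q;q)_inf, and their boundedness makes a multiple of |jterm z q r| a majorant.\<close>

theorem jacobi_triple_product:
  assumes q: "q \<noteq> 0" "norm q < 1" and z: "norm q \<le> norm z" "norm z \<le> 1"
  shows "jtheta z q = qpoch_inf z q * qpoch_inf (q / z) q * qpoch_inf q q"
proof -
  have z0: "z \<noteq> 0" using q z by auto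
  let ?f = "\<lambda>n r. jterm z q r * eul q (int n - r) * eul q (int n + r)"
  obtain B where B: "B > 0" "\<And>k. norm (eul q k) \<le> B" using eul_bounded[OF q(2)] by blast
  let ?c = "1 / qpoch_inf q q"
  have "(\<lambda>n. infsum (?f n) UNIV) \<longlonglongrightarrow> (\<Sum>\<^sub>\<infinity>r. jterm z q r * ?c * ?c)"
  proof (rule infsum_dominated_convergence)
    show "(\<lambda>n. ?f n r) \<longlonglongrightarrow> jterm z q r * ?c * ?c" for r
      using eul_LIMSEQ[OF q(2), of "- r"] eul_LIMSEQ[OF q(2), of r]
      by (intro tendsto_mult tendsto_const) simp_all
    show "norm (?f n r) \<le> norm (jterm z q r) * (B * B)" for n r
      unfolding norm_mult mult.assoc by (intro mult_left_mono mult_mono B norm_ge_zero) (use B in auto)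
    show "(\<lambda>r. norm (jterm z q r) * (B * B)) summable_on UNIV"
      by (intro summable_on_cmult_left abs_summable_jterm assms)
  qed
  then have "(\<lambda>n. infsum (?f n) UNIV * qpoch q q (2 * n)) \<longlonglongrightarrow> (\<Sum>\<^sub>\<infinity>r. jterm z q r * ?c * ?c) * qpoch_inf q q"
    by (rule tendsto_mult) (use LIMSEQ_subseq_LIMSEQ[OF qpoch_LIMSEQ[OF q(2)], of "\<lambda>n. 2 * n" q] in \<open>simp add: o_def strict_mono_def\<close>)
  then have "(\<lambda>n. qpoch z q n * qpoch (q / z) q n) \<longlonglongrightarrow> (\<Sum>\<^sub>\<infinity>r. jterm z q r * ?c * ?c) * qpoch_inf q q"
    unfolding jterm_eul_sum[OF q z0] .
  moreover have "(\<lambda>n. qpoch z q n * qpoch (q / z) q n) \<longlonglongrightarrow> qpoch_inf z q * qpoch_inf (q / z) q"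
    by (intro tendsto_mult qpoch_LIMSEQ q)
  ultimately have "(\<Sum>\<^sub>\<infinity>r. jterm z q r * ?c * ?c) * qpoch_inf q q = qpoch_inf z q * qpoch_inf (q / z) q"
    by (rule LIMSEQ_unique)
  moreover have "(\<Sum>\<^sub>\<infinity>r. jterm z q r * ?c * ?c) = jtheta z q * ?c * ?c"
    unfolding jtheta_def by (simp only: infsum_cmult_left')
  ultimately show ?thesis
    using qpoch_inf_nonzero[OF q(2) q(2)] by (simp add: field_simps)
qed

section \<open>The Bailey pairs behind two identities of Slater\<close>

lemma norm_minus_one_powi [simp]: "norm ((-1::complex) powi n) = 1"
  by (simp add: norm_power_int)

lemma minus_one_powi_minus [simp]: "(-1::complex) powi (- n) = (-1) powi n"
  by (simp add: power_int_minus_left)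

lemma infsum_eq_add_cmult:
  fixes f g h :: "int \<Rightarrow> complex"
  assumes "f summable_on UNIV" "g summable_on UNIV" "\<And>r. h r = f r + c * g r"
  shows "infsum h UNIV = infsum f UNIV + c * infsum g UNIV"
  unfolding assms(3) by (intro infsumI has_sum_add has_sum_cmult_right has_sum_infsum assms)

text \<open>The defining sum of a Bailey pair in base x^2, written bilaterally with alpha_r = (-1)^r
  x^(3 tri r + a r). Up to normalisation, \<open>s = 0\<close> and \<open>s = 1\<close> are the
  pairs relative to 1 and to x^2.\<close>

definition slater_sum :: "complex \<Rightarrow> int \<Rightarrow> int \<Rightarrow> int \<Rightarrow> complex" where
  "slater_sum x n s a = (\<Sum>\<^sub>\<infinity>r. (-1) powi r * x powi (3 * tri r + a * r) * eul (x\<^sup>2) (n - r) * eul (x\<^sup>2) (n + s + r))"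

lemma slater_summable:
  "(\<lambda>r. (-1) powi r * x powi (3 * tri r + a * r) * eul (x\<^sup>2) (n - r) * eul (x\<^sup>2) (n + s + r)) summable_on UNIV"
  by (rule summable_on_bounded_support[of "\<bar>n\<bar> + \<bar>s\<bar> + 2"]; auto simp: eul_def)

lemma powi_2_mult: "(x\<^sup>2) powi n = (x::complex) powi (2 * n)"
  using power_int_mult[of x 2 n] by simp

context
  fixes x :: complex
  assumes x: "x \<noteq> 0" "norm x < 1"
begin

lemma norm_x2: "norm (x\<^sup>2) < 1" "x\<^sup>2 \<noteq> 0"
  using x norm_power_less_1[of x 2] by auto

text \<open>Reflecting \<open>r\<close> to \<open>- 1 - r\<close> exchanges the two reciprocal
  factorials and changes the sign of the term. In particular the sum vanishes at
  \<open>a = 3\<close>.\<close>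

lemma slater_sum_1_reflect:
  "slater_sum x n 1 a = - (x powi (3 - a)) * slater_sum x n 1 (6 - a)"
proof -
  let ?f = "\<lambda>a r. (-1) powi r * x powi (3 * tri r + a * r) * eul (x\<^sup>2) (n - r) * eul (x\<^sup>2) (n + 1 + r)"
  have "slater_sum x n 1 a = (\<Sum>\<^sub>\<infinity>r. ?f a (- 1 - r))"
    unfolding slater_sum_def by (rule infsum_reflect_int[symmetric])
  also have "\<dots> = (\<Sum>\<^sub>\<infinity>r. - (x powi (3 - a)) * ?f (6 - a) r)"
  proof (rule infsum_cong)
    fix r
    have t: "3 * tri (- 1 - r) + a * (- 1 - r) = (3 - a) + (3 * tri r + (6 - a) * r)"
      using two_tri[of "- 1 - r"] two_tri[of r] by (simp add: algebra_simps)
    have s: "(-1::complex) powi (- 1 - r) = - ((-1) powi r)"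
      using power_int_add[of "-1::complex" "-1" "-r"] by simp
    have e: "n - (- 1 - r) = n + 1 + r" "n + 1 + (- 1 - r) = n - r" by simp_all
    have p: "x powi (3 - a + (3 * tri r + (6 - a) * r)) = x powi (3 - a) * x powi (3 * tri r + (6 - a) * r)"
      using x by (intro power_int_add) auto
    show "?f a (- 1 - r) = - (x powi (3 - a)) * ?f (6 - a) r"
      unfolding t s e p by (simp only: mult_ac mult_minus_left mult_minus_right)
  qed
  also have "\<dots> = - (x powi (3 - a)) * slater_sum x n 1 (6 - a)"
    unfolding slater_sum_def by (rule infsum_cmult_right')
  finally show ?thesis .
qed

text \<open>Here the reflection is \<open>r\<close> to \<open>- r\<close> and keeps the sign; it is
  used to identify the values at \<open>a = 1\<close> and \<open>a = 2\<close>.\<close>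

lemma slater_sum_0_reflect: "slater_sum x n 0 a = slater_sum x n 0 (3 - a)"
proof -
  let ?f = "\<lambda>a r. (-1) powi r * x powi (3 * tri r + a * r) * eul (x\<^sup>2) (n - r) * eul (x\<^sup>2) (n + 0 + r)"
  have "slater_sum x n 0 a = (\<Sum>\<^sub>\<infinity>r. ?f a (0 - r))"
    unfolding slater_sum_def by (rule infsum_reflect_int[symmetric])
  also have "\<dots> = (\<Sum>\<^sub>\<infinity>r. ?f (3 - a) r)"
  proof (rule infsum_cong)
    fix r
    have t: "3 * tri (0 - r) + a * (0 - r) = 3 * tri r + (3 - a) * r"
      using two_tri[of "0 - r"] two_tri[of r] by (simp add: algebra_simps)
    have e: "n - (0 - r) = n + 0 + r" "n + 0 + (0 - r) = n - r" by simp_all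
    show "?f a (0 - r) = ?f (3 - a) r"
      unfolding t e by (simp add: mult_ac)
  qed
  finally show ?thesis unfolding slater_sum_def .
qed

text \<open>The two \<open>q\<close>-Pascal rules, from
  \<open>1 - b\<^bsup>i+j\<^esup> = (1 - b\<^bsup>j\<^esup>) + b\<^bsup>j\<^esup> (1 - b\<^bsup>i\<^esup>)\<close> applied to
  \<open>1/((b;b)\<^sub>i (b;b)\<^sub>j)\<close> with \<open>b = x\<^sup>2\<close>, \<open>i = n - r\<close>, \<open>j = n + s + r\<close>.\<close>

lemma slater_sum_pascal1:
  "(1 - x powi (4 * n + 2)) * slater_sum x n 1 a
     = slater_sum x n 0 a - x powi (2 * n + 3 - a) * slater_sum x n 0 (a - 1)"
proof -
  let ?e = "eul (x\<^sup>2)"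
  let ?f = "\<lambda>n s a r. (-1) powi r * x powi (3 * tri r + a * r) * ?e (n - r) * ?e (n + s + r)"
  let ?g = "\<lambda>r. x powi (3 * tri r + a * r + (2 * n + 2 * r + 2)) * ((-1) powi r * ?e (n - r - 1) * ?e (n + 1 + r))"
  have sg: "?g summable_on UNIV"
    by (rule summable_on_bounded_support[of "\<bar>n\<bar> + 3"]; auto simp: eul_def)
  have "(1 - x powi (4 * n + 2)) * slater_sum x n 1 a = (\<Sum>\<^sub>\<infinity>r. (1 - x powi (4 * n + 2)) * ?f n 1 a r)"
    unfolding slater_sum_def by (rule infsum_cmult_right'[symmetric])
  also have "\<dots> = infsum (?f n 0 a) UNIV + 1 * infsum ?g UNIV"
  proof (rule infsum_eq_add_cmult[OF slater_summable sg])
    fix r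
    define A B where "A = x powi (2 * (n - r))" and "B = x powi (2 * (n + 1 + r))"
    have 1: "?e (n - r - 1) = (1 - A) * ?e (n - r)" "?e (n + 0 + r) = (1 - B) * ?e (n + 1 + r)"
      using eul_rec[OF norm_x2(1), of "n - r"] eul_rec[OF norm_x2(1), of "n + 1 + r"]
      by (simp_all add: A_def B_def powi_2_mult)
    have 2: "x powi (4 * n + 2) = A * B"
      using x by (simp add: A_def B_def flip: power_int_add)
    have 3: "x powi (3 * tri r + a * r + (2 * n + 2 * r + 2)) = x powi (3 * tri r + a * r) * B"
      using x by (simp add: B_def flip: power_int_add) (simp add: algebra_simps)
    show "(1 - x powi (4 * n + 2)) * ?f n 1 a r = ?f n 0 a r + 1 * ?g r"
      unfolding 1 2 3 by (simp add: algebra_simps)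
  qed
  also have "infsum ?g UNIV = (\<Sum>\<^sub>\<infinity>r. - (x powi (2 * n + 3 - a)) * ?f n 0 (a - 1) (r + 1))"
  proof (rule infsum_cong)
    fix r
    have t: "3 * tri r + a * r + (2 * n + 2 * r + 2) = (2 * n + 3 - a) + (3 * tri (r + 1) + (a - 1) * (r + 1))"
      by (simp add: tri_add algebra_simps)
    have s: "(-1::complex) powi (r + 1) = - ((-1) powi r)"
      by (simp add: power_int_add)
    have e: "n - (r + 1) = n - r - 1" "n + 0 + (r + 1) = n + 1 + r" by simp_all
    have p: "x powi (2 * n + 3 - a + (3 * tri (r + 1) + (a - 1) * (r + 1)))
       = x powi (2 * n + 3 - a) * x powi (3 * tri (r + 1) + (a - 1) * (r + 1))"
      using x by (intro power_int_add) auto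
    show "?g r = - (x powi (2 * n + 3 - a)) * ?f n 0 (a - 1) (r + 1)"
      unfolding t s e p by (simp only: mult_ac mult_minus_left mult_minus_right minus_minus)
  qed
  also have "\<dots> = - (x powi (2 * n + 3 - a)) * (\<Sum>\<^sub>\<infinity>r. ?f n 0 (a - 1) (r + 1))"
    by (rule infsum_cmult_right')
  also have "(\<Sum>\<^sub>\<infinity>r. ?f n 0 (a - 1) (r + 1)) = infsum (?f n 0 (a - 1)) UNIV"
    by (rule infsum_shift_int)
  finally show ?thesis unfolding slater_sum_def by simp
qed

lemma slater_sum_pascal2:
  "(1 - x powi (4 * n + 4)) * slater_sum x (n + 1) 0 a
     = slater_sum x n 1 (3 - a) + x powi (2 * n + 2) * slater_sum x n 1 (a + 2)"
proof -
  let ?e = "eul (x\<^sup>2)"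
  let ?f = "\<lambda>n s a r. (-1) powi r * x powi (3 * tri r + a * r) * ?e (n - r) * ?e (n + s + r)"
  let ?g = "\<lambda>r. (-1) powi r * x powi (3 * tri r + a * r) * ?e (n + 1 - r) * ?e (n + r)"
  have sg: "?g summable_on UNIV"
    by (rule summable_on_bounded_support[of "\<bar>n\<bar> + 3"]; auto simp: eul_def)
  have "(1 - x powi (4 * n + 4)) * slater_sum x (n + 1) 0 a = (\<Sum>\<^sub>\<infinity>r. (1 - x powi (4 * n + 4)) * ?f (n + 1) 0 a r)"
    unfolding slater_sum_def by (rule infsum_cmult_right'[symmetric])
  also have "\<dots> = infsum ?g UNIV + x powi (2 * n + 2) * infsum (?f n 1 (a + 2)) UNIV"
  proof (rule infsum_eq_add_cmult[OF sg slater_summable])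
    fix r
    define A B where "A = x powi (2 * (n + 1 - r))" and "B = x powi (2 * (n + 1 + r))"
    have 1: "?e (n - r) = (1 - A) * ?e (n + 1 - r)" "?e (n + r) = (1 - B) * ?e (n + 1 + r)"
      using eul_rec[OF norm_x2(1), of "n + 1 - r"] eul_rec[OF norm_x2(1), of "n + 1 + r"]
      by (simp_all add: A_def B_def powi_2_mult)
    have 2: "x powi (4 * n + 4) = A * B"
      using x by (simp add: A_def B_def flip: power_int_add)
    have 3: "x powi (2 * n + 2) * x powi (3 * tri r + (a + 2) * r) = x powi (3 * tri r + a * r) * B"
      using x by (simp add: B_def flip: power_int_add) (simp add: algebra_simps)
    have "x powi (2 * n + 2) * ?f n 1 (a + 2) r
       = (x powi (2 * n + 2) * x powi (3 * tri r + (a + 2) * r)) * ((-1) powi r * ?e (n - r) * ?e (n + 1 + r))"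
      by (simp only: mult_ac)
    then show "(1 - x powi (4 * n + 4)) * ?f (n + 1) 0 a r = ?g r + x powi (2 * n + 2) * ?f n 1 (a + 2) r"
      unfolding 1 2 3 by (simp add: algebra_simps)
  qed
  \<comment> \<open>In \<open>?g\<close> the roles of the two factorials are exchanged compared with
    \<open>s = 1\<close>. Reflecting \<open>r\<close> restores them and turns \<open>a\<close> into
    \<open>3 - a\<close>.\<close>
  also have "infsum ?g UNIV = (\<Sum>\<^sub>\<infinity>r. ?g (0 - r))"
    by (rule infsum_reflect_int[symmetric])
  also have "\<dots> = infsum (?f n 1 (3 - a)) UNIV"
  proof (rule infsum_cong)
    fix r
    have t: "3 * tri (0 - r) + a * (0 - r) = 3 * tri r + (3 - a) * r"
      using two_tri[of "0 - r"] two_tri[of r] by (simp add: algebra_simps)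
    have e: "n + 1 - (0 - r) = n + 1 + r" "n + (0 - r) = n - r" by simp_all
    show "?g (0 - r) = ?f n 1 (3 - a) r"
      unfolding t e by (simp add: mult_ac)
  qed
  finally show ?thesis unfolding slater_sum_def .
qed

lemma norm_powi_less_1: "k > 0 \<Longrightarrow> norm (x powi k) < 1"
  using x norm_power_less_1[of x "nat k"] by (simp add: power_int_def)

lemma one_minus_powi_neq_0: "k > 0 \<Longrightarrow> 1 - x powi k \<noteq> 0"
  using norm_powi_less_1[of k] by auto

lemma one_plus_powi_neq_0: "k > 0 \<Longrightarrow> 1 + x powi k \<noteq> 0"
  using norm_powi_less_1[of k] by (metis add_eq_0_iff norm_minus_cancel norm_one order_less_irrefl add.inverse_inverse)

definition slater_beta :: "nat \<Rightarrow> complex" where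
  "slater_beta n = 1 / (qpoch (x ^ 4) (x ^ 4) n * qpoch (- x) (x\<^sup>2) n)"

lemma qpoch_minus_x_nonzero: "qpoch (- x) (x\<^sup>2) n \<noteq> 0"
  using x norm_x2 by (intro qpoch_nonzero) auto

lemma slater_beta_Suc:
  "(1 - x powi (4 * int n + 4)) * (1 + x powi (2 * int n + 1)) * slater_beta (Suc n) = slater_beta n"
proof -
  have 1: "x ^ 4 * (x ^ 4) ^ n = x powi (4 * int n + 4)"
  proof -
    have "x powi (int (4 * n + 4)) = x ^ 4 * (x ^ 4) ^ n"
      unfolding power_int_of_nat by (simp add: power_add power_mult)
    then show ?thesis by simp
  qed
  have 2: "- x * (x\<^sup>2) ^ n = - (x powi (2 * int n + 1))"
  proof -
    have "x powi (int (2 * n + 1)) = x * (x\<^sup>2) ^ n"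
      unfolding power_int_of_nat by (simp add: power_mult)
    then show ?thesis by (simp add: add.commute)
  qed
  show ?thesis
    using one_minus_powi_neq_0[of "4 * int n + 4"] one_plus_powi_neq_0[of "2 * int n + 1"]
    unfolding slater_beta_def qpoch_Suc 1 2 by simp
qed

text \<open>The first Pascal rule leads from level \<open>n\<close> with \<open>s = 0\<close> to
  \<open>s = 1\<close>, the second on to level \<open>n + 1\<close> with \<open>s = 0\<close>. Since
  the rules couple the parameters, the values at \<open>a = 2\<close> and \<open>a = 0\<close> are
  carried through the induction together, and the reflections supply \<open>a = 1\<close>,
  \<open>3\<close> and \<open>4\<close>.\<close>

lemma slater_sum_eq:
  "slater_sum x (int n) 0 2 = slater_beta n \<and> slater_sum x (int n) 0 0 = x powi (2 * int n) * slater_beta n"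
proof (induction n)
  case 0
  have "slater_sum x (int 0) 0 a = 1" for a
    unfolding slater_sum_def by (subst infsum_only_0) (auto simp: eul_def)
  then show ?case by (simp add: slater_beta_def)
next
  case (Suc n)
  let ?A = "slater_beta n" and ?N = "int n"
  let ?S = "slater_sum x ?N 1" and ?y = "x powi (2 * ?N + 1)"
  have y2: "x powi (4 * ?N + 2) = ?y * ?y" "x powi (2 * ?N + 2) * x powi (2 * ?N) = ?y * ?y"
    using x by (simp_all flip: power_int_add)
  have nz: "1 - x powi (4 * ?N + 2) \<noteq> 0" "1 - x powi (4 * ?N + 4) \<noteq> 0" "1 + ?y \<noteq> 0"
    by (intro one_minus_powi_neq_0 one_plus_powi_neq_0; simp)+
  have A: "slater_sum x ?N 0 2 = ?A" "slater_sum x ?N 0 1 = ?A" "slater_sum x ?N 0 0 = x powi (2 * ?N) * ?A"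
    using Suc slater_sum_0_reflect[of ?N 1] by simp_all
  have "(1 - x powi (4 * ?N + 2)) * ?S 1 = ?A - x powi (2 * ?N + 2) * (x powi (2 * ?N) * ?A)"
    using slater_sum_pascal1[of ?N 1] A by (simp add: add.commute)
  also have "\<dots> = (1 - x powi (4 * ?N + 2)) * ?A"
    unfolding mult.assoc[symmetric] y2 by (simp add: algebra_simps)
  finally have S1: "?S 1 = ?A" using nz by simp
  have "(1 - x powi (4 * ?N + 2)) * ?S 2 = (1 - ?y) * ?A"
    using slater_sum_pascal1[of ?N 2] A by (simp add: algebra_simps)
  also have "1 - x powi (4 * ?N + 2) = (1 - ?y) * (1 + ?y)"
    unfolding y2 by (simp add: algebra_simps)
  finally have S2: "(1 + ?y) * ?S 2 = ?A"
    using one_minus_powi_neq_0[of "2 * ?N + 1"] by (simp add: mult.assoc)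
  have S3: "?S 3 = 0"
    using slater_sum_1_reflect[of ?N 3] by simp
  have S4: "?S 4 = - (x powi (- 1)) * ?S 2"
    using slater_sum_1_reflect[of ?N 4] by simp
  have y1: "x powi (2 * ?N + 2) * x powi (- 1) = ?y"
    using x power_int_add[of x "2 * ?N + 2" "- 1"] by (simp add: add.commute)
  let ?z = "1 - x powi (4 * ?N + 4)"
  have "?z * slater_sum x (?N + 1) 0 2 = ?S 1 + x powi (2 * ?N + 2) * ?S 4"
    using slater_sum_pascal2[of ?N 2] by simp
  also have "\<dots> = ?A - ?y * ?S 2" unfolding S1 S4 y1[symmetric] by simp
  also have "\<dots> = ?S 2" unfolding S2[symmetric] by (simp add: algebra_simps)
  finally have *: "?z * slater_sum x (?N + 1) 0 2 = ?S 2" .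
  have "(1 + ?y) * (?z * slater_sum x (?N + 1) 0 2) = (1 + ?y) * (?z * slater_beta (Suc n))"
    unfolding * S2 using slater_beta_Suc[of n] by (simp add: mult_ac)
  then have B: "slater_sum x (?N + 1) 0 2 = slater_beta (Suc n)"
    using nz by simp
  have "?z * slater_sum x (?N + 1) 0 0 = x powi (2 * ?N + 2) * ?S 2"
    using slater_sum_pascal2[of ?N 0] S3 by simp
  then have "?z * slater_sum x (?N + 1) 0 0 = ?z * (x powi (2 * ?N + 2) * slater_beta (Suc n))"
    using * B by (simp add: mult_ac)
  then have "slater_sum x (?N + 1) 0 0 = x powi (2 * ?N + 2) * slater_beta (Suc n)"
    using nz by simp
  with B show ?case by (simp add: algebra_simps)
qed

text \<open>The pair with \<open>s = 1\<close> has the same beta sequence, so both Slater identities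
  can use the same weights up to the power of x.\<close>

lemma slater_sum_1_eq: "slater_sum x (int n) 1 1 = slater_beta n"
proof -
  let ?A = "slater_beta n" and ?N = "int n"
  have "(1 - x powi (4 * ?N + 2)) * slater_sum x ?N 1 1 = ?A - x powi (2 * ?N + 2) * (x powi (2 * ?N) * ?A)"
    using slater_sum_pascal1[of ?N 1] slater_sum_0_reflect[of ?N 1] slater_sum_eq[of n] by (simp add: add.commute)
  also have "\<dots> = (1 - x powi (2 * ?N + 2) * x powi (2 * ?N)) * ?A"
    by (simp add: algebra_simps)
  also have "x powi (2 * ?N + 2) * x powi (2 * ?N) = x powi (4 * ?N + 2)"
    using x by (simp flip: power_int_add)
  finally show ?thesis using one_minus_powi_neq_0[of "4 * ?N + 2"] by simp
qed

end

section \<open>The 1phi1 summation\<close>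

lemma qpoch_bounded:
  assumes "norm q < 1"
  shows "\<exists>C>0. \<forall>n. norm (qpoch a q n) \<le> C"
  using convergent_imp_Bseq[OF convergentI[OF qpoch_LIMSEQ[OF assms, of a]]] unfolding Bseq_def by blast

lemma qpoch_add: "qpoch a q (m + n) = qpoch a q m * qpoch (a * q ^ m) q n"
  by (induction n) (simp_all add: qpoch_Suc power_add mult_ac)

lemma norm_jterm_le_nonneg:
  assumes "m \<ge> 0" "norm z \<le> 1"
  shows "norm (jterm z q m) \<le> norm q powi (tri \<bar>m\<bar>)"
proof -
  have "norm (jterm z q m) = norm z ^ nat m * norm q powi tri m"
    using assms(1) power_int_of_nat[of "norm z" "nat m"] by (simp add: jterm_def norm_mult norm_power_int)
  also have "\<dots> \<le> 1 * norm q powi tri m"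
    using assms(2) by (intro mult_right_mono power_le_one) auto
  finally show ?thesis using assms(1) by simp
qed

text \<open>With coefficients supported on nonnegative \<open>m\<close> the majorant is uniform in
  |z| at most 1, which permits replacing \<open>z\<close> by \<open>z * b ^ n\<close> and letting it
  shrink to 0.\<close>

lemma abs_summable_jterm_nonneg:
  assumes "b \<noteq> 0" "norm b < 1" "norm z \<le> 1"
    and c: "\<And>m. m < 0 \<Longrightarrow> c m = 0" "\<And>m. norm (c m) \<le> C"
  shows "(\<lambda>m. norm (jterm z b m * c m)) summable_on UNIV"
    and "norm (jterm z b m * c m) \<le> norm b powi (tri \<bar>m\<bar>) * C"
proof -
  have C: "0 \<le> C" using c(2)[of 0] norm_ge_zero order_trans by blast
  show bound: "norm (jterm z b m * c m) \<le> norm b powi (tri \<bar>m\<bar>) * C" for m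
  proof (cases "m < 0")
    case False
    then show ?thesis
      unfolding norm_mult by (intro mult_mono norm_jterm_le_nonneg c assms) auto
  qed (use c(1) C in simp)
  show "(\<lambda>m. norm (jterm z b m * c m)) summable_on UNIV"
    by (rule Infinite_Sum.abs_summable_on_comparison_test'[OF _ bound])
      (intro summable_on_cmult_left summable_powi_tri_abs assms)
qed

text \<open>The \<open>\<^sub>1\<phi>\<^sub>1\<close> summation, with \<open>1/(b;b)\<^sub>m\<^sub>+\<^sub>N\<close> in place of
  \<open>1/((b;b)\<^sub>N (b\<^bsup>N+1\<^esup>;b)\<^sub>m)\<close>. Raising \<open>N\<close> by one costs the factor \<open>1 - z\<close> by telescoping.\<close>

context
  fixes a b :: complex
  assumes b: "b \<noteq> 0" "norm b < 1"
begin

definition phi11_term :: "complex \<Rightarrow> int \<Rightarrow> int \<Rightarrow> complex" where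
  "phi11_term z N m = jterm z b m * (qpoch a b (nat m) * eul b m * eul b (m + N))"

lemma phi11_rec:
  assumes z: "a * z = b powi (N + 1)" "norm z \<le> 1"
  shows "infsum (phi11_term z N) UNIV = (1 - z) * infsum (phi11_term (z * b) (N + 1)) UNIV"
proof -
  have z0: "z \<noteq> 0" using z b by auto
  obtain C where C: "C > 0" "\<And>n. norm (qpoch a b n) \<le> C" using qpoch_bounded[OF b(2)] by blast
  obtain B where B: "B > 0" "\<And>k. norm (eul b k) \<le> B" using eul_bounded[OF b(2)] by blast
  have bd: "norm (qpoch a b n * eul b k * eul b l) \<le> C * B * B" for n k l
    unfolding norm_mult by (intro mult_mono C B) (use B C in auto)
  \<comment> \<open>The telescoping partner: the terms of the two sides differ by
    \<open>V m - V (m + 1)\<close>, and the two sums of \<open>V\<close> cancel.\<close>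
  define V where "V = (\<lambda>m. jterm z b m * (qpoch a b (nat m) * eul b (m - 1) * eul b (m + N)))"
  have zb: "norm (z * b) \<le> 1"
    unfolding norm_mult using z(2) b(2) by (intro mult_le_one) auto
  have s1: "(\<lambda>m. norm (phi11_term (z * b) (N + 1) m)) summable_on UNIV"
    unfolding phi11_term_def by (rule abs_summable_jterm_nonneg(1)[OF b zb _ bd]) simp
  have sV: "(\<lambda>m. norm (V m)) summable_on UNIV"
    unfolding V_def by (rule abs_summable_jterm_nonneg(1)[OF b z(2) _ bd]) simp
  have sV1: "(\<lambda>m. V (m + 1)) summable_on UNIV"
    using summable_on_reindex_bij_witness[of UNIV "\<lambda>n. n - 1" "\<lambda>n. n + 1" UNIV V "\<lambda>m. V (m + 1)"]
      abs_summable_summable[OF sV] by simp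
  have eq: "phi11_term z N m = (1 - z) * phi11_term (z * b) (N + 1) m + V m + (-1) * V (m + 1)" for m
  proof (cases "m < 0")
    case True
    then show ?thesis by (simp add: V_def phi11_term_def)
  next
    case False
    then obtain k where k: "m = int k" by (metis nonneg_int_cases linorder_not_less)
    define X where "X = jterm z b m * qpoch a b k * eul b m * eul b (m + N + 1)"
    have n: "nat (m + 1) = Suc k" "nat m = k" using k by (simp_all add: nat_add_distrib)
    \<comment> \<open>The condition on \<open>a * z\<close> enters here: it makes the factor of the
      recurrence for \<open>eul b (m + N + 1)\<close> equal to
      \<open>1 - b ^ k * (a * z)\<close>.\<close>
    have p: "b powi m = b ^ k" "b powi (m + N + 1) = b ^ k * (a * z)"
      unfolding k z(1) using b by (simp_all add: power_int_add)
    have 1: "phi11_term z N m = (1 - b ^ k * (a * z)) * X"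
      using eul_rec[OF b(2), of "m + N + 1"] by (simp add: phi11_term_def X_def n p mult_ac)
    have "jterm (z * b) b m = b ^ k * jterm z b m"
      using b by (simp add: jterm_def power_int_mult_distrib p mult_ac)
    then have 2: "phi11_term (z * b) (N + 1) m = b ^ k * X"
      by (simp add: phi11_term_def X_def n mult_ac add.assoc)
    have 3: "V m = (1 - b ^ k) * (1 - b ^ k * (a * z)) * X"
      using eul_rec[OF b(2), of "m + N + 1"] eul_rec[OF b(2), of m]
      by (simp add: V_def X_def n p mult_ac)
    have 4: "V (m + 1) = - (1 - a * b ^ k) * z * b ^ k * X"
    proof -
      have "V (m + 1) = (- z * b ^ k * jterm z b m) * (qpoch a b k * (1 - a * b ^ k) * eul b m * eul b (m + N + 1))"
        unfolding V_def n jterm_Suc[OF b(1) z0] qpoch_Suc p by (simp add: add_ac)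
      then show ?thesis by (simp add: X_def algebra_simps)
    qed
    show ?thesis unfolding 1 2 3 4 by (simp add: algebra_simps)
  qed
  have "infsum (phi11_term z N) UNIV
      = (1 - z) * infsum (phi11_term (z * b) (N + 1)) UNIV + infsum V UNIV + (-1) * (\<Sum>\<^sub>\<infinity>m. V (m + 1))"
    unfolding eq
    by (intro infsumI has_sum_add has_sum_cmult_right has_sum_infsum sV1
        abs_summable_summable[OF sV] abs_summable_summable[OF s1])
  then show ?thesis using infsum_shift_int[of V 1] by simp
qed

lemma phi11_rec_iter:
  assumes z: "a * z = b powi (N + 1)" "norm z \<le> 1"
  shows "infsum (phi11_term z N) UNIV = qpoch z b n * infsum (phi11_term (z * b ^ n) (N + int n)) UNIV"
proof (induction n)
  case (Suc n)
  have "infsum (phi11_term (z * b ^ n) (N + int n)) UNIV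
     = (1 - z * b ^ n) * infsum (phi11_term (z * b ^ n * b) (N + int n + 1)) UNIV"
  proof (rule phi11_rec)
    have "a * (z * b ^ n) = b powi (N + 1) * b powi int n" using z(1) by (simp add: mult.assoc[symmetric])
    also have "\<dots> = b powi (N + int n + 1)"
      using b by (simp add: power_int_add mult_ac)
    finally show "a * (z * b ^ n) = b powi (N + int n + 1)" .
    show "norm (z * b ^ n) \<le> 1"
      unfolding norm_mult norm_power using z(2) b(2) by (intro mult_le_one power_le_one) auto
  qed
  then show ?case using Suc by (simp add: qpoch_Suc mult_ac add_ac)
qed simp

text \<open>Iteration sends \<open>z\<close> to 0 and \<open>N\<close> to infinity. Only the term
  \<open>m = 0\<close> survives, with value 1/(b;b)_inf, and the accumulated factors 1 - z b^k form
  (z;b)_inf.\<close>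

lemma phi11_sum:
  assumes z: "a * z = b powi (N + 1)" "norm z \<le> 1"
  shows "infsum (phi11_term z N) UNIV = qpoch_inf z b / qpoch_inf b b"
proof -
  obtain C where C: "C > 0" "\<And>n. norm (qpoch a b n) \<le> C" using qpoch_bounded[OF b(2)] by blast
  obtain B where B: "B > 0" "\<And>k. norm (eul b k) \<le> B" using eul_bounded[OF b(2)] by blast
  have bd: "norm (qpoch a b n * eul b k * eul b l) \<le> C * B * B" for n k l
    unfolding norm_mult by (intro mult_mono C B) (use B C in auto)
  let ?g = "\<lambda>m::int. if m = 0 then 1 / qpoch_inf b b else 0"
  have zb: "norm (z * b ^ n) \<le> 1" for n
    unfolding norm_mult norm_power using z(2) b(2) by (intro mult_le_one power_le_one) auto
  have "(\<lambda>n. infsum (phi11_term (z * b ^ n) (N + int n)) UNIV) \<longlonglongrightarrow> infsum ?g UNIV"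
  proof (rule infsum_dominated_convergence)
    show "norm (phi11_term (z * b ^ n) (N + int n) m) \<le> norm b powi (tri \<bar>m\<bar>) * (C * B * B)" for n m
      unfolding phi11_term_def by (rule abs_summable_jterm_nonneg(2)[OF b zb _ bd]) simp
    show "(\<lambda>m. norm b powi (tri \<bar>m\<bar>) * (C * B * B)) summable_on UNIV"
      by (intro summable_on_cmult_left summable_powi_tri_abs b)
    show "(\<lambda>n. phi11_term (z * b ^ n) (N + int n) m) \<longlonglongrightarrow> ?g m" for m
    proof (cases "m \<le> 0")
      case True
      then show ?thesis
        using eul_LIMSEQ[OF b(2), of N] by (cases "m = 0") (auto simp: phi11_term_def jterm_def add.commute)
    next
      case False
      have "(\<lambda>n. (b ^ n) ^ nat m) \<longlonglongrightarrow> 0 ^ nat m"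
        by (intro tendsto_power LIMSEQ_power_zero b)
      then have "(\<lambda>n. jterm z b m * (qpoch a b (nat m) * eul b m) * (b ^ n) ^ nat m * eul b (int n + (m + N)))
         \<longlonglongrightarrow> jterm z b m * (qpoch a b (nat m) * eul b m) * 0 ^ nat m * (1 / qpoch_inf b b)"
        by (intro tendsto_mult tendsto_const eul_LIMSEQ b)
      moreover have "phi11_term (z * b ^ n) (N + int n) m
        = jterm z b m * (qpoch a b (nat m) * eul b m) * (b ^ n) ^ nat m * eul b (int n + (m + N))" for n
        using False by (simp add: phi11_term_def jterm_def power_int_def power_mult_distrib mult_ac add_ac)
      moreover have "(0::complex) ^ nat m = 0" using False by (simp add: power_0_left)
      ultimately show ?thesis using False by simp
    qed
  qed
  then have "(\<lambda>n. qpoch z b n * infsum (phi11_term (z * b ^ n) (N + int n)) UNIV)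
      \<longlonglongrightarrow> qpoch_inf z b * infsum ?g UNIV"
    by (intro tendsto_mult qpoch_LIMSEQ b)
  moreover have "infsum ?g UNIV = 1 / qpoch_inf b b"
    by (subst infsum_only_0) auto
  ultimately show ?thesis
    unfolding phi11_rec_iter[OF z, symmetric] by (simp add: LIMSEQ_const_iff)
qed

end

section \<open>Bailey's transform and the two Slater identities\<close>

definition slater_R :: "complex \<Rightarrow> int \<Rightarrow> complex" where
  "slater_R x k = (\<Sum>\<^sub>\<infinity>n. x powi (n * n + 2 * k * n) * eul (x ^ 4) n)"

lemma power_powi: "(x ^ n) powi m = (x :: complex) powi (int n * m)"
  using power_int_mult[of x "int n" m] by simp

text \<open>Apply the quadratic bound with slope |a| + 1: the part |a| pays for the linear term, and
  the remaining 1 leaves |r|. This supplies the exponent bounds for the summability tests.\<close>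

lemma tri_linear_ge:
  assumes "c \<ge> 1"
  shows "c * tri r + a * r \<ge> \<bar>r\<bar> - ((\<bar>a\<bar> + 1) * (\<bar>a\<bar> + 1) + 2 * (\<bar>a\<bar> + 1) + 2)"
proof -
  have "\<bar>a * r\<bar> = \<bar>a\<bar> * \<bar>r\<bar>" by (rule abs_mult)
  then have "- (\<bar>a\<bar> * \<bar>r\<bar>) \<le> a * r" by linarith
  moreover have "tri r \<ge> (\<bar>a\<bar> + 1) * \<bar>r\<bar> - (\<bar>a\<bar> + 1) * (\<bar>a\<bar> + 1) - 2 * \<bar>\<bar>a\<bar> + 1\<bar> - 2"
    by (rule tri_ge)
  moreover have "(\<bar>a\<bar> + 1) * \<bar>r\<bar> = \<bar>a\<bar> * \<bar>r\<bar> + \<bar>r\<bar>" by (simp add: algebra_simps)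
  moreover have "\<bar>\<bar>a\<bar> + 1\<bar> = \<bar>a\<bar> + 1" by simp
  moreover have "1 * tri r \<le> c * tri r" by (rule mult_right_mono[OF assms tri_nonneg])
  \<comment> \<open>With the products abstracted into variables the final estimate is purely
    linear.\<close>
  moreover have "v - (K + 2 * (u + 1) + 2) \<le> X + e"
    if "- w \<le> e" "P - K - 2 * u' - 2 \<le> T" "P = w + v" "u' = u + 1" "1 * T \<le> X" for w e P K u T u' v X :: int
    using that by (simp add: algebra_simps)
  ultimately show ?thesis by meson
qed

lemma square_ge: "n * n \<ge> 2 * m * \<bar>n\<bar> - m * (m :: int)"
proof -
  have "0 \<le> (\<bar>n\<bar> - m) * (\<bar>n\<bar> - m)" by simp
  then show ?thesis by (simp add: algebra_simps abs_mult_self_eq)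
qed

context
  fixes x :: complex
  assumes x: "x \<noteq> 0" "norm x < 1"
begin

text \<open>The conjugate Bailey sequence. Its weights x^(n^2+2sn) (-x;x^2)_n are chosen so that
  multiplication by \<open>slater_beta\<close> leaves exactly the terms of
  \<open>slater_R x s\<close>.\<close>

definition slater_gamma :: "nat \<Rightarrow> int \<Rightarrow> complex" where
  "slater_gamma s r = (\<Sum>\<^sub>\<infinity>n. x powi (n * n + 2 * int s * n) * qpoch (- x) (x\<^sup>2) (nat n)
      * (eul (x\<^sup>2) (n - r) * eul (x\<^sup>2) (n + int s + r)))"

lemma slater_gamma_reflect: "slater_gamma s (- int s - r) = slater_gamma s r"
proof -
  have "n - (- int s - r) = n + int s + r" "n + int s + (- int s - r) = n - r" for n by simp_all
  then show ?thesis
    unfolding slater_gamma_def by (intro infsum_cong) (simp only: mult.commute[of "eul _ (_ - r)" "eul _ (_ + r)"])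
qed

text \<open>After the index shift by \<open>r\<close> the series starts at 0 and is a 1phi1 sum in
  base x^2; the prefactor collects what does not depend on the new index.\<close>

lemma slater_gamma_int:
  "slater_gamma s (int r) = x powi (int r * int r + 2 * int s * int r) * qpoch (- x) (x\<^sup>2) r
     * qpoch_inf (- x * (x\<^sup>2) ^ (r + s)) (x\<^sup>2) / qpoch_inf (x\<^sup>2) (x\<^sup>2)"
proof -
  let ?b = "x\<^sup>2" and ?r = "int r" and ?s = "int s"
  let ?e = "x powi (?r * ?r + 2 * ?s * ?r) * qpoch (- x) ?b r"
  \<comment> \<open>These parameters satisfy \<open>?a * ?z = ?b powi (?N + 1)\<close>, the
    condition of the 1phi1 summation.\<close>
  let ?a = "- x * ?b ^ r" and ?z = "- x * ?b ^ (r + s)" and ?N = "2 * ?r + ?s"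
  have b: "?b \<noteq> 0" "norm ?b < 1" using norm_x2[OF x] by auto
  have zp: "?z = - (x powi (2 * ?r + 2 * ?s + 1))"
  proof -
    have "x powi (int (2 * (r + s) + 1)) = x * ?b ^ (r + s)"
      unfolding power_int_of_nat power_add power_mult by simp
    then show ?thesis by (simp add: algebra_simps)
  qed
  have "norm ?z = norm x * norm ?b ^ (r + s)" by (simp add: norm_mult norm_power)
  also have "\<dots> \<le> 1" using x b by (intro mult_le_one power_le_one) auto
  finally have z1: "norm ?z \<le> 1" .
  have "?a * ?z = ?b ^ (r + s + r + 1)"
    by (simp add: power_add power2_eq_square)
  also have "\<dots> = ?b powi int (r + s + r + 1)" by (rule power_int_of_nat[symmetric])
  finally have z2: "?a * ?z = ?b powi (?N + 1)" by (simp add: algebra_simps)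
  have "slater_gamma s ?r = (\<Sum>\<^sub>\<infinity>m. x powi ((m + ?r) * (m + ?r) + 2 * ?s * (m + ?r)) * qpoch (- x) ?b (nat (m + ?r))
      * (eul ?b (m + ?r - ?r) * eul ?b (m + ?r + ?s + ?r)))"
    unfolding slater_gamma_def by (rule infsum_shift_int[symmetric])
  also have "\<dots> = (\<Sum>\<^sub>\<infinity>m. ?e * phi11_term ?a ?b ?z ?N m)"
  proof (rule infsum_cong)
    fix m :: int
    show "x powi ((m + ?r) * (m + ?r) + 2 * ?s * (m + ?r)) * qpoch (- x) ?b (nat (m + ?r))
      * (eul ?b (m + ?r - ?r) * eul ?b (m + ?r + ?s + ?r)) = ?e * phi11_term ?a ?b ?z ?N m"
    proof (cases "m < 0")
      case True
      then show ?thesis by (simp add: phi11_term_def[OF b])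
    next
      case False
      then obtain k where k: "m = int k" by (metis nonneg_int_cases linorder_not_less)
      have q: "qpoch (- x) ?b (nat (m + ?r)) = qpoch (- x) ?b r * qpoch ?a ?b (nat m)"
        using qpoch_add[of "- x" ?b r k] by (simp add: k nat_int_add add.commute)
      have e: "m + ?r - ?r = m" "m + ?r + ?s + ?r = m + ?N" by simp_all
      have "jterm ?z ?b m = (-1) powi m * ((-1) powi m * (x powi (2 * ?r + 2 * ?s + 1)) powi m) * ?b powi tri m"
        unfolding jterm_def zp by (subst power_int_minus_left) (simp add: power_int_minus_left)
      also have "\<dots> = x powi ((2 * ?r + 2 * ?s + 1) * m + 2 * tri m)"
        using x power_int_add[of x "(2 * ?r + 2 * ?s + 1) * m" "2 * tri m"] power_int_mult[of x "2 * ?r + 2 * ?s + 1" m]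
        by (simp add: powi_2_mult power_int_minus_left)
      also have "(2 * ?r + 2 * ?s + 1) * m + 2 * tri m = m * m + 2 * ?r * m + 2 * ?s * m"
        unfolding two_tri by (simp add: algebra_simps)
      finally have j: "x powi (?r * ?r + 2 * ?s * ?r) * jterm ?z ?b m
          = x powi ((m + ?r) * (m + ?r) + 2 * ?s * (m + ?r))"
        using x by (simp flip: power_int_add) (simp add: algebra_simps)
      show ?thesis unfolding q e j[symmetric] phi11_term_def[OF b] by (simp add: mult_ac)
    qed
  qed
  also have "\<dots> = ?e * (qpoch_inf ?z ?b / qpoch_inf ?b ?b)"
    by (simp only: infsum_cmult_right' phi11_sum[OF b z2 z1])
  finally show ?thesis by simp
qed

definition slater_const :: complex where
  "slater_const = qpoch_inf (- x) (x\<^sup>2) / qpoch_inf (x\<^sup>2) (x\<^sup>2)"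

lemma one_plus_powi_odd_neq_0: "1 + x powi (2 * r + 1) \<noteq> 0"
proof (cases "2 * r + 1 > 0")
  case True
  then show ?thesis by (rule one_plus_powi_neq_0[OF x])
next
  case False
  then have "1 + x powi (- (2 * r + 1)) \<noteq> 0" by (intro one_plus_powi_neq_0[OF x]) presburger
  then show ?thesis by (metis add.inverse_inverse add_eq_0_iff inverse_1 inverse_minus_eq power_int_minus)
qed

text \<open>The finite and the infinite product join without a gap to (-x;x^2)_inf. Negative
  \<open>r\<close> follow by reflection.\<close>

lemma slater_gamma_0: "slater_gamma 0 r = x powi (r * r) * slater_const"
proof -
  have *: "slater_gamma 0 (int k) = x powi (int k * int k) * slater_const" for k
    unfolding slater_gamma_int slater_const_def
    using qpoch_inf_split[OF norm_x2(1)[OF x], of "- x" k] by simp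
  show ?thesis
  proof (cases "r \<ge> 0")
    case True
    then show ?thesis using *[of "nat r"] by simp
  next
    case False
    then show ?thesis using *[of "nat (- r)"] slater_gamma_reflect[of 0 r] by simp
  qed
qed

text \<open>For \<open>s = 1\<close> the joined product skips the single factor 1 + x^(2r+1), hence
  the denominator. Negative \<open>r\<close> are reflected to \<open>- 1 - r\<close>.\<close>

lemma slater_gamma_1: "slater_gamma 1 r = x powi (r * r + 2 * r) / (1 + x powi (2 * r + 1)) * slater_const"
proof -
  have *: "slater_gamma 1 (int k) = x powi (int k * int k + 2 * int k) / (1 + x powi (2 * int k + 1)) * slater_const" for k
  proof -
    have "x powi int (2 * k + 1) = x * (x\<^sup>2) ^ k"
      unfolding power_int_of_nat by (simp add: power_mult)
    then have p: "1 + x powi (2 * int k + 1) = 1 - (- x) * (x\<^sup>2) ^ k" by (simp add: add.commute)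
    show ?thesis
      unfolding slater_gamma_int slater_const_def p
      using qpoch_inf_split[OF norm_x2(1)[OF x], of "- x" "k + 1"] one_plus_powi_odd_neq_0[of "int k", unfolded p]
      by (simp add: qpoch_Suc)
  qed
  show ?thesis
  proof (cases "r \<ge> 0")
    case True
    then show ?thesis using *[of "nat r"] by simp
  next
    case False
    define k where "k = - 1 - r"
    have "slater_gamma 1 r = slater_gamma 1 k"
      using slater_gamma_reflect[of 1 r] by (simp add: k_def)
    also have "\<dots> = x powi (k * k + 2 * k) / (1 + x powi (2 * k + 1)) * slater_const"
      using *[of "nat k"] False by (simp add: k_def)
    also have "x powi (k * k + 2 * k) / (1 + x powi (2 * k + 1)) = x powi (r * r + 2 * r) / (1 + x powi (2 * r + 1))"
    proof -
      have 1: "x powi (2 * k + 1) * x powi (2 * r + 1) = 1"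
        using x by (simp add: k_def flip: power_int_add)
      have 2: "x powi (r * r + 2 * r) = x powi (k * k + 2 * k) * x powi (2 * r + 1)"
        using x by (simp flip: power_int_add) (simp add: k_def algebra_simps)
      show ?thesis unfolding 2
        using 1 one_plus_powi_odd_neq_0[of k] one_plus_powi_odd_neq_0[of r]
        by (simp add: field_simps)
    qed
    finally show ?thesis .
  qed
qed

text \<open>Bailey's transform: inserting the double series and exchanging the order of summation
  turns the sum of beta_n delta_n into the sum of alpha_r gamma_r.\<close>

lemma slater_bailey:
  fixes s :: nat and a :: int
  assumes s1: "s \<le> 1" and s: "\<And>n. slater_sum x (int n) (int s) a = slater_beta x n"
  shows "slater_R x (int s) = (\<Sum>\<^sub>\<infinity>r. (-1) powi r * x powi (3 * tri r + a * r) * slater_gamma s r)"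
    and "(\<lambda>r. (-1) powi r * x powi (3 * tri r + a * r) * slater_gamma s r) summable_on UNIV"
proof -
  let ?b = "x\<^sup>2" and ?s = "int s"
  define W where "W = (\<lambda>n. x powi (n * n + 2 * ?s * n) * qpoch (- x) ?b (nat n))"
  define f where "f = (\<lambda>n r. W n * ((-1) powi r * x powi (3 * tri r + a * r) * eul ?b (n - r) * eul ?b (n + ?s + r)))"
  obtain C where C: "C > 0" "\<And>n. norm (qpoch (- x) ?b n) \<le> C" using qpoch_bounded[OF norm_x2(1)[OF x]] by blast
  obtain B where B: "B > 0" "\<And>k. norm (eul ?b k) \<le> B" using eul_bounded[OF norm_x2(1)[OF x]] by blast
  let ?g = "\<lambda>(n, r). qpoch (- x) ?b (nat n) * (-1) powi r * eul ?b (n - r) * eul ?b (n + ?s + r)"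
  let ?p = "\<lambda>(n, r). (n * n + 2 * ?s * n) + (3 * tri r + a * r)"
  have "(\<lambda>z. norm (?g z * x powi ?p z)) summable_on UNIV"
  proof (rule abs_summable_powi2[OF x])
    let ?c = "(2 * ?s + 1) * (2 * ?s + 1) + ((\<bar>a\<bar> + 1) * (\<bar>a\<bar> + 1) + 2 * (\<bar>a\<bar> + 1) + 2) + 1"
    show "0 \<le> ?c" by simp
    show "\<bar>n\<bar> + \<bar>r\<bar> - ?c \<le> ?p (n, r)" for n r
    proof -
      have "3 * tri r + a * r \<ge> \<bar>r\<bar> - ((\<bar>a\<bar> + 1) * (\<bar>a\<bar> + 1) + 2 * (\<bar>a\<bar> + 1) + 2)"
        by (rule tri_linear_ge) simp
      moreover have "n * n + 2 * ?s * n \<ge> \<bar>n\<bar> - (2 * ?s + 1) * (2 * ?s + 1) - 1"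
      proof -
        have "n * n \<ge> 2 * (2 * ?s + 1) * \<bar>n\<bar> - (2 * ?s + 1) * (2 * ?s + 1)" by (rule square_ge)
        moreover have "2 * (2 * ?s + 1) * \<bar>n\<bar> = 4 * (?s * \<bar>n\<bar>) + 2 * \<bar>n\<bar>" by (simp add: algebra_simps)
        moreover have "- (?s * \<bar>n\<bar>) \<le> ?s * n" by (simp add: mult_left_mono flip: mult_minus_right)
        moreover have "2 * ?s * n = 2 * (?s * n)" by simp
        moreover have "0 \<le> ?s * \<bar>n\<bar>" by simp
        ultimately show ?thesis by linarith
      qed
      ultimately show ?thesis by simp
    qed
    show "norm (?g z) \<le> C * 1 * B * B" for z
      by (cases z) (simp only: prod.case norm_mult norm_minus_one_powi, intro mult_mono C B, use B C in auto)
  qed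
  then have "(\<lambda>z. ?g z * x powi ?p z) summable_on UNIV \<times> UNIV"
    using abs_summable_summable by (auto simp: UNIV_Times_UNIV)
  then have sf: "(\<lambda>(n, r). f n r) summable_on UNIV \<times> UNIV"
    by (rule summable_on_cong[THEN iffD1, rotated])
      (use x in \<open>auto simp: f_def W_def power_int_add mult_ac\<close>)
  then have sf': "(\<lambda>(r, n). f n r) summable_on UNIV \<times> UNIV"
    by (subst (asm) summable_on_swap) (simp add: case_prod_unfold)
  have "slater_R x ?s = (\<Sum>\<^sub>\<infinity>n. \<Sum>\<^sub>\<infinity>r. f n r)"
    unfolding slater_R_def
  proof (rule infsum_cong)
    fix n
    have *: "(\<Sum>\<^sub>\<infinity>r. f n r) = W n * slater_sum x n ?s a"
      unfolding f_def slater_sum_def by (rule infsum_cmult_right')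
    show "x powi (n * n + 2 * ?s * n) * eul (x ^ 4) n = (\<Sum>\<^sub>\<infinity>r. f n r)"
    proof (cases "n < 0")
      case True
      \<comment> \<open>The indices \<open>n - r\<close> and \<open>n + ?s + r\<close> add up to 2n
        + s, which is negative because \<open>s\<close> is at most 1; so one of the
        \<open>eul\<close> factors is zero.\<close>
      then have "(-1) powi r * x powi (3 * tri r + a * r) * eul ?b (n - r) * eul ?b (n + ?s + r) = 0" for r
        using True s1 by (cases "n < r") auto
      then have "slater_sum x n ?s a = 0" unfolding slater_sum_def by (intro infsum_0; blast)
      then show ?thesis unfolding * using True by simp
    next
      case False
      then obtain k where k: "n = int k" by (metis nonneg_int_cases linorder_not_less)
      show ?thesis
        using qpoch_minus_x_nonzero[OF x, of k]
        unfolding * unfolding k s W_def slater_beta_def[OF x] eul_int by simp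
    qed
  qed
  also have "\<dots> = (\<Sum>\<^sub>\<infinity>r. \<Sum>\<^sub>\<infinity>n. f n r)"
    by (rule infsum_swap_banach[OF sf])
  also have eq: "(\<lambda>r. \<Sum>\<^sub>\<infinity>n. f n r) = (\<lambda>r. (-1) powi r * x powi (3 * tri r + a * r) * slater_gamma s r)"
  proof
    fix r
    have "(\<Sum>\<^sub>\<infinity>n. f n r) = (\<Sum>\<^sub>\<infinity>n. ((-1) powi r * x powi (3 * tri r + a * r)) *
       (W n * (eul ?b (n - r) * eul ?b (n + ?s + r))))"
      by (intro infsum_cong) (simp add: f_def mult_ac)
    also have "\<dots> = ((-1) powi r * x powi (3 * tri r + a * r)) * slater_gamma s r"
      unfolding slater_gamma_def W_def by (rule infsum_cmult_right')
    finally show "(\<Sum>\<^sub>\<infinity>n. f n r) = (-1) powi r * x powi (3 * tri r + a * r) * slater_gamma s r" .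
  qed
  finally show "slater_R x ?s = (\<Sum>\<^sub>\<infinity>r. (-1) powi r * x powi (3 * tri r + a * r) * slater_gamma s r)" .
  show "(\<lambda>r. (-1) powi r * x powi (3 * tri r + a * r) * slater_gamma s r) summable_on UNIV"
    unfolding eq[symmetric] using summable_on_Sigma_banach[OF sf'] .
qed

text \<open>The factor x^(r^2) from gamma raises the coefficient of \<open>tri r\<close> from 3 to
  5; reflecting \<open>r\<close> then brings the linear term into the form of
  \<open>jterm\<close>.\<close>

lemma slater_R_0: "slater_R x 0 = slater_const * jtheta (x\<^sup>2) (x ^ 5)"
proof -
  have "slater_R x 0 = (\<Sum>\<^sub>\<infinity>r. (-1) powi r * x powi (3 * tri r + 2 * r) * slater_gamma 0 r)"
    using slater_bailey(1)[of 0 2] slater_sum_eq[OF x] by simp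
  also have "\<dots> = (\<Sum>\<^sub>\<infinity>r. slater_const * jterm (x\<^sup>2) (x ^ 5) (0 - r))"
  proof (rule infsum_cong)
    fix r
    have p: "(x\<^sup>2) powi (0 - r) * (x ^ 5) powi tri (0 - r) = x powi (2 * (0 - r) + 5 * tri (0 - r))"
      unfolding power_powi using x power_int_add[of x "2 * (0 - r)" "5 * tri (0 - r)"] by simp
    have t: "2 * (0 - r) + 5 * tri (0 - r) = (3 * tri r + 2 * r) + r * r"
      using two_tri[of r] two_tri[of "0 - r"] by (simp add: algebra_simps)
    show "(-1) powi r * x powi (3 * tri r + 2 * r) * slater_gamma 0 r = slater_const * jterm (x\<^sup>2) (x ^ 5) (0 - r)"
      unfolding jterm_def mult.assoc p t slater_gamma_0 using x by (simp add: power_int_add mult_ac)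
  qed
  also have "\<dots> = slater_const * jtheta (x\<^sup>2) (x ^ 5)"
    unfolding jtheta_def infsum_cmult_right' by (subst infsum_reflect_int) (rule refl)
  finally show ?thesis .
qed

text \<open>The denominators 1 + x^(2r+1) disappear only when \<open>r\<close> is paired with
  \<open>- 1 - r\<close>: with y = x^(2r+1), 1/(1+y) - y/(1+1/y) equals 1 - y, which is what the
  theta terms alone contribute. Hence twice the sum is computed.\<close>

lemma slater_R_1: "slater_R x 1 = slater_const * jtheta x (x ^ 5)"
proof -
  let ?f = "\<lambda>r. (-1) powi r * x powi (3 * tri r + r) * slater_gamma 1 r"
  let ?g = "\<lambda>r. jterm x (x ^ 5) (0 - r)"
  have j: "?g r = (-1) powi r * x powi (5 * tri r + 4 * r)" for r
  proof -
    have p: "x powi (0 - r) * (x ^ 5) powi tri (0 - r) = x powi ((0 - r) + 5 * tri (0 - r))"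
      unfolding power_powi using x power_int_add[of x "0 - r" "5 * tri (0 - r)"] by simp
    have t: "(0 - r) + 5 * tri (0 - r) = 5 * tri r + 4 * r"
      using two_tri[of r] two_tri[of "0 - r"] by (simp add: algebra_simps)
    show ?thesis unfolding jterm_def mult.assoc p t by simp
  qed
  have f: "?f r = ?g r / (1 + x powi (2 * r + 1)) * slater_const" for r
  proof -
    have t: "(3 * tri r + r) + (r * r + 2 * r) = 5 * tri r + 4 * r"
      using two_tri[of r] by (simp add: algebra_simps)
    have p: "x powi (3 * tri r + r) * x powi (r * r + 2 * r) = x powi (5 * tri r + 4 * r)"
      using x power_int_add[of x "3 * tri r + r" "r * r + 2 * r"] unfolding t by simp
    show ?thesis unfolding j slater_gamma_1 p[symmetric] by simp
  qed
  have fg: "?f r + ?f (- 1 - r) = slater_const * (?g r + ?g (- 1 - r))" for r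
  proof -
    define y where "y = x powi (2 * r + 1)"
    have nz: "1 + y \<noteq> 0" "y \<noteq> 0" using one_plus_powi_odd_neq_0[of r] x by (simp_all add: y_def)
    have t: "5 * tri (- 1 - r) + 4 * (- 1 - r) = (5 * tri r + 4 * r) + (2 * r + 1)"
      using two_tri[of r] two_tri[of "- 1 - r"] by (simp add: algebra_simps)
    have s: "(-1::complex) powi (- 1 - r) = - ((-1) powi r)"
      using power_int_add[of "-1::complex" "-1" "-r"] by simp
    have g1: "?g (- 1 - r) = - (?g r) * y"
      unfolding j s t y_def using x by (subst power_int_add) auto
    have "2 * (- 1 - r) + 1 = - (2 * r + 1)" by simp
    then have y1: "x powi (2 * (- 1 - r) + 1) = inverse y"
      unfolding y_def by (simp only: power_int_minus)
    have "?f r + ?f (- 1 - r) = slater_const * (?g r * (1 / (1 + y) - y / (1 + inverse y)))"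
      unfolding f g1 y1 y_def[symmetric] by (simp add: algebra_simps)
    also have "1 / (1 + y) - y / (1 + inverse y) = 1 - y"
      using nz by (simp add: field_simps)
    finally show ?thesis unfolding g1 by (simp add: algebra_simps)
  qed
  have sf: "?f summable_on UNIV"
    using slater_bailey(2)[of 1 1] slater_sum_1_eq[OF x] by simp
  have sf': "(\<lambda>r. ?f (- 1 - r)) summable_on UNIV"
    using summable_on_reindex_bij_witness[of UNIV "\<lambda>n. - 1 - n" "\<lambda>n. - 1 - n" UNIV ?f "\<lambda>r. ?f (- 1 - r)"] sf by simp
  have n5: "norm (x ^ 5) \<le> norm x" using x power_decreasing[of 1 5 "norm x"] by (simp add: norm_power)
  have sj: "jterm x (x ^ 5) summable_on UNIV"
    using x n5 norm_power_less_1[of x 5] by (intro abs_summable_summable[OF abs_summable_jterm]) auto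
  have sg: "?g summable_on UNIV"
    using summable_on_reindex_bij_witness[of UNIV "\<lambda>n. 0 - n" "\<lambda>n. 0 - n" UNIV "jterm x (x ^ 5)" ?g] sj by simp
  have sg': "(\<lambda>r. ?g (- 1 - r)) summable_on UNIV"
    using summable_on_reindex_bij_witness[of UNIV "\<lambda>n. - 1 - n" "\<lambda>n. - 1 - n" UNIV ?g "\<lambda>r. ?g (- 1 - r)"] sg by simp
  have R: "slater_R x 1 = infsum ?f UNIV"
    using slater_bailey(1)[of 1 1] slater_sum_1_eq[OF x] by simp
  have "2 * slater_R x 1 = infsum ?f UNIV + (\<Sum>\<^sub>\<infinity>r. ?f (- 1 - r))"
    unfolding R by (subst infsum_reflect_int) simp
  also have "\<dots> = (\<Sum>\<^sub>\<infinity>r. slater_const * (?g r + ?g (- 1 - r)))"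
    unfolding fg[symmetric] by (rule infsum_add[OF sf sf', symmetric])
  also have "\<dots> = slater_const * (infsum ?g UNIV + (\<Sum>\<^sub>\<infinity>r. ?g (- 1 - r)))"
    by (simp only: infsum_cmult_right' infsum_add[OF sg sg'])
  also have "(\<Sum>\<^sub>\<infinity>r. ?g (- 1 - r)) = infsum ?g UNIV" by (rule infsum_reflect_int)
  also have "infsum ?g UNIV = jtheta x (x ^ 5)"
    unfolding jtheta_def by (rule infsum_reflect_int)
  finally show ?thesis by simp
qed

end

section \<open>A convolution of reciprocal q-factorials\<close>

text \<open>The maximum \<open>M n\<close> of two neighbouring norms is at most (1 + |Q|^n) times
  \<open>M (Suc n)\<close>. The product of these factors stays below exp(1/(1-|Q|)), so the limit 0
  at infinity forces zeros at all nonnegative indices.\<close>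

lemma backward_recurrence_zero:
  fixes D :: "int \<Rightarrow> complex"
  assumes r: "norm Q < 1" "Q \<noteq> 0"
    and rec: "\<And>m. D (m - 1) = D m + Q powi (2 * m + 1) * D (m + 1)"
    and lim: "(\<lambda>n. D (int n)) \<longlonglongrightarrow> 0"
  shows "D m = 0"
proof -
  define M where "M = (\<lambda>n. max (norm (D (int n))) (norm (D (int n + 1))))"
  let ?r = "norm Q"
  have step: "M n \<le> (1 + ?r ^ n) * M (Suc n)" for n
  proof -
    have M0: "0 \<le> M (Suc n)" by (simp add: M_def le_max_iff_disj)
    have "norm (Q powi (2 * (int n + 1) + 1)) \<le> ?r ^ n"
      using norm_powi_le_geometric[OF r(2,1), of n 0 "2 * (int n + 1) + 1"] by simp
    then have "norm (Q powi (2 * (int n + 1) + 1)) * norm (D (int n + 2)) \<le> ?r ^ n * M (Suc n)"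
      by (intro mult_mono) (auto simp: M_def add_ac)
    moreover have "norm (D (int n)) \<le> norm (D (int n + 1)) + norm (Q powi (2 * (int n + 1) + 1)) * norm (D (int n + 2))"
      using norm_triangle_ineq[of "D (int n + 1)" "Q powi (2 * (int n + 1) + 1) * D (int n + 2)"] rec[of "int n + 1"]
      by (simp add: norm_mult add_ac)
    moreover have "norm (D (int n + 1)) \<le> M (Suc n)" by (simp add: M_def add_ac)
    moreover have "0 \<le> ?r ^ n * M (Suc n)" using M0 by simp
    moreover have "M n = max (norm (D (int n))) (norm (D (int n + 1)))" by (simp add: M_def)
    ultimately show ?thesis unfolding distrib_right by linarith
  qed
  have bound: "M n \<le> exp (1 / (1 - ?r)) * M (n + N)" for n N
  proof -
    have M0: "0 \<le> M k" for k by (simp add: M_def le_max_iff_disj)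
    have "M n \<le> exp (\<Sum>i<N. ?r ^ (n + i)) * M (n + N)"
    proof (induction N)
      case (Suc N)
      have "M (n + N) \<le> exp (?r ^ (n + N)) * M (Suc (n + N))"
        by (rule order_trans[OF step]) (intro mult_right_mono M0, simp)
      then have "exp (\<Sum>i<N. ?r ^ (n + i)) * M (n + N) \<le> exp (\<Sum>i<N. ?r ^ (n + i)) * (exp (?r ^ (n + N)) * M (Suc (n + N)))"
        by (intro mult_left_mono) auto
      with Suc have "M n \<le> exp (\<Sum>i<N. ?r ^ (n + i)) * (exp (?r ^ (n + N)) * M (Suc (n + N)))"
        by (rule order_trans)
      then show ?case by (simp add: exp_add mult.assoc)
    qed simp
    also have "\<dots> \<le> exp (1 / (1 - ?r)) * M (n + N)"
    proof (intro mult_right_mono M0)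
      have "(\<Sum>i<N. ?r ^ (n + i)) \<le> (\<Sum>i<N. ?r ^ i)"
        using r by (intro sum_mono power_decreasing) auto
      also have "\<dots> \<le> (\<Sum>i. ?r ^ i)" using r by (intro sum_le_suminf) auto
      also have "\<dots> = 1 / (1 - ?r)" using r by (intro suminf_geometric) auto
      finally show "exp (\<Sum>i<N. ?r ^ (n + i)) \<le> exp (1 / (1 - ?r))" by simp
    qed
    finally show ?thesis .
  qed
  have "M \<longlonglongrightarrow> max 0 0"
    unfolding M_def using lim LIMSEQ_Suc[OF lim]
    by (intro tendsto_max) (auto simp: tendsto_norm_zero_iff add_ac)
  then have L: "(\<lambda>N. exp (1 / (1 - ?r)) * M (N + n)) \<longlonglongrightarrow> exp (1 / (1 - ?r)) * 0" for n
    by (intro tendsto_mult_left LIMSEQ_ignore_initial_segment) simp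
  have "M n \<le> exp (1 / (1 - ?r)) * 0" for n
    by (rule LIMSEQ_le_const[OF L]) (use bound[of n] in \<open>auto simp: add.commute\<close>)
  then have "M n \<le> 0" for n by simp
  then have nonneg: "D (int n) = 0" for n unfolding M_def by (metis max.boundedE norm_le_zero_iff)
  \<comment> \<open>Two consecutive zeros determine the next lower value, so the recurrence carries
    them to all negative indices.\<close>
  have "D (- int n) = 0 \<and> D (1 - int n) = 0" for n
  proof (induction n)
    case 0
    show ?case using nonneg[of 0] nonneg[of 1] by simp
  next
    case (Suc n)
    have "- int (Suc n) = - int n - 1" "1 - int (Suc n) = - int n" by simp_all
    with Suc show ?case using rec[of "- int n"] by (simp only:) (simp add: add.commute)
  qed
  then have "D (- int n) = 0" for n by blast
  from this[of "nat (- m)"] nonneg[of "nat m"] show ?thesis by (cases "m \<ge> 0") auto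
qed

context
  fixes Q :: complex
  assumes Q: "Q \<noteq> 0" "norm Q < 1"
begin

definition eul_conv :: "int \<Rightarrow> complex" where
  "eul_conv m = (\<Sum>\<^sub>\<infinity>j. eul Q j * eul Q (j + m) * Q powi (tri (j + 1) + m * j))"

definition eul_conv_theta :: "int \<Rightarrow> complex" where
  "eul_conv_theta m = (\<Sum>\<^sub>\<infinity>k. eul (Q\<^sup>2) k * Q powi (2 * k * k + k + 2 * m * k))"

lemma eul2_bounded: "\<exists>B>0. \<forall>i j. norm (eul Q i * eul Q j) \<le> B"
proof -
  obtain B where B: "B > 0" "\<And>k. norm (eul Q k) \<le> B" using eul_bounded[OF Q(2)] by blast
  have "norm (eul Q i * eul Q j) \<le> B * B" for i j
    unfolding norm_mult by (intro mult_mono B) (use B in auto)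
  then show ?thesis using B(1) by (intro exI[of _ "B * B"]) auto
qed

lemma summable_eul_conv_term:
  "(\<lambda>j. norm (eul Q (j + a) * eul Q (j + b) * Q powi (tri j + c * j + d))) summable_on UNIV"
proof -
  obtain B where B: "B > 0" "\<And>i j. norm (eul Q i * eul Q j) \<le> B" using eul2_bounded by blast
  let ?c = "((\<bar>c\<bar> + 1) * (\<bar>c\<bar> + 1) + 2 * (\<bar>c\<bar> + 1) + 2) + \<bar>d\<bar>"
  show ?thesis
  proof (rule abs_summable_powi[OF Q _ _ B(2), of ?c])
    show "\<bar>j\<bar> - ?c \<le> tri j + c * j + d" for j
      using tri_linear_ge[of 1 j c] by simp
  qed simp
qed

text \<open>A contiguous relation obtained by creative telescoping: it holds term by term up to a
  difference that sums to zero.\<close>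

lemma eul_conv_rec: "eul_conv (m - 1) = eul_conv m + Q powi (2 * m + 1) * eul_conv (m + 1)"
proof -
  let ?t = "\<lambda>m j. eul Q j * eul Q (j + m) * Q powi (tri (j + 1) + m * j)"
  \<comment> \<open>The certificate: the terms satisfy the recurrence up to
    \<open>?V j - ?V (j + 1)\<close>.\<close>
  let ?V = "\<lambda>j. eul Q (j - 1) * eul Q (j + m) * Q powi (tri (j + 1) + m * j - j)"
  have st: "?t m summable_on UNIV" for m
    using abs_summable_summable[OF summable_eul_conv_term[of 0 m "m + 1" 0]] by (simp add: tri_add algebra_simps)
  have sV: "?V summable_on UNIV"
    using abs_summable_summable[OF summable_eul_conv_term[of "-1" m "m" 0]] by (simp add: tri_add algebra_simps)
  then have sV1: "(\<lambda>j. ?V (j + 1)) summable_on UNIV"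
    using summable_on_reindex_bij_witness[of UNIV "\<lambda>n. n - 1" "\<lambda>n. n + 1" UNIV ?V "\<lambda>j. ?V (j + 1)"] by simp
  have eq: "?t (m - 1) j = ?t m j + Q powi (2 * m + 1) * ?t (m + 1) j + ?V j + (-1) * ?V (j + 1)" for j
  proof -
    define y where "y = Q powi (tri (j + 1) + m * j)"
    define a b where "a = Q powi j" and "b = Q powi m"
    have nz: "a \<noteq> 0" using Q by (simp add: a_def)
    have "Q powi ((tri (j + 1) + m * j) - j) = y / a"
      unfolding y_def a_def using Q by (intro power_int_diff) auto
    then have 1: "Q powi (tri (j + 1) + (m - 1) * j) = y / a" "Q powi (tri (j + 1) + m * j - j) = y / a"
      by (simp_all add: algebra_simps)
    have 2: "Q powi (tri (j + 1) + (m + 1) * j) = y * a"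
      using Q by (simp add: y_def a_def distrib_right add.assoc[symmetric] power_int_add)
    have 3: "Q powi (tri (j + 1 + 1) + m * (j + 1) - (j + 1)) = y * b"
      using Q by (simp add: y_def b_def tri_add algebra_simps flip: power_int_add)
    have 4: "Q powi (2 * m + 1) = Q * b * b"
      using Q by (simp add: b_def power_int_add powi_double)
    have e1: "eul Q (j + m) = (1 - a * b * Q) * eul Q (j + m + 1)"
      using Q eul_rec[OF Q(2), of "j + m + 1"] by (simp add: a_def b_def power_int_add)
    have "eul Q (j + (m - 1)) = (1 - a * b) * eul Q (j + m)"
      using Q eul_rec[OF Q(2), of "j + m"] by (simp add: a_def b_def power_int_add add_diff_eq)
    note 5 = this[unfolded e1] e1 eul_rec[OF Q(2), of j, folded a_def]
    have 6: "eul Q (j + 1 - 1) = eul Q j" "eul Q (j + 1 + m) = eul Q (j + m + 1)" "eul Q (j + (m + 1)) = eul Q (j + m + 1)"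
      by (simp_all add: add_ac)
    show ?thesis
      unfolding 1 2 3 4 6 unfolding 5 y_def[symmetric] using nz by (simp add: field_simps)
  qed
  have "eul_conv (m - 1) = infsum (?t m) UNIV + Q powi (2 * m + 1) * infsum (?t (m + 1)) UNIV + infsum ?V UNIV
     + (-1) * (\<Sum>\<^sub>\<infinity>j. ?V (j + 1))"
    unfolding eul_conv_def eq
    by (intro infsumI has_sum_add has_sum_cmult_right has_sum_infsum sV1 st sV)
  moreover have "(\<Sum>\<^sub>\<infinity>j. ?V (j + 1)) = infsum ?V UNIV" by (rule infsum_shift_int)
  ultimately show ?thesis unfolding eul_conv_def by simp
qed

lemma summable_eul_conv_theta_term:
  "(\<lambda>k. norm (eul (Q\<^sup>2) (k + a) * Q powi (2 * k * k + b * k + c))) summable_on UNIV"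
proof -
  obtain B where B: "B > 0" "\<And>k. norm (eul (Q\<^sup>2) k) \<le> B" using eul_bounded[OF norm_x2(1)[OF Q]] by blast
  let ?a = "2 + b"
  let ?c = "((\<bar>?a\<bar> + 1) * (\<bar>?a\<bar> + 1) + 2 * (\<bar>?a\<bar> + 1) + 2) + \<bar>c\<bar>"
  show ?thesis
  proof (rule abs_summable_powi[OF Q _ _ B(2), of ?c])
    have "4 * tri k + ?a * k = 2 * k * k + b * k" for k
      using two_tri[of k] by (simp add: algebra_simps)
    then show "\<bar>k\<bar> - ?c \<le> 2 * k * k + b * k + c" for k
      using tri_linear_ge[of 4 k ?a] by (simp del: abs_add_one_gt_zero)
  qed simp
qed

text \<open>Subtracting the series at \<open>m\<close> from that at \<open>m - 1\<close> produces
  the factor 1 - Q^(2k), which lowers the index of 1/(Q^2;Q^2)_k; shifting \<open>k\<close> back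
  gives the series at \<open>m + 1\<close>.\<close>

lemma eul_conv_theta_rec: "eul_conv_theta (m - 1) = eul_conv_theta m + Q powi (2 * m + 1) * eul_conv_theta (m + 1)"
proof -
  let ?t = "\<lambda>m k. eul (Q\<^sup>2) k * Q powi (2 * k * k + k + 2 * m * k)"
  let ?V = "\<lambda>k. eul (Q\<^sup>2) (k - 1) * Q powi (2 * k * k - k + 2 * m * k)"
  have st: "?t m summable_on UNIV" for m
    using abs_summable_summable[OF summable_eul_conv_theta_term[of 0 "2 * m + 1" 0]] by (simp add: algebra_simps)
  have sV: "?V summable_on UNIV"
    using abs_summable_summable[OF summable_eul_conv_theta_term[of "-1" "2 * m - 1" 0]] by (simp add: algebra_simps)
  have eq: "?t (m - 1) k = ?t m k + ?V k" for k
  proof -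
    have 1: "2 * k * k + k + 2 * m * k = (2 * k * k - k + 2 * m * k) + 2 * k"
      "2 * k * k + k + 2 * (m - 1) * k = 2 * k * k - k + 2 * m * k" by (simp_all add: algebra_simps)
    have 2: "eul (Q\<^sup>2) (k - 1) = (1 - Q powi (2 * k)) * eul (Q\<^sup>2) k"
      using eul_rec[OF norm_x2(1)[OF Q], of k] by (simp add: powi_2_mult)
    have "Q powi ((2 * k * k - k + 2 * m * k) + 2 * k) = Q powi (2 * k * k - k + 2 * m * k) * Q powi (2 * k)"
      using Q by (intro power_int_add) auto
    then show ?thesis unfolding 1 2 by (simp add: algebra_simps)
  qed
  have shift: "?V (k + 1) = Q powi (2 * m + 1) * ?t (m + 1) k" for k
  proof -
    have 1: "2 * (k + 1) * (k + 1) - (k + 1) + 2 * m * (k + 1) = (2 * m + 1) + (2 * k * k + k + 2 * (m + 1) * k)"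
      by (simp add: algebra_simps)
    have 2: "Q powi ((2 * m + 1) + (2 * k * k + k + 2 * (m + 1) * k)) = Q powi (2 * m + 1) * Q powi (2 * k * k + k + 2 * (m + 1) * k)"
      using Q by (intro power_int_add) auto
    show ?thesis unfolding 1 2 by simp
  qed
  have "eul_conv_theta (m - 1) = infsum (?t m) UNIV + infsum ?V UNIV"
    unfolding eul_conv_theta_def eq by (rule infsum_add[OF st sV])
  also have "infsum ?V UNIV = (\<Sum>\<^sub>\<infinity>k. ?V (k + 1))" by (rule infsum_shift_int[symmetric])
  also have "\<dots> = Q powi (2 * m + 1) * infsum (?t (m + 1)) UNIV"
    unfolding shift by (rule infsum_cmult_right')
  finally show ?thesis unfolding eul_conv_theta_def .
qed

lemma powi_mult_LIMSEQ_0: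
  assumes "k > 0" "d \<ge> 0"
  shows "(\<lambda>n. Q powi (c + d * int n * k)) \<longlonglongrightarrow> (if d > 0 then 0 else Q powi c)"
proof (cases "d > 0")
  case True
  have "norm (Q ^ nat (d * k)) < 1" using Q assms True by (intro norm_power_less_1) auto
  then have "(\<lambda>n. Q powi c * (Q ^ nat (d * k)) ^ n) \<longlonglongrightarrow> Q powi c * 0"
    by (intro tendsto_mult_left LIMSEQ_power_zero)
  moreover have "Q powi c * (Q ^ nat (d * k)) ^ n = Q powi (c + d * int n * k)" for n
  proof -
    have "(Q ^ nat (d * k)) ^ n = Q powi (int (nat (d * k) * n))"
      by (simp only: power_mult power_int_of_nat)
    also have "int (nat (d * k) * n) = d * int n * k" using assms True by simp
    finally show ?thesis using Q by (simp add: power_int_add)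
  qed
  ultimately show ?thesis using True by simp
qed (use assms in simp)

text \<open>A term with positive \<open>j\<close> carries Q^(n j) and dies out, so only
  \<open>j = 0\<close> contributes to the limit.\<close>

lemma eul_conv_LIMSEQ: "(\<lambda>n. eul_conv (int n)) \<longlonglongrightarrow> 1 / qpoch_inf Q Q"
proof -
  obtain B where B: "B > 0" "\<And>i j. norm (eul Q i * eul Q j) \<le> B" using eul2_bounded by blast
  let ?g = "\<lambda>j::int. if j = 0 then 1 / qpoch_inf Q Q else 0"
  have "(\<lambda>n. eul_conv (int n)) \<longlonglongrightarrow> infsum ?g UNIV"
    unfolding eul_conv_def
  proof (rule infsum_dominated_convergence)
    show "norm (eul Q j * eul Q (j + int n) * Q powi (tri (j + 1) + int n * j)) \<le> B * norm Q powi (tri \<bar>j\<bar>)" for n j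
    proof (cases "j < 0")
      case False
      then have "norm Q powi (tri (j + 1) + int n * j) \<le> norm Q powi (tri \<bar>j\<bar>)"
        using Q by (intro power_int_decreasing) (auto simp: tri_add)
      then show ?thesis
        unfolding norm_mult[of "_ * _"] norm_power_int using B by (intro mult_mono) auto
    qed (use B in simp)
    show "(\<lambda>j. B * norm Q powi (tri \<bar>j\<bar>)) summable_on UNIV"
      by (intro summable_on_cmult_right summable_powi_tri_abs Q)
    show "(\<lambda>n. eul Q j * eul Q (j + int n) * Q powi (tri (j + 1) + int n * j)) \<longlonglongrightarrow> ?g j" for j
    proof (cases "j \<le> 0")
      case True
      then show ?thesis using eul_LIMSEQ[OF Q(2), of 0] by (cases "j = 0") auto
    next
      case False
      have "(\<lambda>n. eul Q j * eul Q (int n + j) * Q powi (tri (j + 1) + 1 * int n * j)) \<longlonglongrightarrow> eul Q j * (1 / qpoch_inf Q Q) * 0"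
        using powi_mult_LIMSEQ_0[of j 1 "tri (j + 1)"] False
        by (intro tendsto_mult tendsto_const eul_LIMSEQ Q) auto
      then show ?thesis using False by (simp add: add.commute)
    qed
  qed
  moreover have "infsum ?g UNIV = 1 / qpoch_inf Q Q" by (subst infsum_only_0) auto
  ultimately show ?thesis by simp
qed

lemma eul_conv_theta_LIMSEQ: "(\<lambda>n. eul_conv_theta (int n)) \<longlonglongrightarrow> 1"
proof -
  obtain B where B: "B > 0" "\<And>k. norm (eul (Q\<^sup>2) k) \<le> B" using eul_bounded[OF norm_x2(1)[OF Q]] by blast
  let ?g = "\<lambda>j::int. if j = 0 then 1 else (0 :: complex)"
  have "(\<lambda>n. eul_conv_theta (int n)) \<longlonglongrightarrow> infsum ?g UNIV"
    unfolding eul_conv_theta_def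
  proof (rule infsum_dominated_convergence)
    show "norm (eul (Q\<^sup>2) k * Q powi (2 * k * k + k + 2 * int n * k)) \<le> B * norm Q powi (tri \<bar>k\<bar>)" for n k
    proof (cases "k < 0")
      case False
      then have "tri k \<le> 2 * k * k + k + 2 * int n * k"
      proof -
        have "0 \<le> k * k" "0 \<le> int n * k" "0 \<le> k" using False by simp_all
        moreover have "2 * int n * k = 2 * (int n * k)" "2 * k * k = 2 * (k * k)" by simp_all
        ultimately show ?thesis using two_tri[of k] by linarith
      qed
      then have "norm Q powi (2 * k * k + k + 2 * int n * k) \<le> norm Q powi (tri \<bar>k\<bar>)"
        using Q False by (intro power_int_decreasing) auto
      then show ?thesis
        unfolding norm_mult norm_power_int using B by (intro mult_mono) auto
    qed (use B in simp)
    show "(\<lambda>j. B * norm Q powi (tri \<bar>j\<bar>)) summable_on UNIV"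
      by (intro summable_on_cmult_right summable_powi_tri_abs Q)
    show "(\<lambda>n. eul (Q\<^sup>2) k * Q powi (2 * k * k + k + 2 * int n * k)) \<longlonglongrightarrow> ?g k" for k
    proof (cases "k \<le> 0")
      case True
      then show ?thesis by (cases "k = 0") auto
    next
      case False
      have "(\<lambda>n. eul (Q\<^sup>2) k * Q powi (2 * k * k + k + 2 * int n * k)) \<longlonglongrightarrow> eul (Q\<^sup>2) k * 0"
        using powi_mult_LIMSEQ_0[of k 2 "2 * k * k + k"] False by (intro tendsto_mult tendsto_const) auto
      then show ?thesis using False by simp
    qed
  qed
  moreover have "infsum ?g UNIV = 1" by (subst infsum_only_0) auto
  ultimately show ?thesis by simp
qed

text \<open>After multiplication by (Q;Q)_inf both sides satisfy the same recurrence and tend to 1,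
  so their difference vanishes.\<close>

lemma eul_conv_eq: "eul_conv m = eul_conv_theta m / qpoch_inf Q Q"
proof -
  let ?c = "qpoch_inf Q Q"
  have c: "?c \<noteq> 0" by (rule qpoch_inf_nonzero[OF Q(2) Q(2)])
  have "eul_conv m * ?c - eul_conv_theta m = 0"
  proof (rule backward_recurrence_zero[OF Q(2) Q(1), where D = "\<lambda>m. eul_conv m * ?c - eul_conv_theta m"])
    show "eul_conv (m - 1) * ?c - eul_conv_theta (m - 1) = eul_conv m * ?c - eul_conv_theta m + Q powi (2 * m + 1) * (eul_conv (m + 1) * ?c - eul_conv_theta (m + 1))" for m
      unfolding eul_conv_rec eul_conv_theta_rec by (simp add: algebra_simps)
    have "(\<lambda>n. eul_conv (int n) * ?c - eul_conv_theta (int n)) \<longlonglongrightarrow> 1 / ?c * ?c - 1"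
      by (intro tendsto_intros eul_conv_LIMSEQ eul_conv_theta_LIMSEQ)
    then show "(\<lambda>n. eul_conv (int n) * ?c - eul_conv_theta (int n)) \<longlonglongrightarrow> 0" using c by simp
  qed
  then show ?thesis using c by (simp add: field_simps)
qed

text \<open>This is the preceding equality at -n. The extra factor \<open>Q powi tri n\<close>
  completes both exponents to triangular numbers, the form in which the inner sums of
  \<open>S1\<close> and \<open>S2\<close> appear.\<close>

lemma eul_convolution:
  "(\<Sum>\<^sub>\<infinity>j. Q powi tri (j + 1) * eul Q j * eul Q (j + n)) =
     (\<Sum>\<^sub>\<infinity>k. Q powi tri (n - 2 * k) * eul (Q\<^sup>2) k) / qpoch_inf Q Q"
proof -
  have "(\<Sum>\<^sub>\<infinity>j. Q powi tri (j + 1) * eul Q j * eul Q (j + n))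
      = (\<Sum>\<^sub>\<infinity>j. Q powi tri (j - n + 1) * eul Q (j - n) * eul Q (j - n + n))"
    using infsum_shift_int[of "\<lambda>j. Q powi tri (j + 1) * eul Q j * eul Q (j + n)" "- n"] by simp
  also have "\<dots> = (\<Sum>\<^sub>\<infinity>j. Q powi tri n * (eul Q j * eul Q (j + (- n)) * Q powi (tri (j + 1) + (- n) * j)))"
  proof (rule infsum_cong)
    fix j
    have "tri (j - n + 1) = tri n + (tri (j + 1) + (- n) * j)"
      using two_tri[of "j - n + 1"] two_tri[of n] two_tri[of "j + 1"] by (simp add: algebra_simps)
    then have "Q powi tri (j - n + 1) = Q powi tri n * Q powi (tri (j + 1) + (- n) * j)"
      by (simp only: power_int_add[OF disjI1[OF Q(1)]])
    then show "Q powi tri (j - n + 1) * eul Q (j - n) * eul Q (j - n + n)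
      = Q powi tri n * (eul Q j * eul Q (j + (- n)) * Q powi (tri (j + 1) + (- n) * j))"
      by (simp add: mult_ac)
  qed
  also have "\<dots> = Q powi tri n * eul_conv (- n)"
    unfolding eul_conv_def by (rule infsum_cmult_right')
  also have "\<dots> = Q powi tri n * eul_conv_theta (- n) / qpoch_inf Q Q" unfolding eul_conv_eq by simp
  also have "Q powi tri n * eul_conv_theta (- n) = (\<Sum>\<^sub>\<infinity>k. Q powi tri n * (eul (Q\<^sup>2) k * Q powi (2 * k * k + k + 2 * (- n) * k)))"
    unfolding eul_conv_theta_def by (rule infsum_cmult_right'[symmetric])
  also have "\<dots> = (\<Sum>\<^sub>\<infinity>k. Q powi tri (n - 2 * k) * eul (Q\<^sup>2) k)"
  proof (rule infsum_cong)
    fix k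
    have "tri (n - 2 * k) = tri n + (2 * k * k + k + 2 * (- n) * k)"
      using two_tri[of "n - 2 * k"] two_tri[of n] by (simp add: algebra_simps)
    then have "Q powi tri (n - 2 * k) = Q powi tri n * Q powi (2 * k * k + k + 2 * (- n) * k)"
      by (simp only: power_int_add[OF disjI1[OF Q(1)]])
    then show "Q powi tri n * (eul (Q\<^sup>2) k * Q powi (2 * k * k + k + 2 * (- n) * k)) = Q powi tri (n - 2 * k) * eul (Q\<^sup>2) k"
      by (simp add: mult_ac)
  qed
  finally show ?thesis .
qed

end

section \<open>The double sums as parity parts of theta products\<close>

text \<open>Raising \<open>k\<close> by 2 multiplies the term by x^(4n), which matches the base x^4
  of the factorial: the difference lowers its index by one and, after a shift, is the series at
  \<open>k + 1\<close>. This is why \<open>slater_R\<close> is defined for all integers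
  \<open>k\<close>.\<close>

lemma slater_R_rec:
  assumes x: "x \<noteq> 0" "norm x < 1"
  shows "slater_R x k = slater_R x (k + 2) + x powi (2 * k + 1) * slater_R x (k + 1)"
proof -
  have x4: "norm (x ^ 4) < 1" using x by (intro norm_power_less_1) auto
  obtain B where B: "B > 0" "\<And>k. norm (eul (x ^ 4) k) \<le> B" using eul_bounded[OF x4] by blast
  let ?t = "\<lambda>k n. x powi (n * n + 2 * k * n) * eul (x ^ 4) n"
  have st: "(\<lambda>n. eul (x ^ 4) (n + a) * x powi (n * n + 2 * k * n)) summable_on UNIV" for k a
  proof (rule abs_summable_summable, rule abs_summable_powi[OF x _ _ B(2)])
    show "\<bar>n\<bar> - ((\<bar>2 * k + 1\<bar> + 1) * (\<bar>2 * k + 1\<bar> + 1) + 2 * (\<bar>2 * k + 1\<bar> + 1) + 2) \<le> n * n + 2 * k * n" for n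
      using tri_linear_ge[of 2 n "2 * k + 1"] two_tri[of n] by (simp add: distrib_right)
  qed simp
  have "slater_R x k = (\<Sum>\<^sub>\<infinity>n. ?t (k + 2) n + eul (x ^ 4) (n - 1) * x powi (n * n + 2 * k * n))"
    unfolding slater_R_def
  proof (rule infsum_cong)
    fix n
    have 1: "n * n + 2 * (k + 2) * n = (n * n + 2 * k * n) + 4 * n" by (simp add: algebra_simps)
    have 2: "eul (x ^ 4) (n - 1) = (1 - x powi (4 * n)) * eul (x ^ 4) n"
      using eul_rec[OF x4, of n] by (simp add: power_powi)
    have 3: "x powi ((n * n + 2 * k * n) + 4 * n) = x powi (n * n + 2 * k * n) * x powi (4 * n)"
      using x by (intro power_int_add) auto
    show "?t k n = ?t (k + 2) n + eul (x ^ 4) (n - 1) * x powi (n * n + 2 * k * n)"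
      unfolding 1 2 3 by (simp add: algebra_simps)
  qed
  also have "\<dots> = slater_R x (k + 2) + (\<Sum>\<^sub>\<infinity>n. eul (x ^ 4) (n - 1) * x powi (n * n + 2 * k * n))"
    unfolding slater_R_def using st[of 0 "k + 2"] st[of "-1" k] by (intro infsum_add) (simp_all add: mult.commute)
  also have "(\<Sum>\<^sub>\<infinity>n. eul (x ^ 4) (n - 1) * x powi (n * n + 2 * k * n))
      = (\<Sum>\<^sub>\<infinity>n. eul (x ^ 4) (n + 1 - 1) * x powi ((n + 1) * (n + 1) + 2 * k * (n + 1)))"
    by (rule infsum_shift_int[symmetric])
  also have "\<dots> = (\<Sum>\<^sub>\<infinity>n. x powi (2 * k + 1) * ?t (k + 1) n)"
  proof (rule infsum_cong)
    fix n
    have 1: "(n + 1) * (n + 1) + 2 * k * (n + 1) = (2 * k + 1) + (n * n + 2 * (k + 1) * n)"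
      by (simp add: algebra_simps)
    have 2: "x powi ((2 * k + 1) + (n * n + 2 * (k + 1) * n)) = x powi (2 * k + 1) * x powi (n * n + 2 * (k + 1) * n)"
      using x by (intro power_int_add) auto
    show "eul (x ^ 4) (n + 1 - 1) * x powi ((n + 1) * (n + 1) + 2 * k * (n + 1)) = x powi (2 * k + 1) * ?t (k + 1) n"
      unfolding 1 2 by simp
  qed
  also have "\<dots> = x powi (2 * k + 1) * slater_R x (k + 1)"
    unfolding slater_R_def by (rule infsum_cmult_right')
  finally show ?thesis .
qed

lemma slater_R_LIMSEQ:
  assumes x: "x \<noteq> 0" "norm x < 1"
  shows "(\<lambda>k. slater_R x (int k)) \<longlonglongrightarrow> 1"
proof -
  have x4: "norm (x ^ 4) < 1" using x by (intro norm_power_less_1) auto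
  obtain B where B: "B > 0" "\<And>k. norm (eul (x ^ 4) k) \<le> B" using eul_bounded[OF x4] by blast
  let ?g = "\<lambda>j::int. if j = 0 then 1 else (0 :: complex)"
  have "(\<lambda>k. slater_R x (int k)) \<longlonglongrightarrow> infsum ?g UNIV"
    unfolding slater_R_def
  proof (rule infsum_dominated_convergence)
    show "norm (x powi (n * n + 2 * int k * n) * eul (x ^ 4) n) \<le> norm x powi (tri \<bar>n\<bar>) * B" for n k
    proof (cases "n < 0")
      case False
      have "tri n \<le> n * n + 2 * int k * n"
      proof -
        have "0 \<le> n * n" "0 \<le> int k * n" "0 \<le> n" using False by simp_all
        moreover have "2 * int k * n = 2 * (int k * n)" by simp
        ultimately show ?thesis using two_tri[of n] by linarith
      qed
      then have "norm x powi (n * n + 2 * int k * n) \<le> norm x powi (tri \<bar>n\<bar>)"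
        using x False by (intro power_int_decreasing) auto
      then show ?thesis
        unfolding norm_mult norm_power_int using B by (intro mult_mono) auto
    qed (use B in simp)
    show "(\<lambda>n. norm x powi (tri \<bar>n\<bar>) * B) summable_on UNIV"
      by (intro summable_on_cmult_left summable_powi_tri_abs x)
    show "(\<lambda>k. x powi (n * n + 2 * int k * n) * eul (x ^ 4) n) \<longlonglongrightarrow> ?g n" for n
    proof (cases "n \<le> 0")
      case True
      then show ?thesis by (cases "n = 0") auto
    next
      case False
      have "(\<lambda>k. x powi (n * n + 2 * int k * n) * eul (x ^ 4) n) \<longlonglongrightarrow> 0 * eul (x ^ 4) n"
        using powi_mult_LIMSEQ_0[OF x, of n 2 "n * n"] False by (intro tendsto_mult tendsto_const) auto
      then show ?thesis using False by simp
    qed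
  qed
  moreover have "infsum ?g UNIV = 1" by (subst infsum_only_0) auto
  ultimately show ?thesis by simp
qed

text \<open>The coefficient x^(2k+1) changes sign with \<open>x\<close>, so the mixed terms cancel
  and the expression is independent of \<open>k\<close>. Letting \<open>k\<close> tend to infinity
  gives 1 + 1.\<close>

lemma slater_R_casoratian:
  assumes x: "x \<noteq> 0" "norm x < 1"
  shows "slater_R x 0 * slater_R (- x) 1 + slater_R x 1 * slater_R (- x) 0 = 2"
proof -
  have x': "- x \<noteq> 0" "norm (- x) < 1" using x by auto
  define C where "C = (\<lambda>k::nat. slater_R x (int k) * slater_R (- x) (int k + 1) + slater_R x (int k + 1) * slater_R (- x) (int k))"
  have "C k = C (Suc k)" for k
  proof -
    have "(- x) powi (2 * int k + 1) = - (x powi (2 * int k + 1))"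
      by (simp add: power_int_minus_left)
    then show ?thesis
      unfolding C_def slater_R_rec[OF x, of "int k"] slater_R_rec[OF x', of "int k"]
      by (simp add: algebra_simps)
  qed
  then have "C k = C 0" for k by (induction k) auto
  then have C: "C = (\<lambda>k. C 0)" by blast
  have *: "(\<lambda>k. slater_R y (int k + 1)) \<longlonglongrightarrow> 1" if "y \<noteq> 0" "norm y < 1" for y
    using LIMSEQ_Suc[OF slater_R_LIMSEQ[OF that]] by (simp add: add.commute)
  have "C \<longlonglongrightarrow> 1 * 1 + 1 * 1"
    unfolding C_def by (intro tendsto_intros slater_R_LIMSEQ * x x')
  with C have "C 0 = 2" by (metis LIMSEQ_const_iff one_add_one mult_1)
  then show ?thesis by (simp add: C_def)
qed

section \<open>Parity parts of products with phi\<close>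

definition phi :: "complex \<Rightarrow> complex" where
  "phi t = (\<Sum>\<^sub>\<infinity>n. t powi (n * n))"

lemma phi_mult_slater_R:
  fixes s :: int
  assumes t: "t \<noteq> 0" "norm t < 1"
  defines "f \<equiv> \<lambda>(m, k). eul (t ^ 12) k * t powi (m * m + 3 * (k * k + 2 * s * k))"
  shows "phi t * slater_R (t ^ 3) s = infsum f UNIV" "f summable_on UNIV"
proof -
  have t12: "norm (t ^ 12) < 1" using t by (intro norm_power_less_1) auto
  obtain B where B: "B > 0" "\<And>k. norm (eul (t ^ 12) k) \<le> B" using eul_bounded[OF t12] by blast
  let ?a = "6 * s + 3" let ?c = "(\<bar>?a\<bar> + 1) * (\<bar>?a\<bar> + 1) + 2 * (\<bar>?a\<bar> + 1) + 2"
  have "(\<lambda>z. norm (eul (t ^ 12) (snd z) * t powi (fst z * fst z + 3 * (snd z * snd z + 2 * s * snd z)))) summable_on UNIV"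
  proof (rule abs_summable_powi2[OF t, of ?c])
    show "\<bar>n\<bar> + \<bar>k\<bar> - ?c \<le> fst (n, k) * fst (n, k) + 3 * (snd (n, k) * snd (n, k) + 2 * s * snd (n, k))" for n k
    proof -
      have "6 * tri k + ?a * k = 3 * (k * k + 2 * s * k)"
        using two_tri[of k] by (simp add: algebra_simps)
      then show ?thesis
        using int_abs_le_square[of n] tri_linear_ge[of 6 k ?a] by (simp del: abs_add_one_gt_zero)
    qed
  qed (use B in auto)
  then show sf: "f summable_on UNIV"
    unfolding f_def case_prod_unfold by (rule abs_summable_summable)
  have p: "(t ^ 3) powi (k * k + 2 * s * k) = t powi (3 * (k * k + 2 * s * k))" for k
    by (simp add: power_powi)
  have t43: "(t ^ 3) ^ 4 = t ^ 12" by (simp flip: power_mult)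
  have "infsum f UNIV = (\<Sum>\<^sub>\<infinity>m. \<Sum>\<^sub>\<infinity>k. f (m, k))"
    using infsum_Sigma_banach[of f UNIV "\<lambda>_. UNIV"] sf by simp
  also have "\<dots> = (\<Sum>\<^sub>\<infinity>m. t powi (m * m) * slater_R (t ^ 3) s)"
    unfolding slater_R_def infsum_cmult_right'[symmetric] f_def p t43
    by (intro infsum_cong) (use t in \<open>simp add: power_int_add mult_ac\<close>)
  also have "\<dots> = phi t * slater_R (t ^ 3) s"
    unfolding phi_def by (rule infsum_cmult_left')
  finally show "phi t * slater_R (t ^ 3) s = infsum f UNIV" ..
qed

text \<open>Adding the value at \<open>- t\<close> with the sign (-1)^d keeps just the pairs with m
  + k + d even, and these are exactly m = 2n - 3k - d. \<open>E\<close> is the matching completion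
  of the square; (c, d, s) is (0, 1, 0) for \<open>S1\<close> and (2, 0, 1) for
  \<open>S2\<close>.\<close>

lemma phi_slater_R_parity:
  assumes t: "t \<noteq> 0" "norm t < 1"
    and E: "\<And>n k. 2 * (tri n + c * n + 3 * tri (n - 2 * k)) + d = (2 * n - 3 * k - d) * (2 * n - 3 * k - d) + 3 * (k * k + 2 * s * k)"
  shows "2 * (t powi d * (\<Sum>\<^sub>\<infinity>(n,k). eul (t ^ 12) k * t powi (2 * (tri n + c * n + 3 * tri (n - 2 * k)))))
    = phi t * slater_R (t ^ 3) s + (-1) powi d * (phi (- t) * slater_R (- (t ^ 3)) s)"
proof -
  let ?p = "\<lambda>m k. m * m + 3 * (k * k + 2 * s * k)"
  let ?f = "\<lambda>t (m, k). eul (t ^ 12) k * t powi (?p m k)"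
  let ?S = "{(m, k). even (m + k + d)}"
  have t': "- t \<noteq> 0" "norm (- t) < 1" using t by auto
  have "phi t * slater_R (t ^ 3) s + (-1) powi d * (phi (- t) * slater_R (- (t ^ 3)) s)
    = infsum (?f t) UNIV + (-1) powi d * infsum (?f (- t)) UNIV"
    using phi_mult_slater_R(1)[OF t, of s] phi_mult_slater_R(1)[OF t', of s] by simp
  also have "\<dots> = (\<Sum>\<^sub>\<infinity>z. ?f t z + (-1) powi d * ?f (- t) z)"
    using phi_mult_slater_R(2)[OF t, of s] phi_mult_slater_R(2)[OF t', of s]
    by (intro infsumI[symmetric] has_sum_add has_sum_cmult_right has_sum_infsum)
  also have "\<dots> = (\<Sum>\<^sub>\<infinity>z\<in>?S. 2 * ?f t z)"
  proof (rule infsum_cong_neutral)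
    have *: "?f t (m, k) + (-1) powi d * ?f (- t) (m, k) = (if even (m + k + d) then 2 * ?f t (m, k) else 0)" for m k
    proof -
      \<comment> \<open>Modulo 2 the exponent m^2 + 3k^2 + 6sk reduces to m + k, so the passage to
        \<open>- t\<close> only sees this parity.\<close>
      have "even (?p m k) = even (m + k)" by auto
      then have "(-1) powi d * (- t) powi ?p m k = (if even (m + k + d) then 1 else - 1) * t powi ?p m k"
        by (auto simp: power_int_minus_left)
      moreover have "?f t (m, k) + (-1) powi d * ?f (- t) (m, k)
          = eul (t ^ 12) k * (t powi ?p m k + (-1) powi d * (- t) powi ?p m k)"
        by (simp add: algebra_simps)
      ultimately show ?thesis by simp
    qed
    show "?f t z + (-1) powi d * ?f (- t) z = 0" if "z \<in> UNIV - ?S" for z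
      using that *[of "fst z" "snd z"] by (auto simp: case_prod_unfold)
    show "?f t z + (-1) powi d * ?f (- t) z = 2 * ?f t z" if "z \<in> UNIV \<inter> ?S" for z
      using that *[of "fst z" "snd z"] by (auto simp: case_prod_unfold)
  qed auto
  also have "\<dots> = 2 * infsum (?f t) ?S" by (rule infsum_cmult_right')
  also have "infsum (?f t) ?S = (\<Sum>\<^sub>\<infinity>(n,k). t powi d * (eul (t ^ 12) k * t powi (2 * (tri n + c * n + 3 * tri (n - 2 * k)))))"
  proof (rule infsum_reindex_bij_witness[where
        i = "\<lambda>(n, k). (2 * n - 3 * k - d, k)" and j = "\<lambda>(m, k). ((m + 3 * k + d) div 2, k)"], goal_cases)
    case (1 a)
    obtain m k where a: "a = (m, k)" by (cases a)
    have "even (m + 3 * k + d)" using 1 a by auto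
    then have "2 * ((m + 3 * k + d) div 2) = m + 3 * k + d" by (rule dvd_mult_div_cancel)
    then show ?case by (simp add: a)
  next
    case (2 a) show ?case by simp
  next
    case (3 b) then show ?case by (auto simp: case_prod_unfold)
  next
    case (4 b) then show ?case by (auto simp: case_prod_unfold)
  next
    case (5 a)
    obtain m k where a: "a = (m, k)" by (cases a)
    define n where "n = (m + 3 * k + d) div 2"
    have "even (m + 3 * k + d)" using 5 a by auto
    then have m: "m = 2 * n - 3 * k - d" unfolding n_def by auto
    have P: "t powi d * t powi (2 * (tri n + c * n + 3 * tri (n - 2 * k))) = t powi ?p m k"
      using t power_int_add[of t "2 * (tri n + c * n + 3 * tri (n - 2 * k))" d] unfolding E m by (simp add: mult.commute)
    show ?case unfolding a prod.case n_def[symmetric] P[symmetric] by (simp only: mult.left_commute)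
  qed
  also have "\<dots> = t powi d * (\<Sum>\<^sub>\<infinity>(n,k). eul (t ^ 12) k * t powi (2 * (tri n + c * n + 3 * tri (n - 2 * k))))"
    unfolding case_prod_unfold by (rule infsum_cmult_right')
  finally show ?thesis ..
qed

lemma infsum_nat_pairs:
  fixes f :: "nat \<times> nat \<Rightarrow> complex" and g :: "int \<times> int \<Rightarrow> complex"
  assumes "\<And>i j. g (int i, int j) = f (i, j)" "\<And>i j. i < 0 \<or> j < 0 \<Longrightarrow> g (i, j) = 0"
  shows "infsum f UNIV = infsum g UNIV"
proof -
  let ?h = "map_prod int int"
  have "infsum g UNIV = infsum g (range ?h)"
  proof (rule infsum_cong_neutral)
    fix z assume "z \<in> UNIV - range ?h"
    moreover have "z = ?h (nat (fst z), nat (snd z))" if "\<not> (fst z < 0 \<or> snd z < 0)"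
      using that by (cases z) auto
    ultimately have "fst z < 0 \<or> snd z < 0" by blast
    then show "g z = 0" using assms(2)[of "fst z" "snd z"] by simp
  qed auto
  also have "\<dots> = infsum (g \<circ> ?h) UNIV"
    by (rule infsum_reindex) (auto simp: inj_def)
  also have "g \<circ> ?h = f" using assms(1) by (auto simp: fun_eq_iff)
  finally show ?thesis ..
qed

text \<open>With n = i - j the exponent separates into a part in \<open>n\<close> and
  \<open>3 * tri (j + 1)\<close>, so the inner sum over \<open>j\<close> is the convolution in base
  q^3. Absolute summability on both sides justifies the iterated sums.\<close>

lemma double_sum_eq:
  fixes c :: int
  assumes q: "q \<noteq> 0" "norm q < 1"
  shows "(\<Sum>\<^sub>\<infinity>(i,j). eul (q^3) i * eul (q^3) j * q powi (tri (i - j) + c * (i - j) + 3 * tri (j + 1)))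
    = (\<Sum>\<^sub>\<infinity>(n,k). eul (q^6) k * q powi (tri n + c * n + 3 * tri (n - 2 * k))) / qpoch_inf (q^3) (q^3)"
proof -
  let ?Q = "q ^ 3"
  have Q: "?Q \<noteq> 0" "norm ?Q < 1" using q norm_power_less_1[of q 3] by auto
  have Q2: "?Q\<^sup>2 = q ^ 6" by (simp flip: power_mult)
  let ?K = "\<lambda>a. (\<bar>a\<bar> + 1) * (\<bar>a\<bar> + 1) + 2 * (\<bar>a\<bar> + 1) + (2 :: int)"
  have K0: "?K a \<ge> 0" for a by simp
  let ?f = "\<lambda>(n, j). eul ?Q (n + j) * eul ?Q j * q powi (tri n + c * n + 3 * tri (j + 1))"
  let ?g = "\<lambda>(n, k). eul (q^6) k * q powi (tri n + c * n + 3 * tri (n - 2 * k))"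
  have "(\<Sum>\<^sub>\<infinity>(i,j). eul ?Q i * eul ?Q j * q powi (tri (i - j) + c * (i - j) + 3 * tri (j + 1))) = infsum ?f UNIV"
    by (rule infsum_reindex_bij_witness[where i = "\<lambda>(n, j). (n + j, j)" and j = "\<lambda>(i, j). (i - j, j)"]) auto
  also have "\<dots> = (\<Sum>\<^sub>\<infinity>n. \<Sum>\<^sub>\<infinity>j. ?f (n, j))"
  proof -
    obtain B where B: "B > 0" "\<And>i j. norm (eul ?Q i * eul ?Q j) \<le> B" using eul2_bounded[OF Q] by blast
    have "(\<lambda>z. norm (eul ?Q (fst z + snd z) * eul ?Q (snd z) * q powi (tri (fst z) + c * fst z + 3 * tri (snd z + 1)))) summable_on UNIV"
    proof (rule abs_summable_powi2[OF q, of "?K c + ?K 3"])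
      show "\<bar>n\<bar> + \<bar>j\<bar> - (?K c + ?K 3) \<le> tri (fst (n, j)) + c * fst (n, j) + 3 * tri (snd (n, j) + 1)" for n j
        using tri_linear_ge[of 1 n c] tri_linear_ge[of 3 j 3] by (simp add: tri_add)
    qed (use K0 B in auto)
    then have "?f summable_on UNIV" unfolding case_prod_unfold by (rule abs_summable_summable)
    then show ?thesis using infsum_Sigma_banach[of ?f UNIV "\<lambda>_. UNIV"] by simp
  qed
  also have "\<dots> = (\<Sum>\<^sub>\<infinity>n. \<Sum>\<^sub>\<infinity>k. ?g (n, k) / qpoch_inf ?Q ?Q)"
  proof (rule infsum_cong)
    fix n
    have "(\<Sum>\<^sub>\<infinity>j. ?f (n, j)) = (\<Sum>\<^sub>\<infinity>j. q powi (tri n + c * n) * (?Q powi tri (j + 1) * eul ?Q j * eul ?Q (j + n)))"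
      by (intro infsum_cong) (use q in \<open>simp add: power_powi power_int_add mult_ac add_ac\<close>)
    also have "\<dots> = q powi (tri n + c * n) * ((\<Sum>\<^sub>\<infinity>k. ?Q powi tri (n - 2 * k) * eul (?Q\<^sup>2) k) / qpoch_inf ?Q ?Q)"
      by (simp only: infsum_cmult_right' eul_convolution[OF Q])
    also have "\<dots> = q powi (tri n + c * n) / qpoch_inf ?Q ?Q * (\<Sum>\<^sub>\<infinity>k. ?Q powi tri (n - 2 * k) * eul (?Q\<^sup>2) k)"
      by simp
    also have "\<dots> = (\<Sum>\<^sub>\<infinity>k. q powi (tri n + c * n) / qpoch_inf ?Q ?Q * (?Q powi tri (n - 2 * k) * eul (?Q\<^sup>2) k))"
      by (rule infsum_cmult_right'[symmetric])
    also have "\<dots> = (\<Sum>\<^sub>\<infinity>k. ?g (n, k) / qpoch_inf ?Q ?Q)"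
      unfolding Q2 by (intro infsum_cong) (use q in \<open>simp add: power_powi power_int_add mult_ac\<close>)
    finally show "(\<Sum>\<^sub>\<infinity>j. ?f (n, j)) = (\<Sum>\<^sub>\<infinity>k. ?g (n, k) / qpoch_inf ?Q ?Q)" .
  qed
  also have "\<dots> = (\<Sum>\<^sub>\<infinity>n. \<Sum>\<^sub>\<infinity>k. ?g (n, k)) / qpoch_inf ?Q ?Q"
    unfolding divide_inverse by (simp only: infsum_cmult_left')
  also have "(\<Sum>\<^sub>\<infinity>n. \<Sum>\<^sub>\<infinity>k. ?g (n, k)) = infsum ?g UNIV"
  proof -
    have q6: "norm (q ^ 6) < 1" using q by (intro norm_power_less_1) auto
    obtain B where B: "B > 0" "\<And>k. norm (eul (q ^ 6) k) \<le> B" using eul_bounded[OF q6] by blast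
    let ?C = "?K (c + 1) + ?K (c - 1) + ?K 0"
    have "(\<lambda>z. norm (eul (q ^ 6) (snd z) * q powi (tri (fst z) + c * fst z + 3 * tri (fst z - 2 * snd z)))) summable_on UNIV"
    proof (rule abs_summable_powi2[OF q, of ?C])
      show "\<bar>n\<bar> + \<bar>k\<bar> - ?C \<le> tri (fst (n, k)) + c * fst (n, k) + 3 * tri (fst (n, k) - 2 * snd (n, k))" for n k
      proof -
        \<comment> \<open>Using both slopes \<open>c + 1\<close> and \<open>c - 1\<close> yields
          2|n|. One copy of |n| is then spent on |n - 2k| being at least 2|k| - |n|.\<close>
        have "\<bar>n\<bar> - ?K (c + 1) \<le> tri n + c * n + n" "\<bar>n\<bar> - ?K (c - 1) \<le> tri n + c * n - n"
          using tri_linear_ge[of 1 n "c + 1"] tri_linear_ge[of 1 n "c - 1"] by (simp_all add: algebra_simps)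
        then have "2 * \<bar>n\<bar> - ?K (c + 1) - ?K (c - 1) \<le> tri n + c * n"
          using K0[of "c + 1"] K0[of "c - 1"] by linarith
        moreover have "\<bar>n - 2 * k\<bar> - ?K 0 \<le> 3 * tri (n - 2 * k)"
          using tri_linear_ge[of 3 "n - 2 * k" 0] by simp
        ultimately show ?thesis by (simp only: fst_conv snd_conv) linarith
      qed
    qed (use K0 B in auto)
    then have "?g summable_on UNIV" unfolding case_prod_unfold by (rule abs_summable_summable)
    then show ?thesis using infsum_Sigma_banach[of ?g UNIV "\<lambda>_. UNIV"] by simp
  qed
  finally show ?thesis .
qed

text \<open>The exponent of \<open>S1\<close> is \<open>tri (i - j) + 3 * tri (j + 1)\<close>, so c
  = 0. Completing the square costs one power of \<open>t\<close>, which selects the difference of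
  the values at \<open>t\<close> and \<open>- t\<close>.\<close>

lemma S1_phi_slater_R:
  assumes t: "t \<noteq> 0" "norm t < 1"
  shows "2 * t * S1 (t\<^sup>2) * qpoch_inf (t ^ 6) (t ^ 6)
    = phi t * slater_R (t ^ 3) 0 - phi (- t) * slater_R (- (t ^ 3)) 0"
proof -
  have q: "t\<^sup>2 \<noteq> 0" "norm (t\<^sup>2) < 1" using norm_x2[OF t] by auto
  have Q: "(t\<^sup>2) ^ 3 = t ^ 6" "(t\<^sup>2) ^ 6 = t ^ 12" by (simp_all flip: power_mult)
  have nz: "qpoch_inf (t ^ 6) (t ^ 6) \<noteq> 0"
    using t norm_power_less_1[of t 6] by (intro qpoch_inf_nonzero) auto
  have "S1 (t\<^sup>2) = (\<Sum>\<^sub>\<infinity>(i,j). eul (t ^ 6) i * eul (t ^ 6) j * (t\<^sup>2) powi (tri (i - j) + 0 * (i - j) + 3 * tri (j + 1)))"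
    unfolding S1_def Q
  proof (rule infsum_nat_pairs)
    fix i j :: nat
    have "(int i * int i - int i) div 2 = tri (int i)" by (simp add: tri_def algebra_simps)
    moreover have "tri (int i) - int i * int j + 2 * int j * int j + 2 * int j = tri (int i - int j) + 0 * (int i - int j) + 3 * tri (int j + 1)"
      using two_tri[of "int i"] two_tri[of "int i - int j"] two_tri[of "int j + 1"] by (simp add: algebra_simps)
    ultimately have e: "(int i * int i - int i) div 2 - int i * int j + 2 * int j * int j + 2 * int j = tri (int i - int j) + 0 * (int i - int j) + 3 * tri (int j + 1)"
      by (simp only:)
    show "(case (int i, int j) of (i,j) \<Rightarrow> eul (t ^ 6) i * eul (t ^ 6) j * (t\<^sup>2) powi (tri (i - j) + 0 * (i - j) + 3 * tri (j + 1)))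
      = (case (i, j) of (i, j) \<Rightarrow> (t\<^sup>2) powi ((int i * int i - int i) div 2 - int i * int j + 2 * int j * int j + 2 * int j) / (qpoch (t ^ 6) (t ^ 6) i * qpoch (t ^ 6) (t ^ 6) j))"
      unfolding prod.case e eul_int by simp
  qed auto
  also have "\<dots> = (\<Sum>\<^sub>\<infinity>(n,k). eul (t ^ 12) k * (t\<^sup>2) powi (tri n + 0 * n + 3 * tri (n - 2 * k))) / qpoch_inf (t ^ 6) (t ^ 6)"
    by (rule double_sum_eq[OF q, unfolded Q])
  finally have "S1 (t\<^sup>2) * qpoch_inf (t ^ 6) (t ^ 6)
     = (\<Sum>\<^sub>\<infinity>(n,k). eul (t ^ 12) k * t powi (2 * (tri n + 0 * n + 3 * tri (n - 2 * k))))"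
    using nz by (simp add: powi_2_mult)
  moreover have E: "2 * (tri n + 0 * n + 3 * tri (n - 2 * k)) + 1
      = (2 * n - 3 * k - 1) * (2 * n - 3 * k - 1) + 3 * (k * k + 2 * 0 * k)" for n k
    using two_tri[of n] two_tri[of "n - 2 * k"] by (simp add: algebra_simps)
  ultimately show ?thesis
    using phi_slater_R_parity[OF t E] by (simp add: mult_ac)
qed

text \<open>Here the exponent has the extra \<open>2 * (i - j)\<close>. The square completes without
  a remaining power of \<open>t\<close>, so the sum of the values at \<open>t\<close> and
  \<open>- t\<close> appears.\<close>

lemma S2_phi_slater_R:
  assumes t: "t \<noteq> 0" "norm t < 1"
  shows "2 * S2 (t\<^sup>2) * qpoch_inf (t ^ 6) (t ^ 6)
    = phi t * slater_R (t ^ 3) 1 + phi (- t) * slater_R (- (t ^ 3)) 1"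
proof -
  have q: "t\<^sup>2 \<noteq> 0" "norm (t\<^sup>2) < 1" using norm_x2[OF t] by auto
  have Q: "(t\<^sup>2) ^ 3 = t ^ 6" "(t\<^sup>2) ^ 6 = t ^ 12" by (simp_all flip: power_mult)
  have nz: "qpoch_inf (t ^ 6) (t ^ 6) \<noteq> 0"
    using t norm_power_less_1[of t 6] by (intro qpoch_inf_nonzero) auto
  have "S2 (t\<^sup>2) = (\<Sum>\<^sub>\<infinity>(i,j). eul (t ^ 6) i * eul (t ^ 6) j * (t\<^sup>2) powi (tri (i - j) + 2 * (i - j) + 3 * tri (j + 1)))"
    unfolding S2_def Q
  proof (rule infsum_nat_pairs)
    fix i j :: nat
    have "int i * int i + 3 * int i = int i * (int i - 1) + int i * 2 * 2" by (simp add: algebra_simps)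
    then have "(int i * int i + 3 * int i) div 2 = tri (int i) + 2 * int i" unfolding tri_def by (simp add: algebra_simps)
    moreover have "tri (int i) + 2 * int i - int i * int j + 2 * int j * int j = tri (int i - int j) + 2 * (int i - int j) + 3 * tri (int j + 1)"
      using two_tri[of "int i"] two_tri[of "int i - int j"] two_tri[of "int j + 1"] by (simp add: algebra_simps)
    ultimately have e: "(int i * int i + 3 * int i) div 2 - int i * int j + 2 * int j * int j = tri (int i - int j) + 2 * (int i - int j) + 3 * tri (int j + 1)"
      by (simp only:)
    show "(case (int i, int j) of (i,j) \<Rightarrow> eul (t ^ 6) i * eul (t ^ 6) j * (t\<^sup>2) powi (tri (i - j) + 2 * (i - j) + 3 * tri (j + 1)))
      = (case (i, j) of (i, j) \<Rightarrow> (t\<^sup>2) powi ((int i * int i + 3 * int i) div 2 - int i * int j + 2 * int j * int j) / (qpoch (t ^ 6) (t ^ 6) i * qpoch (t ^ 6) (t ^ 6) j))"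
      unfolding prod.case e eul_int by simp
  qed auto
  also have "\<dots> = (\<Sum>\<^sub>\<infinity>(n,k). eul (t ^ 12) k * (t\<^sup>2) powi (tri n + 2 * n + 3 * tri (n - 2 * k))) / qpoch_inf (t ^ 6) (t ^ 6)"
    by (rule double_sum_eq[OF q, unfolded Q])
  finally have "S2 (t\<^sup>2) * qpoch_inf (t ^ 6) (t ^ 6)
     = (\<Sum>\<^sub>\<infinity>(n,k). eul (t ^ 12) k * t powi (2 * (tri n + 2 * n + 3 * tri (n - 2 * k))))"
    using nz by (simp add: powi_2_mult)
  moreover have E: "2 * (tri n + 2 * n + 3 * tri (n - 2 * k)) + 0
      = (2 * n - 3 * k - 0) * (2 * n - 3 * k - 0) + 3 * (k * k + 2 * 1 * k)" for n k
    using two_tri[of n] two_tri[of "n - 2 * k"] by (simp add: algebra_simps)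
  ultimately show ?thesis
    using phi_slater_R_parity[OF t E] by (simp add: mult_ac)
qed

section \<open>Theta series twisted by cube roots of unity\<close>

definition omega :: complex where "omega = Complex (- 1 / 2) (sqrt 3 / 2)"

lemma omega_sq: "omega\<^sup>2 = - 1 - omega"
  by (simp add: omega_def power2_eq_square complex_eq_iff)

lemma omega_cube: "omega ^ 3 = 1"
proof -
  have m: "omega * omega = - 1 - omega" using omega_sq by (simp add: power2_eq_square)
  have "omega ^ 3 = omega * (omega * omega)" by (simp add: power3_eq_cube)
  also have "\<dots> = - omega - omega * omega" unfolding m by (simp add: right_diff_distrib m)
  also have "\<dots> = 1" unfolding m by simp
  finally show ?thesis .
qed

lemma norm_omega [simp]: "norm omega = 1"
  by (simp add: omega_def cmod_def power_divide)

lemma omega_nonzero [simp]: "omega \<noteq> 0"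
  using norm_omega by fastforce

text \<open>Three times the indicator of the multiples of 3, minus 1. This reading yields the two
  products in each formula of the theorem; the reading through \<open>omega\<close> gives access to
  the triple product.\<close>

definition chi :: "int \<Rightarrow> complex" where "chi n = (if 3 dvd n then 2 else - 1)"

lemma chi_omega: "chi n = omega powi n + omega powi (- n)"
proof -
  have p3: "omega powi (3 * k) = 1" for k
    using power_int_mult[of omega 3 k] by (simp add: omega_cube)
  have inv: "inverse omega = omega\<^sup>2"
    using omega_cube by (simp add: field_simps power2_eq_square power3_eq_cube)
  define k where "k = n div 3"
  consider "n = 3 * k" | "n = 3 * k + 1" | "n = 3 * k + 2" unfolding k_def by linarith
  then show ?thesis
  proof cases
    case 1
    then show ?thesis using p3[of k] p3[of "- k"] by (simp add: chi_def)
  next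
    case 2
    have "\<not> 3 dvd n" using 2 by presburger
    moreover have "omega powi n = omega" using p3[of k] by (simp add: 2 power_int_add)
    moreover have "omega powi (- n) = omega\<^sup>2" using inv calculation by (simp add: power_int_minus)
    ultimately show ?thesis by (simp add: chi_def omega_sq)
  next
    case 3
    have "\<not> 3 dvd n" using 3 by presburger
    moreover have "omega powi n = omega\<^sup>2" using p3[of k] by (simp add: 3 power_int_add)
    moreover have "omega powi (- n) = omega" using inv calculation by (simp add: power_int_minus flip: inv)
    ultimately show ?thesis by (simp add: chi_def omega_sq)
  qed
qed

lemma chi_minus [simp]: "chi (- n) = chi n"
  by (simp add: chi_def)

lemma norm_chi_le: "norm (chi n) \<le> 2"
  by (simp add: chi_def)

text \<open>Writing \<open>chi\<close> with \<open>omega\<close> gives two halves exchanged by u to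
  -1 - u. Each is a theta series at z = -omega^2 t, and (1 + omega^2 y)(1 + omega y)(1 + y) = 1 +
  y^3 merges its product with (-t;t)_inf into base t^3.\<close>

lemma sum_chi_triangular:
  assumes t: "t \<noteq> 0" "norm t < 1"
  shows "(\<Sum>\<^sub>\<infinity>u. chi (2 * u + 1) * t powi tri (u + 1)) * qpoch_inf (- t) t
     = - 2 * qpoch_inf t t * qpoch_inf (- (t ^ 3)) (t ^ 3)"
proof -
  let ?z = "- (omega\<^sup>2) * t"
  have nz: "norm ?z = norm t" by (simp add: norm_mult norm_power)
  let ?f = "\<lambda>u. omega powi (2 * u + 1) * t powi tri (u + 1)"
  have f: "?f u = omega * jterm ?z t u" for u
  proof -
    have "?z = (-1) * (omega\<^sup>2 * t)" by simp
    then have 1: "?z powi u = (-1) powi u * (omega powi (2 * u) * t powi u)"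
      by (simp only: power_int_mult_distrib powi_2_mult)
    have 2: "(-1::complex) powi u * (-1) powi u = 1" by (simp flip: power_int_mult_distrib)
    have "omega * jterm ?z t u = ((-1) powi u * (-1) powi u) * (omega * omega powi (2 * u)) * (t powi tri u * t powi u)"
      unfolding jterm_def 1 by (simp only: mult_ac)
    also have "\<dots> = ?f u" unfolding 2 using t by (simp add: tri_add power_int_add)
    finally show ?thesis ..
  qed
  have sf: "?f summable_on UNIV"
    unfolding f using t nz by (intro summable_on_cmult_right abs_summable_summable[OF abs_summable_jterm]) auto
  have "infsum ?f UNIV = omega * jtheta ?z t"
    unfolding f jtheta_def by (rule infsum_cmult_right')
  also have "jtheta ?z t = qpoch_inf ?z t * qpoch_inf (t / ?z) t * qpoch_inf t t"
    using t nz by (intro jacobi_triple_product) auto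
  also have "t / ?z = - omega"
    using t omega_cube by (simp add: field_simps power2_eq_square power3_eq_cube)
  \<comment> \<open>The leading factor 1 + \<open>omega\<close> is split off; multiplied by the
    prefactor \<open>omega\<close> it gives -1.\<close>
  also have "qpoch_inf (- omega) t = (1 + omega) * qpoch_inf (- omega * t) t"
    using qpoch_inf_split[OF t(2), of "- omega" 1] by (simp add: qpoch_Suc qpoch_def)
  finally have F: "infsum ?f UNIV = - (qpoch_inf ?z t * qpoch_inf (- omega * t) t * qpoch_inf t t)"
  proof -
    assume "infsum ?f UNIV = omega * (qpoch_inf ?z t * ((1 + omega) * qpoch_inf (- omega * t) t) * qpoch_inf t t)"
    moreover have "omega * (1 + omega) = - 1" using omega_sq by (simp add: distrib_left power2_eq_square)
    moreover have "omega * (a * ((1 + omega) * b) * c) = omega * (1 + omega) * (a * b * c)" for a b c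
      by (simp only: mult_ac)
    ultimately show ?thesis by simp
  qed
  have "(\<Sum>\<^sub>\<infinity>u. chi (2 * u + 1) * t powi tri (u + 1)) = (\<Sum>\<^sub>\<infinity>u. ?f u + ?f (- 1 - u))"
  proof (rule infsum_cong)
    fix u :: int
    have "2 * (- 1 - u) + 1 = - (2 * u + 1)" by simp
    moreover have "tri (- 1 - u + 1) = tri (u + 1)"
      using two_tri[of "- 1 - u + 1"] two_tri[of "u + 1"] by (simp add: algebra_simps)
    ultimately show "chi (2 * u + 1) * t powi tri (u + 1) = ?f u + ?f (- 1 - u)"
      by (simp only: chi_omega distrib_right)
  qed
  also have "\<dots> = infsum ?f UNIV + (\<Sum>\<^sub>\<infinity>u. ?f (- 1 - u))"
    using sf summable_on_reindex_bij_witness[of UNIV "\<lambda>n. - 1 - n" "\<lambda>n. - 1 - n" UNIV ?f "\<lambda>r. ?f (- 1 - r)"]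
    by (intro infsum_add) auto
  also have "(\<Sum>\<^sub>\<infinity>u. ?f (- 1 - u)) = infsum ?f UNIV" by (rule infsum_reflect_int)
  finally have C: "(\<Sum>\<^sub>\<infinity>u. chi (2 * u + 1) * t powi tri (u + 1)) = - 2 * (qpoch_inf ?z t * qpoch_inf (- omega * t) t * qpoch_inf t t)"
    unfolding F by simp
  have "qpoch_inf ?z t * qpoch_inf (- omega * t) t * qpoch_inf (- t) t = qpoch_inf (- (t ^ 3)) (t ^ 3)"
  proof (rule qpoch_inf_eqI[symmetric])
    show "norm (t ^ 3) < 1" using t by (intro norm_power_less_1) auto
    have eq: "qpoch (- (t ^ 3)) (t ^ 3) n = qpoch ?z t n * qpoch (- omega * t) t n * qpoch (- t) t n" for n
    proof -
      have cubic: "(1 + omega\<^sup>2 * y) * (1 + omega * y) * (1 + y) = 1 + y ^ 3" for y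
      proof -
        have "(1 + omega\<^sup>2 * y) * (1 + omega * y) * (1 + y)
          = 1 + (1 + omega + omega\<^sup>2) * y + (omega + omega\<^sup>2 + omega ^ 3) * y\<^sup>2 + omega ^ 3 * y ^ 3"
          by (simp add: algebra_simps power2_eq_square power3_eq_cube)
        then show ?thesis by (simp add: omega_cube omega_sq)
      qed
      have "1 - - (t ^ 3) * (t ^ 3) ^ k = (1 - ?z * t ^ k) * (1 - - omega * t * t ^ k) * (1 - - t * t ^ k)" for k
        using cubic[of "t * t ^ k"] by (simp add: power_mult_distrib mult.assoc flip: power_mult)
          (simp add: mult.commute)
      then show ?thesis unfolding qpoch_def prod.distrib[symmetric] by simp
    qed
    have "(\<lambda>n. qpoch ?z t n * qpoch (- omega * t) t n * qpoch (- t) t n)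
        \<longlonglongrightarrow> qpoch_inf ?z t * qpoch_inf (- omega * t) t * qpoch_inf (- t) t"
      by (intro tendsto_mult qpoch_LIMSEQ t)
    then show "qpoch (- (t ^ 3)) (t ^ 3) \<longlonglongrightarrow> qpoch_inf ?z t * qpoch_inf (- omega * t) t * qpoch_inf (- t) t"
      unfolding eq[symmetric] .
  qed
  then show ?thesis unfolding C by (simp add: mult_ac)
qed

section \<open>Theta series in base q^5 weighted by chi\<close>

lemma jtheta_power5:
  assumes x: "x \<noteq> 0"
  shows "jtheta (x ^ a) (x ^ 5) = (\<Sum>\<^sub>\<infinity>n. (-1) powi n * x powi (5 * tri n + int a * n))"
    and "jtheta (x ^ a) (x ^ 5) = (\<Sum>\<^sub>\<infinity>n. (-1) powi n * x powi (5 * tri n + (5 - int a) * n))"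
proof -
  have j: "jterm (x ^ a) (x ^ 5) n = (-1) powi n * x powi (5 * tri n + int a * n)" for n
    unfolding jterm_def power_powi using x by (simp add: power_int_add mult_ac)
  show 1: "jtheta (x ^ a) (x ^ 5) = (\<Sum>\<^sub>\<infinity>n. (-1) powi n * x powi (5 * tri n + int a * n))"
    unfolding jtheta_def j ..
  have "5 * tri (0 - n) + int a * (0 - n) = 5 * tri n + (5 - int a) * n" for n
    using tri_minus[of n] by (simp add: algebra_simps)
  then show "jtheta (x ^ a) (x ^ 5) = (\<Sum>\<^sub>\<infinity>n. (-1) powi n * x powi (5 * tri n + (5 - int a) * n))"
    unfolding 1 by (subst infsum_reflect_int[of _ 0, symmetric]) simp
qed

lemma infsum_mult_abs_summable:
  fixes a b :: "int \<Rightarrow> complex"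
  assumes a: "(\<lambda>m. norm (a m)) summable_on UNIV" and b: "(\<lambda>n. norm (b n)) summable_on UNIV"
  shows "infsum a UNIV * infsum b UNIV = (\<Sum>\<^sub>\<infinity>(m, n). a m * b n)"
proof -
  have "(\<lambda>(m, n). norm (a m) * norm (b n)) summable_on (UNIV \<times> UNIV)"
  proof (rule summable_on_SigmaI[where g = "\<lambda>m. norm (a m) * (\<Sum>\<^sub>\<infinity>n. norm (b n))"])
    show "(\<lambda>m. norm (a m) * (\<Sum>\<^sub>\<infinity>n. norm (b n))) summable_on UNIV"
      by (rule summable_on_cmult_left[OF a])
  qed (use b in \<open>auto intro!: has_sum_cmult_right\<close>)
  then have "(\<lambda>z. norm (case z of (m, n) \<Rightarrow> a m * b n)) summable_on UNIV"
    by (simp add: case_prod_unfold norm_mult)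
  then have s: "(\<lambda>(m, n). a m * b n) summable_on UNIV \<times> UNIV"
    using abs_summable_summable by auto
  have "(\<Sum>\<^sub>\<infinity>(m, n). a m * b n) = (\<Sum>\<^sub>\<infinity>m. \<Sum>\<^sub>\<infinity>n. a m * b n)"
    using infsum_Sigma'_banach[OF s] by simp
  also have "\<dots> = (\<Sum>\<^sub>\<infinity>m. a m * infsum b UNIV)"
    by (simp only: infsum_cmult_right')
  also have "\<dots> = infsum a UNIV * infsum b UNIV" by (rule infsum_cmult_left')
  finally show ?thesis ..
qed

lemma infsum_chi:
  fixes f :: "int \<Rightarrow> complex"
  assumes f: "f summable_on UNIV"
  shows "(\<Sum>\<^sub>\<infinity>n. chi (n + k) * f n) = 3 * (\<Sum>\<^sub>\<infinity>m. f (3 * m - k)) - infsum f UNIV"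
proof -
  let ?g = "\<lambda>n. if 3 dvd n + k then f n else 0"
  have r: "(\<lambda>m. 3 * m - k) ` UNIV = {n. 3 dvd n + k}"
  proof -
    have "n \<in> range (\<lambda>m. 3 * m - k)" if "3 dvd n + k" for n
      using that by (intro image_eqI[of _ _ "(n + k) div 3"]) auto
    then show ?thesis by auto
  qed
  have inj: "inj (\<lambda>m::int. 3 * m - k)" by (simp add: inj_def)
  have "f summable_on {n. 3 dvd n + k}" by (rule summable_on_subset_banach[OF f]) simp
  then have sg: "?g summable_on UNIV"
    by (rule summable_on_cong_neutral[THEN iffD1, rotated -1]) auto
  have "infsum ?g UNIV = infsum f {n. 3 dvd n + k}"
    by (rule infsum_cong_neutral) auto
  also have "\<dots> = (\<Sum>\<^sub>\<infinity>m. f (3 * m - k))"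
    unfolding r[symmetric] by (subst infsum_reindex[OF inj]) (simp add: o_def)
  finally have g: "infsum ?g UNIV = (\<Sum>\<^sub>\<infinity>m. f (3 * m - k))" .
  have "(\<Sum>\<^sub>\<infinity>n. chi (n + k) * f n) = (\<Sum>\<^sub>\<infinity>n. 3 * ?g n + (-1) * f n)"
    by (intro infsum_cong) (simp add: chi_def)
  also have "\<dots> = 3 * infsum ?g UNIV + (-1) * infsum f UNIV"
    by (intro infsumI has_sum_add has_sum_cmult_right has_sum_infsum sg f)
  finally show ?thesis by (simp add: g)
qed

text \<open>The quantities s_1 and s_2 of the outline are \<open>chi_theta q 0 4\<close> and
  \<open>- chi_theta q 1 3\<close>.\<close>

definition chi_theta :: "complex \<Rightarrow> int \<Rightarrow> int \<Rightarrow> complex" where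
  "chi_theta q k a = (\<Sum>\<^sub>\<infinity>n. chi (n + k) * ((-1) powi n * q powi (5 * tri n + a * n)))"

lemma summable_chi_theta:
  assumes q: "q \<noteq> 0" "norm q < 1"
  shows "(\<lambda>n. norm ((-1) powi n * q powi (5 * tri n + a * n))) summable_on UNIV"
    and "(\<lambda>n. norm (chi (n + k) * ((-1) powi n * q powi (5 * tri n + a * n)))) summable_on UNIV"
proof -
  have "(\<lambda>n. norm ((g n * (-1) powi n) * q powi (5 * tri n + a * n))) summable_on UNIV" if "\<And>n. norm (g n) \<le> 2" for g
  proof (rule abs_summable_powi[OF q])
    show "norm (g n * (-1) powi n) \<le> 2" for n using that by (simp add: norm_mult)
    show "\<bar>n\<bar> - ((\<bar>a\<bar> + 1) * (\<bar>a\<bar> + 1) + 2 * (\<bar>a\<bar> + 1) + 2) \<le> 5 * tri n + a * n" for n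
      by (rule tri_linear_ge) simp
  qed simp
  from this[of "\<lambda>_. 1"] this[of "\<lambda>n. chi (n + k)"] norm_chi_le
  show "(\<lambda>n. norm ((-1) powi n * q powi (5 * tri n + a * n))) summable_on UNIV"
    and "(\<lambda>n. norm (chi (n + k) * ((-1) powi n * q powi (5 * tri n + a * n)))) summable_on UNIV"
    by (simp_all add: mult.assoc)
qed

text \<open>On n = 3m the exponent is 9 times one of the same shape, which turns base q^5 into q^45.
  The -1 in \<open>chi\<close> contributes the unscaled series.\<close>

lemma chi_theta_0_4:
  assumes q: "q \<noteq> 0" "norm q < 1"
  shows "chi_theta q 0 4 = 3 * jtheta (q ^ 18) (q ^ 45) - jtheta q (q ^ 5)"
proof -
  let ?f = "\<lambda>n. (-1) powi n * q powi (5 * tri n + 4 * n)"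
  have sf: "?f summable_on UNIV" by (rule abs_summable_summable[OF summable_chi_theta(1)[OF q]])
  have "(\<Sum>\<^sub>\<infinity>m. ?f (3 * m - 0)) = (\<Sum>\<^sub>\<infinity>m. (-1) powi m * (q ^ 9) powi (5 * tri m + (5 - int 2) * m))"
  proof (rule infsum_cong)
    fix m
    have 1: "5 * tri (3 * m - 0) + 4 * (3 * m - 0) = 9 * (5 * tri m + (5 - int 2) * m)"
      using two_tri[of "3 * m - 0"] two_tri[of m] by (simp add: algebra_simps)
    have 2: "(-1::complex) powi (3 * m - 0) = (-1) powi m" by (simp add: power_int_minus_left)
    show "?f (3 * m - 0) = (-1) powi m * (q ^ 9) powi (5 * tri m + (5 - int 2) * m)"
      unfolding power_powi 1 2 by simp
  qed
  also have "\<dots> = jtheta ((q ^ 9) ^ 2) ((q ^ 9) ^ 5)"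
    using q by (intro jtheta_power5(2)[symmetric]) simp
  also have "\<dots> = jtheta (q ^ 18) (q ^ 45)" by (simp flip: power_mult)
  finally show ?thesis
    unfolding chi_theta_def infsum_chi[OF sf] using jtheta_power5(2)[OF q(1), of 1] by simp
qed

text \<open>The selected indices are n = 3m - 1. There the exponent is 2 plus 9 times one of the
  same shape, the source of q^2, and the sign picked up by (-1)^n is offset by the leading
  minus.\<close>

lemma chi_theta_1_3:
  assumes q: "q \<noteq> 0" "norm q < 1"
  shows "- chi_theta q 1 3 = 3 * q\<^sup>2 * jtheta (q ^ 9) (q ^ 45) + jtheta (q\<^sup>2) (q ^ 5)"
proof -
  let ?f = "\<lambda>n. (-1) powi n * q powi (5 * tri n + 3 * n)"
  have sf: "?f summable_on UNIV" by (rule abs_summable_summable[OF summable_chi_theta(1)[OF q]])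
  have "(\<Sum>\<^sub>\<infinity>m. ?f (3 * m - 1)) = (\<Sum>\<^sub>\<infinity>m. - (q\<^sup>2) * ((-1) powi m * (q ^ 9) powi (5 * tri m + int 1 * m)))"
  proof (rule infsum_cong)
    fix m
    have 1: "5 * tri (3 * m - 1) + 3 * (3 * m - 1) = 2 + 9 * (5 * tri m + int 1 * m)"
      using two_tri[of "3 * m - 1"] two_tri[of m] by (simp add: algebra_simps)
    have 2: "(-1::complex) powi (3 * m - 1) = - ((-1) powi m)" by (simp add: power_int_minus_left)
    have 3: "q powi (2 + 9 * (5 * tri m + int 1 * m)) = q\<^sup>2 * q powi (9 * (5 * tri m + int 1 * m))"
      using q by (subst power_int_add) auto
    show "?f (3 * m - 1) = - (q\<^sup>2) * ((-1) powi m * (q ^ 9) powi (5 * tri m + int 1 * m))"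
      unfolding power_powi 1 2 3 by simp
  qed
  also have "\<dots> = - (q\<^sup>2) * jtheta ((q ^ 9) ^ 1) ((q ^ 9) ^ 5)"
    using q by (subst infsum_cmult_right', subst jtheta_power5(1)) auto
  also have "\<dots> = - (q\<^sup>2) * jtheta (q ^ 9) (q ^ 45)" by (simp flip: power_mult)
  finally show ?thesis
    unfolding chi_theta_def infsum_chi[OF sf] using jtheta_power5(2)[OF q(1), of 2] by simp
qed

section \<open>Splitting a two-variable theta series along a sublattice of index 5\<close>

context
  fixes t :: complex
  assumes t: "t \<noteq> 0" "norm t < 1"
begin

definition lattice_term :: "int \<Rightarrow> int \<Rightarrow> complex" where
  "lattice_term u w = (-1) powi w * chi (2 * u + 1) * t powi (tri (u + 1) + 3 * (w * w))"

lemma lattice_summable: "(\<lambda>(u, w). lattice_term u w) summable_on A"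
proof -
  have "(\<lambda>z. norm (((-1) powi snd z * chi (2 * fst z + 1)) * t powi (tri (fst z + 1) + 3 * (snd z * snd z)))) summable_on UNIV"
  proof (rule abs_summable_powi2[OF t])
    show "norm ((-1) powi snd z * chi (2 * fst z + 1)) \<le> 2" for z :: "int \<times> int"
      using norm_chi_le by (simp add: norm_mult)
    show "\<bar>n\<bar> + \<bar>k\<bar> - 10 \<le> tri (fst (n, k) + 1) + 3 * (snd (n, k) * snd (n, k))" for n k
      using tri_linear_ge[of 1 n 1] int_abs_le_square[of k] by (simp add: tri_add)
  qed simp
  then have "(\<lambda>(u, w). lattice_term u w) summable_on UNIV"
    unfolding lattice_term_def case_prod_unfold by (rule abs_summable_summable)
  then show ?thesis by (rule summable_on_subset_banach) simp
qed

lemma lattice_sum_product: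
  "(\<Sum>\<^sub>\<infinity>(u, w). lattice_term u w) = (\<Sum>\<^sub>\<infinity>u. chi (2 * u + 1) * t powi tri (u + 1)) * jtheta (t ^ 3) (t ^ 6)"
proof -
  have j: "jterm (t ^ 3) (t ^ 6) w = (-1) powi w * t powi (3 * (w * w))" for w
  proof -
    have "3 * w + 6 * tri w = 3 * (w * w)" using two_tri[of w] by simp
    then show ?thesis unfolding jterm_def power_powi using t power_int_add[of t "3 * w" "6 * tri w"] by (simp add: mult.assoc)
  qed
  have "(\<Sum>\<^sub>\<infinity>(u, w). lattice_term u w) = (\<Sum>\<^sub>\<infinity>u. \<Sum>\<^sub>\<infinity>w. lattice_term u w)"
    using infsum_Sigma_banach[of "\<lambda>(u, w). lattice_term u w" UNIV "\<lambda>_. UNIV"] lattice_summable by simp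
  also have "\<dots> = (\<Sum>\<^sub>\<infinity>u. chi (2 * u + 1) * t powi tri (u + 1) * jtheta (t ^ 3) (t ^ 6))"
    unfolding jtheta_def infsum_cmult_right'[symmetric] j lattice_term_def
    by (intro infsum_cong) (use t in \<open>simp add: power_int_add mult_ac\<close>)
  also have "\<dots> = (\<Sum>\<^sub>\<infinity>u. chi (2 * u + 1) * t powi tri (u + 1)) * jtheta (t ^ 3) (t ^ 6)"
    by (rule infsum_cmult_left')
  finally show ?thesis .
qed

text \<open>The classes are chosen for their coordinates: on class r one can write u = 2m + 3n + r
  and w = m - n, and then the cross term in m and n of the quadratic exponent cancels.\<close>

lemma lattice_split:
  "(\<Sum>\<^sub>\<infinity>(u, w). lattice_term u w) = (\<Sum>r\<in>{0..4}. \<Sum>\<^sub>\<infinity>(u, w)\<in>{(u, w). (u + 3 * w) mod 5 = r}. lattice_term u w)"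
proof -
  have "(\<Sum>r\<in>{0..4::int}. \<Sum>\<^sub>\<infinity>(u, w)\<in>{(u, w). (u + 3 * w) mod 5 = r}. lattice_term u w)
    = (\<Sum>\<^sub>\<infinity>(u, w)\<in>(\<Union>r\<in>{0..4::int}. {(u, w). (u + 3 * w) mod 5 = r}). lattice_term u w)"
    by (rule sum_infsum) (auto intro: lattice_summable)
  also have "(\<Union>r\<in>{0..4::int}. {(u, w). (u + 3 * w) mod 5 = r}) = UNIV"
  proof -
    have "(u + 3 * w) mod 5 \<in> {0..4}" for u w :: int
      using pos_mod_bound[of 5 "u + 3 * w"] pos_mod_sign[of 5 "u + 3 * w"] by auto
    then show ?thesis by auto
  qed
  finally show ?thesis ..
qed

lemma lattice_class:
  assumes "0 \<le> r" "r \<le> 4"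
  shows "(\<Sum>\<^sub>\<infinity>(u, w)\<in>{(u, w). (u + 3 * w) mod 5 = r}. lattice_term u w)
    = (\<Sum>\<^sub>\<infinity>(k, w). lattice_term (5 * k + r - 3 * w) w)"
proof (rule infsum_reindex_bij_witness[where
      i = "\<lambda>(k, w). (5 * k + r - 3 * w, w)" and j = "\<lambda>(u, w). ((u + 3 * w) div 5, w)"], goal_cases)
  case (1 a)
  obtain u w where a: "a = (u, w)" by (cases a)
  have "5 * ((u + 3 * w) div 5) + r = u + 3 * w"
    using 1 a mult_div_mod_eq[of 5 "u + 3 * w"] by simp
  then show ?case by (simp add: a)
next
  case (3 b)
  obtain k w where b: "b = (k, w)" by (cases b)
  show ?case using assms by (simp add: b)
next
  case (4 b)
  obtain k w where b: "b = (k, w)" by (cases b)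
  show ?case using assms by (simp add: b)
next
  case (5 a)
  obtain u w where a: "a = (u, w)" by (cases a)
  have "5 * ((u + 3 * w) div 5) + r = u + 3 * w"
    using 5 a mult_div_mod_eq[of 5 "u + 3 * w"] by simp
  then show ?case by (simp add: a)
qed simp

text \<open>In these coordinates the exponent is a sum of a function of \<open>m\<close> and one of
  \<open>n\<close>, and modulo 3 the argument of \<open>chi\<close> depends on \<open>m\<close>
  alone. So the class factors into a twisted series in t^2 and an untwisted one in t^3.\<close>

lemma lattice_class_theta:
  fixes s :: int
  assumes s: "s = 0 \<or> s = 1"
  shows "(\<Sum>\<^sub>\<infinity>(m, n). lattice_term (2 * m + 3 * n + s) (m - n))
    = t powi s * chi_theta (t\<^sup>2) (1 - s) (3 + s) * jtheta ((t ^ 3) ^ nat (2 - s)) ((t ^ 3) ^ 5)"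
    (is "infsum ?L UNIV = _")
proof -
  have q: "t\<^sup>2 \<noteq> 0" "norm (t\<^sup>2) < 1" and x: "t ^ 3 \<noteq> 0" "norm (t ^ 3) < 1"
    using t norm_power_less_1[of t 2] norm_power_less_1[of t 3] by auto
  let ?a = "\<lambda>m. chi (m + (1 - s)) * ((-1) powi m * (t\<^sup>2) powi (5 * tri m + (3 + s) * m))"
  let ?b = "\<lambda>n. (-1) powi n * (t ^ 3) powi (5 * tri n + (3 + s) * n)"
  have L: "?L (m, n) = t powi s * (?a m * ?b n)" for m n
  proof -
    have 1: "(-1::complex) powi (m - n) = (-1) powi m * (-1) powi n"
      using power_int_add[of "-1::complex" m "- n"] by simp
    have "3 dvd 2 * (2 * m + 3 * n + s) + 1 \<longleftrightarrow> 3 dvd m + (1 - s)"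
      using s by presburger
    then have 2: "chi (2 * (2 * m + 3 * n + s) + 1) = chi (m + (1 - s))" by (simp add: chi_def)
    have e: "tri (2 * m + 3 * n + s + 1) + 3 * ((m - n) * (m - n))
      = s + (2 * (5 * tri m + (3 + s) * m) + 3 * (5 * tri n + (3 + s) * n))"
      using s two_tri[of "2 * m + 3 * n + s + 1"] two_tri[of m] two_tri[of n] by (auto simp: algebra_simps)
    have 3: "t powi (s + (2 * (5 * tri m + (3 + s) * m) + 3 * (5 * tri n + (3 + s) * n)))
      = t powi s * ((t\<^sup>2) powi (5 * tri m + (3 + s) * m) * (t ^ 3) powi (5 * tri n + (3 + s) * n))"
      unfolding power_powi using t power_int_add[of t s] power_int_add[of t "2 * (5 * tri m + (3 + s) * m)"] by simp
    show ?thesis unfolding lattice_term_def prod.case 1 2 e 3 by (simp only: mult_ac)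
  qed
  have sb: "(\<lambda>n. norm (?b n)) summable_on UNIV" by (rule summable_chi_theta(1)[OF x])
  have sa: "(\<lambda>m. norm (?a m)) summable_on UNIV" by (rule summable_chi_theta(2)[OF q])
  have "infsum ?L UNIV = (\<Sum>\<^sub>\<infinity>(m, n). t powi s * (?a m * ?b n))"
    using L by (intro infsum_cong) auto
  also have "\<dots> = t powi s * (\<Sum>\<^sub>\<infinity>(m, n). ?a m * ?b n)"
    unfolding case_prod_unfold by (rule infsum_cmult_right')
  also have "(\<Sum>\<^sub>\<infinity>(m, n). ?a m * ?b n) = infsum ?a UNIV * infsum ?b UNIV"
    by (rule infsum_mult_abs_summable[OF sa sb, symmetric])
  also have "infsum ?a UNIV = chi_theta (t\<^sup>2) (1 - s) (3 + s)" by (simp add: chi_theta_def)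
  \<comment> \<open>The linear coefficient \<open>3 + s\<close> is 5 - (2 - s), hence the power
    \<open>nat (2 - s)\<close> in the reflected form of the theta series.\<close>
  also have "infsum ?b UNIV = jtheta ((t ^ 3) ^ nat (2 - s)) ((t ^ 3) ^ 5)"
    using s unfolding jtheta_power5(2)[OF x(1)] by auto
  finally show ?thesis by (simp add: mult.assoc)
qed

lemma lattice_term_reflect: "lattice_term (- 1 - u) (- w) = lattice_term u w"
proof -
  have 1: "tri (- 1 - u + 1) = tri (u + 1)" and 2: "2 * (- 1 - u) + 1 = - (2 * u + 1)"
    using two_tri[of "- 1 - u + 1"] two_tri[of "u + 1"] by (simp_all add: algebra_simps)
  show ?thesis unfolding lattice_term_def 1 2 chi_minus by simp
qed

text \<open>The involution n to -1 - n preserves the exponent and the value of \<open>chi\<close>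
  but reverses the sign, so the terms cancel.\<close>

lemma lattice_class_vanishes: "(\<Sum>\<^sub>\<infinity>(m, n). lattice_term (2 * m - 3 * n - 1) (m + n + 1)) = 0"
proof -
  let ?f = "\<lambda>(m, n). lattice_term (2 * m - 3 * n - 1) (m + n + 1)"
  have "infsum ?f UNIV = (\<Sum>\<^sub>\<infinity>(m, n). ?f (m, - 1 - n))"
    by (rule infsum_reindex_bij_witness[where i = "\<lambda>(m, n). (m, - 1 - n)" and j = "\<lambda>(m, n). (m, - 1 - n)"])
      (auto simp: algebra_simps)
  also have "\<dots> = (\<Sum>\<^sub>\<infinity>z. - ?f z)"
  proof (rule infsum_cong)
    fix z :: "int \<times> int"
    obtain m n where z: "z = (m, n)" by (cases z)
    have 1: "(-1::complex) powi (m + (- 1 - n) + 1) = - ((-1) powi (m + n + 1))"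
      by (simp add: power_int_minus_left)
    have "3 dvd 2 * (2 * m - 3 * (- 1 - n) - 1) + 1 \<longleftrightarrow> 3 dvd 2 * (2 * m - 3 * n - 1) + 1"
      by presburger
    then have 2: "chi (2 * (2 * m - 3 * (- 1 - n) - 1) + 1) = chi (2 * (2 * m - 3 * n - 1) + 1)" by (simp add: chi_def)
    have 3: "tri (2 * m - 3 * (- 1 - n) - 1 + 1) + 3 * ((m + (- 1 - n) + 1) * (m + (- 1 - n) + 1))
       = tri (2 * m - 3 * n - 1 + 1) + 3 * ((m + n + 1) * (m + n + 1))"
      using two_tri[of "2 * m - 3 * (- 1 - n) - 1 + 1"] two_tri[of "2 * m - 3 * n - 1 + 1"] by (simp add: algebra_simps)
    show "(case z of (m, n) \<Rightarrow> ?f (m, - 1 - n)) = - ?f z"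
      unfolding z prod.case lattice_term_def 1 2 3 by simp
  qed
  also have "\<dots> = - infsum ?f UNIV" by (rule infsum_uminus)
  finally show ?thesis by simp
qed

text \<open>The central symmetry of the lattice identifies class 4 - r with class r, and class 2
  cancels in itself. Classes 0 and 1 remain, each counted twice.\<close>

lemma lattice_identity:
  "(\<Sum>\<^sub>\<infinity>u. chi (2 * u + 1) * t powi tri (u + 1)) * jtheta (t ^ 3) (t ^ 6)
   = 2 * (chi_theta (t\<^sup>2) 1 3 * jtheta ((t ^ 3)\<^sup>2) ((t ^ 3) ^ 5) + t * chi_theta (t\<^sup>2) 0 4 * jtheta (t ^ 3) ((t ^ 3) ^ 5))"
proof -
  let ?A = "\<lambda>r. \<Sum>\<^sub>\<infinity>(k, w). lattice_term (5 * k + r - 3 * w) w"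
  let ?T = "\<lambda>s. \<Sum>\<^sub>\<infinity>(m, n). lattice_term (2 * m + 3 * n + s) (m - n)"
  have A01: "?A s = ?T s" for s
    by (rule infsum_reindex_bij_witness[where i = "\<lambda>(m, n). (m, m - n)" and j = "\<lambda>(k, w). (k, k - w)"])
      (auto simp: algebra_simps)
  \<comment> \<open>The witness composes the coordinates of class \<open>s\<close> with the symmetry
    of (u, w) to (-1 - u, -w).\<close>
  have A34: "?A (4 - s) = ?T s" for s
  proof (rule infsum_reindex_bij_witness[where i = "\<lambda>(m, n). (- 1 - m, n - m)" and j = "\<lambda>(k, w). (- 1 - k, w - 1 - k)"], goal_cases)
    case (5 a)
    obtain k w where a: "a = (k, w)" by (cases a)
    have "lattice_term (2 * (- 1 - k) + 3 * (w - 1 - k) + s) ((- 1 - k) - (w - 1 - k))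
       = lattice_term (- 1 - (5 * k + (4 - s) - 3 * w)) (- w)"
      by (simp add: algebra_simps)
    then show ?case unfolding a prod.case lattice_term_reflect .
  qed auto
  have A2: "?A 2 = 0"
  proof -
    have "?A 2 = (\<Sum>\<^sub>\<infinity>(m, n). lattice_term (2 * m - 3 * n - 1) (m + n + 1))"
      by (rule infsum_reindex_bij_witness[where i = "\<lambda>(m, n). (m, m + n + 1)" and j = "\<lambda>(k, w). (k, w - k - 1)"])
        (auto simp: algebra_simps)
    then show ?thesis by (simp add: lattice_class_vanishes)
  qed
  have "{0..4::int} = {0, 1, 2, 3, 4}" by auto
  then have "(\<Sum>\<^sub>\<infinity>(u, w). lattice_term u w) = ?A 0 + ?A 1 + ?A 2 + ?A 3 + ?A 4"
    unfolding lattice_split by (simp add: lattice_class)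
  also have "\<dots> = 2 * (?T 0 + ?T 1)"
    using A01[of 0] A01[of 1] A34[of 0] A34[of 1] A2 by simp
  also have "?T 0 = chi_theta (t\<^sup>2) 1 3 * jtheta ((t ^ 3)\<^sup>2) ((t ^ 3) ^ 5)"
    using lattice_class_theta[of 0] by simp
  also have "?T 1 = t * chi_theta (t\<^sup>2) 0 4 * jtheta (t ^ 3) ((t ^ 3) ^ 5)"
    using lattice_class_theta[of 1] by simp
  finally show ?thesis unfolding lattice_sum_product .
qed

end

section \<open>The product formulas\<close>

lemma qpoch_inf_power_residues:
  assumes "norm (q :: complex) < 1" "m > 0" "n > 0"
  shows "qpoch_inf (q ^ a) (q ^ m) = (\<Prod>r<n. qpoch_inf (q ^ (a + m * r)) (q ^ (m * n)))"
  using qpoch_inf_residues[OF norm_power_less_1[OF assms(1,2)] assms(3), of "q ^ a"]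
  by (simp add: power_add power_mult)

lemma qpoch_inf_double:
  assumes "norm (q :: complex) < 1"
  shows "qpoch_inf q q = qpoch_inf q (q\<^sup>2) * qpoch_inf (q\<^sup>2) (q\<^sup>2)"
  using qpoch_inf_residues[OF assms, of 2 q] by (simp add: lessThan_Suc numeral_2_eq_2 mult.commute)

text \<open>Euler's identity between partitions into odd parts and into distinct parts.\<close>

lemma qpoch_inf_odd_mult_minus:
  assumes q: "norm (q :: complex) < 1"
  shows "qpoch_inf q (q\<^sup>2) * qpoch_inf (- q) q = 1"
proof -
  have q2: "norm (q\<^sup>2) < 1" using q by (intro norm_power_less_1) auto
  have "qpoch_inf q (q\<^sup>2) * (qpoch_inf (q\<^sup>2) (q\<^sup>2) * qpoch_inf (- q) q) = qpoch_inf (q\<^sup>2) (q\<^sup>2)"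
    using qpoch_inf_mult_minus[OF q, of q] qpoch_inf_double[OF q] by (simp add: mult_ac)
  then show ?thesis using qpoch_inf_nonzero[OF q2 q2] by (simp add: mult.left_commute)
qed

lemma phi_minus_eq_jtheta:
  assumes t: "t \<noteq> 0"
  shows "phi (- t) = jtheta t (t\<^sup>2)"
  unfolding phi_def jtheta_def
proof (rule infsum_cong)
  fix n
  have "(- t) powi (n * n) = (-1) powi n * t powi (n * n)" by (simp add: power_int_minus_left)
  moreover have "n + 2 * tri n = n * n" using two_tri[of n] by simp
  ultimately show "(- t) powi (n * n) = jterm t (t\<^sup>2) n"
    unfolding jterm_def powi_2_mult using t power_int_add[of t n "2 * tri n"] by (simp add: mult.assoc)
qed

lemma jtheta_self_square:
  assumes t: "t \<noteq> 0" "norm t < 1"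
  shows "jtheta t (t\<^sup>2) = qpoch_inf t (t\<^sup>2) ^ 2 * qpoch_inf (t\<^sup>2) (t\<^sup>2)"
proof -
  have "jtheta t (t\<^sup>2) = qpoch_inf t (t\<^sup>2) * qpoch_inf (t\<^sup>2 / t) (t\<^sup>2) * qpoch_inf (t\<^sup>2) (t\<^sup>2)"
    using t norm_power_less_1[of t 2] power_decreasing[of 1 2 "norm t"]
    by (intro jacobi_triple_product) (auto simp: norm_power)
  then show ?thesis using t by (simp add: power2_eq_square)
qed

text \<open>The left side is minus half of the lattice sum, which also factors as a product. Euler's
  identity in base \<open>t\<close> and in base \<open>x\<close> reduces that product to the right
  side.\<close>

lemma chi_theta_relation:
  assumes t: "t \<noteq> 0" "norm t < 1"
  defines "x \<equiv> t ^ 3"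
  shows "jtheta (x\<^sup>2) (x ^ 5) * (- chi_theta (t\<^sup>2) 1 3) - t * jtheta x (x ^ 5) * chi_theta (t\<^sup>2) 0 4
    = qpoch_inf x x * phi (- t)"
proof -
  have x: "x \<noteq> 0" "norm x < 1" using t norm_power_less_1[of t 3] by (auto simp: x_def)
  let ?C = "\<Sum>\<^sub>\<infinity>u. chi (2 * u + 1) * t powi tri (u + 1)"
  have "t ^ 6 = x\<^sup>2" by (simp add: x_def flip: power_mult)
  then have J: "jtheta (t ^ 3) (t ^ 6) = qpoch_inf x (x\<^sup>2) ^ 2 * qpoch_inf (x\<^sup>2) (x\<^sup>2)"
    using jtheta_self_square[OF x] by (simp add: x_def)
  have C: "?C = - 2 * qpoch_inf t t * qpoch_inf t (t\<^sup>2) * qpoch_inf (- x) x"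
  proof -
    \<comment> \<open>Euler's identity supplies a factor 1, so that the value of \<open>?C\<close>
      multiplied by (-t;t)_inf can be inserted.\<close>
    have "?C = ?C * qpoch_inf (- t) t * qpoch_inf t (t\<^sup>2)"
      using qpoch_inf_odd_mult_minus[OF t(2)] by (simp add: mult_ac)
    then show ?thesis unfolding sum_chi_triangular[OF t] x_def by (simp add: mult_ac)
  qed
  have "jtheta (x\<^sup>2) (x ^ 5) * (- chi_theta (t\<^sup>2) 1 3) - t * jtheta x (x ^ 5) * chi_theta (t\<^sup>2) 0 4
     = - (?C * jtheta (t ^ 3) (t ^ 6)) / 2"
    unfolding lattice_identity[OF t] x_def by (simp add: algebra_simps)
  also have "\<dots> = (qpoch_inf t t * qpoch_inf t (t\<^sup>2)) * (qpoch_inf x (x\<^sup>2) * qpoch_inf (x\<^sup>2) (x\<^sup>2))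
      * (qpoch_inf x (x\<^sup>2) * qpoch_inf (- x) x)"
    unfolding C J by (simp add: power2_eq_square)
  also have "\<dots> = phi (- t) * qpoch_inf x x"
    unfolding qpoch_inf_odd_mult_minus[OF x(2)] qpoch_inf_double[OF x(2), symmetric]
      phi_minus_eq_jtheta[OF t(1)] jtheta_self_square[OF t]
    by (simp add: qpoch_inf_double[OF t(2)] power2_eq_square)
  finally show ?thesis by simp
qed

text \<open>Multiplying by the common Slater constant replaces the theta series by
  \<open>slater_R\<close>; the product (-x;x^2)_inf (x;x^2)_inf contracts to base x^4.\<close>

lemma slater_R_chi_theta_relation:
  assumes t: "t \<noteq> 0" "norm t < 1"
  defines "x \<equiv> t ^ 3"
  shows "slater_R x 0 * (- chi_theta (t\<^sup>2) 1 3) - t * slater_R x 1 * chi_theta (t\<^sup>2) 0 4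
    = qpoch_inf (x\<^sup>2) (x ^ 4) * phi (- t)"
proof -
  have x: "x \<noteq> 0" "norm x < 1" using t norm_power_less_1[of t 3] by (auto simp: x_def)
  let ?K = "slater_const x"
  have x2: "norm (x\<^sup>2) < 1" using x by (intro norm_power_less_1) auto
  have nz: "qpoch_inf (x\<^sup>2) (x\<^sup>2) \<noteq> 0" by (rule qpoch_inf_nonzero[OF x2 x2])
  have "slater_R x 0 * (- chi_theta (t\<^sup>2) 1 3) - t * slater_R x 1 * chi_theta (t\<^sup>2) 0 4
     = ?K * (jtheta (x\<^sup>2) (x ^ 5) * (- chi_theta (t\<^sup>2) 1 3) - t * jtheta x (x ^ 5) * chi_theta (t\<^sup>2) 0 4)"
    unfolding slater_R_0[OF x] slater_R_1[OF x] by (simp add: algebra_simps)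
  also have "\<dots> = ?K * qpoch_inf x x * phi (- t)"
    using chi_theta_relation[OF t] by (simp add: x_def)
  also have "?K * qpoch_inf x x = qpoch_inf (- x) (x\<^sup>2) * qpoch_inf x (x\<^sup>2)"
    unfolding slater_const_def[OF x] qpoch_inf_double[OF x(2)] using nz by simp
  also have "\<dots> = qpoch_inf (x\<^sup>2) (x ^ 4)"
    using qpoch_inf_mult_minus[OF x2, of x] by (simp add: mult.commute flip: power_mult)
  finally show ?thesis .
qed

text \<open>The relation at \<open>t\<close> and at \<open>- t\<close> consists of two linear
  equations in the same \<open>s1\<close> and \<open>s2\<close>. Combining them with the
  coefficients from the parity formulas produces the Casoratian, whose value 2 cancels the factor 2
  in those formulas.\<close>

lemma S_chi_theta:
  assumes t: "t \<noteq> 0" "norm t < 1"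
  defines "P \<equiv> qpoch_inf (t ^ 12) (t ^ 12) / (qpoch_inf (t ^ 6) (t ^ 6))\<^sup>2"
  shows "S1 (t\<^sup>2) = P * chi_theta (t\<^sup>2) 0 4" and "S2 (t\<^sup>2) = P * (- chi_theta (t\<^sup>2) 1 3)"
proof -
  define x where "x = t ^ 3"
  have t': "- t \<noteq> 0" "norm (- t) < 1" using t by auto
  have x: "x \<noteq> 0" "norm x < 1" using t norm_power_less_1[of t 3] by (auto simp: x_def)
  have t6: "norm (t ^ 6) < 1" and t12: "norm (t ^ 12) < 1" using t by (auto intro: norm_power_less_1)
  define A B A' B' where "A = slater_R x 0" and "B = slater_R x 1"
    and "A' = slater_R (- x) 0" and "B' = slater_R (- x) 1"
  define s1 s2 where "s1 = chi_theta (t\<^sup>2) 0 4" and "s2 = - chi_theta (t\<^sup>2) 1 3"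
  let ?k = "qpoch_inf (x\<^sup>2) (x ^ 4)" and ?Q = "qpoch_inf (t ^ 6) (t ^ 6)"
  have W: "A * B' + B * A' = 2"
    using slater_R_casoratian[OF x] by (simp add: A_def B_def A'_def B'_def)
  have 1: "A * s2 - t * B * s1 = ?k * phi (- t)"
    using slater_R_chi_theta_relation[OF t] by (simp add: A_def B_def s1_def s2_def x_def)
  \<comment> \<open>Passing to \<open>- t\<close> negates \<open>x\<close> and turns
    \<open>phi (- t)\<close> into \<open>phi t\<close>, while \<open>s1\<close>, \<open>s2\<close>
    and \<open>?k\<close> involve even powers of \<open>t\<close> only.\<close>
  have 2: "A' * s2 + t * B' * s1 = ?k * phi t"
    using slater_R_chi_theta_relation[OF t'] by (simp add: A'_def B'_def s1_def s2_def x_def)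
  have S1: "2 * t * S1 (t\<^sup>2) * ?Q = phi t * A - phi (- t) * A'"
    using S1_phi_slater_R[OF t] by (simp add: A_def A'_def x_def)
  have S2: "2 * S2 (t\<^sup>2) * ?Q = phi t * B + phi (- t) * B'"
    using S2_phi_slater_R[OF t] by (simp add: B_def B'_def x_def)
  have "2 * (?k * ?Q * S2 (t\<^sup>2)) = ?k * (2 * S2 (t\<^sup>2) * ?Q)" by (simp add: mult_ac)
  also have "\<dots> = (?k * phi t) * B + (?k * phi (- t)) * B'" unfolding S2 by (simp add: algebra_simps)
  also have "\<dots> = (A * B' + B * A') * s2" unfolding 1[symmetric] 2[symmetric] by (simp add: algebra_simps)
  finally have k2: "?k * ?Q * S2 (t\<^sup>2) = s2" unfolding W by simp
  have "2 * t * (?k * ?Q * S1 (t\<^sup>2)) = ?k * (2 * t * S1 (t\<^sup>2) * ?Q)" by (simp add: mult_ac)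
  also have "\<dots> = (?k * phi t) * A - (?k * phi (- t)) * A'" unfolding S1 by (simp add: algebra_simps)
  also have "\<dots> = t * (A * B' + B * A') * s1" unfolding 1[symmetric] 2[symmetric] by (simp add: algebra_simps)
  finally have k1: "?k * ?Q * S1 (t\<^sup>2) = s1" unfolding W using t by (simp add: mult.assoc)
  have x26: "x\<^sup>2 = t ^ 6" "x ^ 4 = t ^ 12" "(t ^ 6)\<^sup>2 = t ^ 12" by (simp_all add: x_def flip: power_mult)
  have nz: "?Q \<noteq> 0" "qpoch_inf (t ^ 12) (t ^ 12) \<noteq> 0"
    by (intro qpoch_inf_nonzero t6 t12)+
  \<comment> \<open>Separating odd from even exponents shows that \<open>P\<close> is the reciprocal
    of \<open>?k * ?Q\<close>.\<close>
  have "?Q = ?k * qpoch_inf (t ^ 12) (t ^ 12)"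
    using qpoch_inf_double[OF t6] by (simp add: x26)
  then have "P * (?k * ?Q) = 1" using nz by (simp add: P_def power2_eq_square)
  then have P: "P * (?k * ?Q * z) = z" for z by (metis mult.assoc mult_1)
  show "S1 (t\<^sup>2) = P * chi_theta (t\<^sup>2) 0 4"
    using P[of "S1 (t\<^sup>2)"] k1 by (simp add: s1_def)
  show "S2 (t\<^sup>2) = P * (- chi_theta (t\<^sup>2) 1 3)"
    using P[of "S2 (t\<^sup>2)"] k2 by (simp add: s2_def)
qed

section \<open>From theta series to the products modulo 30 and 45\<close>

lemma jtheta_power:
  assumes q: "q \<noteq> 0" "norm q < 1" and ab: "0 < a" "0 < b"
  shows "jtheta (q ^ a) (q ^ (a + b)) = qpoch_inf (q ^ a) (q ^ (a + b)) * qpoch_inf (q ^ b) (q ^ (a + b)) * qpoch_inf (q ^ (a + b)) (q ^ (a + b))"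
proof -
  have "q ^ (a + b) / q ^ a = q ^ b" using q by (simp add: power_add)
  moreover have "norm (q ^ (a + b)) \<le> norm (q ^ a)"
    using q by (simp add: norm_power power_decreasing)
  moreover have "norm (q ^ a) \<le> 1" using q by (simp add: norm_power power_le_one)
  ultimately show ?thesis
    using jacobi_triple_product[of "q ^ (a + b)" "q ^ a"] q norm_power_less_1[of q "a + b"] ab by simp
qed

lemma qpoch_inf_power_nonzero:
  assumes "norm (q :: complex) < 1" "a > 0" "m > 0"
  shows "qpoch_inf (q ^ a) (q ^ m) \<noteq> 0"
  by (intro qpoch_inf_nonzero norm_power_less_1 assms)

text \<open>Splitting every factor into residue classes modulo 30 gives the same product on both
  sides. The identity is stated without denominators, so no nonvanishing is required.\<close>

lemma product_mod_30_first:
  assumes q: "norm q < 1"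
  shows "qpoch_inf (q^4) (q^10) * qpoch_inf (q^6) (q^10) * qpoch_inf (q^10) (q^10)
       * qpoch_inf q (q^30) * qpoch_inf (q^5) (q^30) * qpoch_inf (q^11) (q^30) * qpoch_inf (q^19) (q^30) * qpoch_inf (q^25) (q^30) * qpoch_inf (q^29) (q^30)
       * qpoch_inf (q^3) (q^3)
     = qpoch_inf (q^6) (q^6) * (qpoch_inf q (q^5) * qpoch_inf (q^4) (q^5) * qpoch_inf (q^5) (q^5))
       * (qpoch_inf (q^3) (q^30) * qpoch_inf (q^27) (q^30))"
proof -
  have e10_4: "qpoch_inf (q^4) (q^10)
    = qpoch_inf (q^4) (q^30) * qpoch_inf (q^14) (q^30) * qpoch_inf (q^24) (q^30)"
    using qpoch_inf_power_residues[OF q, of 10 3 4] by (simp add: lessThan_nat_numeral mult_ac)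
  have e10_6: "qpoch_inf (q^6) (q^10)
    = qpoch_inf (q^6) (q^30) * qpoch_inf (q^16) (q^30) * qpoch_inf (q^26) (q^30)"
    using qpoch_inf_power_residues[OF q, of 10 3 6] by (simp add: lessThan_nat_numeral mult_ac)
  have e10_10: "qpoch_inf (q^10) (q^10)
    = qpoch_inf (q^10) (q^30) * qpoch_inf (q^20) (q^30) * qpoch_inf (q^30) (q^30)"
    using qpoch_inf_power_residues[OF q, of 10 3 10] by (simp add: lessThan_nat_numeral mult_ac)
  have e5_1: "qpoch_inf q (q^5)
    = qpoch_inf q (q^30) * qpoch_inf (q^6) (q^30) * qpoch_inf (q^11) (q^30) * qpoch_inf (q^16) (q^30) * qpoch_inf (q^21) (q^30) * qpoch_inf (q^26) (q^30)"
    using qpoch_inf_power_residues[OF q, of 5 6 1]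
    by (simp add: lessThan_nat_numeral mult_ac del: power_Suc add_2_eq_Suc add_2_eq_Suc' plus_1_eq_Suc One_nat_def)
  have e5_4: "qpoch_inf (q^4) (q^5)
    = qpoch_inf (q^4) (q^30) * qpoch_inf (q^9) (q^30) * qpoch_inf (q^14) (q^30) * qpoch_inf (q^19) (q^30) * qpoch_inf (q^24) (q^30) * qpoch_inf (q^29) (q^30)"
    using qpoch_inf_power_residues[OF q, of 5 6 4] by (simp add: lessThan_nat_numeral mult_ac)
  have e5_5: "qpoch_inf (q^5) (q^5)
    = qpoch_inf (q^5) (q^30) * qpoch_inf (q^10) (q^30) * qpoch_inf (q^15) (q^30) * qpoch_inf (q^20) (q^30) * qpoch_inf (q^25) (q^30) * qpoch_inf (q^30) (q^30)"
    using qpoch_inf_power_residues[OF q, of 5 6 5] by (simp add: lessThan_nat_numeral mult_ac)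
  have e3_3: "qpoch_inf (q^3) (q^3)
    = qpoch_inf (q^3) (q^30) * qpoch_inf (q^6) (q^30) * qpoch_inf (q^9) (q^30) * qpoch_inf (q^12) (q^30) * qpoch_inf (q^15) (q^30) * qpoch_inf (q^18) (q^30) * qpoch_inf (q^21) (q^30) * qpoch_inf (q^24) (q^30) * qpoch_inf (q^27) (q^30) * qpoch_inf (q^30) (q^30)"
    using qpoch_inf_power_residues[OF q, of 3 10 3] by (simp add: lessThan_nat_numeral mult_ac)
  have e6_6: "qpoch_inf (q^6) (q^6)
    = qpoch_inf (q^6) (q^30) * qpoch_inf (q^12) (q^30) * qpoch_inf (q^18) (q^30) * qpoch_inf (q^24) (q^30) * qpoch_inf (q^30) (q^30)"
    using qpoch_inf_power_residues[OF q, of 6 5 6] by (simp add: lessThan_nat_numeral mult_ac)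
  show ?thesis
    unfolding e10_4 e10_6 e10_10 e5_1 e5_4 e5_5 e3_3 e6_6
    by (simp only: mult_ac)
qed

lemma product_mod_30_second:
  assumes q: "norm q < 1"
  shows "qpoch_inf (q^2) (q^10) * qpoch_inf (q^8) (q^10) * qpoch_inf (q^10) (q^10)
       * qpoch_inf (q^5) (q^30) * qpoch_inf (q^7) (q^30) * qpoch_inf (q^13) (q^30) * qpoch_inf (q^17) (q^30) * qpoch_inf (q^23) (q^30) * qpoch_inf (q^25) (q^30)
       * qpoch_inf (q^3) (q^3)
     = qpoch_inf (q^6) (q^6) * (qpoch_inf (q^2) (q^5) * qpoch_inf (q^3) (q^5) * qpoch_inf (q^5) (q^5))
       * (qpoch_inf (q^9) (q^30) * qpoch_inf (q^21) (q^30))"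
proof -
  have e10_2: "qpoch_inf (q^2) (q^10)
    = qpoch_inf (q^2) (q^30) * qpoch_inf (q^12) (q^30) * qpoch_inf (q^22) (q^30)"
    using qpoch_inf_power_residues[OF q, of 10 3 2]
    by (simp add: lessThan_nat_numeral mult_ac del: power_Suc add_2_eq_Suc add_2_eq_Suc' plus_1_eq_Suc One_nat_def)
  have e10_8: "qpoch_inf (q^8) (q^10)
    = qpoch_inf (q^8) (q^30) * qpoch_inf (q^18) (q^30) * qpoch_inf (q^28) (q^30)"
    using qpoch_inf_power_residues[OF q, of 10 3 8] by (simp add: lessThan_nat_numeral mult_ac)
  have e10_10: "qpoch_inf (q^10) (q^10)
    = qpoch_inf (q^10) (q^30) * qpoch_inf (q^20) (q^30) * qpoch_inf (q^30) (q^30)"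
    using qpoch_inf_power_residues[OF q, of 10 3 10] by (simp add: lessThan_nat_numeral mult_ac)
  have e5_2: "qpoch_inf (q^2) (q^5)
    = qpoch_inf (q^2) (q^30) * qpoch_inf (q^7) (q^30) * qpoch_inf (q^12) (q^30) * qpoch_inf (q^17) (q^30) * qpoch_inf (q^22) (q^30) * qpoch_inf (q^27) (q^30)"
    using qpoch_inf_power_residues[OF q, of 5 6 2]
    by (simp add: lessThan_nat_numeral mult_ac del: power_Suc add_2_eq_Suc add_2_eq_Suc' plus_1_eq_Suc One_nat_def)
  have e5_3: "qpoch_inf (q^3) (q^5)
    = qpoch_inf (q^3) (q^30) * qpoch_inf (q^8) (q^30) * qpoch_inf (q^13) (q^30) * qpoch_inf (q^18) (q^30) * qpoch_inf (q^23) (q^30) * qpoch_inf (q^28) (q^30)"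
    using qpoch_inf_power_residues[OF q, of 5 6 3] by (simp add: lessThan_nat_numeral mult_ac)
  have e5_5: "qpoch_inf (q^5) (q^5)
    = qpoch_inf (q^5) (q^30) * qpoch_inf (q^10) (q^30) * qpoch_inf (q^15) (q^30) * qpoch_inf (q^20) (q^30) * qpoch_inf (q^25) (q^30) * qpoch_inf (q^30) (q^30)"
    using qpoch_inf_power_residues[OF q, of 5 6 5] by (simp add: lessThan_nat_numeral mult_ac)
  have e3_3: "qpoch_inf (q^3) (q^3)
    = qpoch_inf (q^3) (q^30) * qpoch_inf (q^6) (q^30) * qpoch_inf (q^9) (q^30) * qpoch_inf (q^12) (q^30) * qpoch_inf (q^15) (q^30) * qpoch_inf (q^18) (q^30) * qpoch_inf (q^21) (q^30) * qpoch_inf (q^24) (q^30) * qpoch_inf (q^27) (q^30) * qpoch_inf (q^30) (q^30)"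
    using qpoch_inf_power_residues[OF q, of 3 10 3] by (simp add: lessThan_nat_numeral mult_ac)
  have e6_6: "qpoch_inf (q^6) (q^6)
    = qpoch_inf (q^6) (q^30) * qpoch_inf (q^12) (q^30) * qpoch_inf (q^18) (q^30) * qpoch_inf (q^24) (q^30) * qpoch_inf (q^30) (q^30)"
    using qpoch_inf_power_residues[OF q, of 6 5 6] by (simp add: lessThan_nat_numeral mult_ac)
  show ?thesis
    unfolding e10_2 e10_8 e10_10 e5_2 e5_3 e5_5 e3_3 e6_6
    by (simp only: mult_ac)
qed

section \<open>The degenerate case q = 0\<close>

lemma infsum_eq_sum_support:
  fixes f :: "nat \<times> nat \<Rightarrow> complex"
  assumes "finite A" "\<And>z. z \<notin> A \<Longrightarrow> f z = 0"
  shows "infsum f UNIV = sum f A"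
proof -
  have "infsum f UNIV = infsum f A" by (rule infsum_cong_neutral) (use assms in auto)
  then show ?thesis using assms by simp
qed

lemma qpoch_inf_0 [simp]: "qpoch_inf 0 q = 1"
  by (simp add: qpoch_inf_def)

lemma qpoch_0_left [simp]: "qpoch 0 q n = 1"
  by (simp add: qpoch_def)

text \<open>At q = 0 only pairs with exponent 0 contribute. The exponent is a sum of the nonnegative
  numbers \<open>tri (i - j)\<close> and \<open>3 * tri (j + 1)\<close>, which forces j = 0 and i =
  0 or 1.\<close>

lemma S1_0: "S1 0 = 2"
proof -
  let ?f = "\<lambda>(i, j). 0 powi ((int i * int i - int i) div 2 - int i * int j + 2 * int j * int j + 2 * int j)
     / (qpoch (0 ^ 3) (0 ^ 3) i * qpoch (0 ^ 3) (0 ^ 3) j) :: complex"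
  have "S1 0 = sum ?f {(0, 0), (1, 0)}"
    unfolding S1_def
  proof (rule infsum_eq_sum_support)
    fix z :: "nat \<times> nat" assume z: "z \<notin> {(0, 0), (1, 0)}"
    obtain i j where ij: "z = (i, j)" by (cases z)
    have 1: "(int i * int i - int i) div 2 = tri (int i)" by (simp add: tri_def algebra_simps)
    have 2: "tri (int i) - int i * int j + 2 * int j * int j + 2 * int j = tri (int i - int j) + 3 * tri (int j + 1)"
      using two_tri[of "int i"] two_tri[of "int i - int j"] two_tri[of "int j + 1"] by (simp add: algebra_simps)
    have "tri (int i - int j) + 3 * tri (int j + 1) \<noteq> 0"
    proof
      assume *: "tri (int i - int j) + 3 * tri (int j + 1) = 0"
      then have "tri (int i - int j) = 0" "tri (int j + 1) = 0"
        using tri_nonneg[of "int i - int j"] tri_nonneg[of "int j + 1"] by linarith+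
      then have "(int j + 1) * int j = 0" "(int i - int j) * (int i - int j - 1) = 0"
        using two_tri[of "int j + 1"] two_tri[of "int i - int j"] by (simp_all add: algebra_simps)
      then have "j = 0" "i = 0 \<or> i = 1" by auto
      then show False using z ij by auto
    qed
    then show "?f z = 0" unfolding ij prod.case 1 2 by simp
  qed simp
  also have "\<dots> = 2" by simp
  finally show ?thesis .
qed

text \<open>Twice the exponent is (i - j)^2 + 3i + 3j^2, positive away from the origin, so a single
  term remains.\<close>

lemma S2_0: "S2 0 = 1"
proof -
  let ?f = "\<lambda>(i, j). 0 powi ((int i * int i + 3 * int i) div 2 - int i * int j + 2 * int j * int j)
     / (qpoch (0 ^ 3) (0 ^ 3) i * qpoch (0 ^ 3) (0 ^ 3) j) :: complex"
  have "S2 0 = sum ?f {(0, 0)}"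
    unfolding S2_def
  proof (rule infsum_eq_sum_support)
    fix z :: "nat \<times> nat" assume z: "z \<notin> {(0, 0)}"
    obtain i j where ij: "z = (i, j)" by (cases z)
    have "2 * ((int i * int i + 3 * int i) div 2) = int i * int i + 3 * int i"
      by (intro dvd_mult_div_cancel) simp
    moreover have "0 < int i * int i + 3 * int i - 2 * (int i * int j) + 4 * (int j * int j)"
    proof -
      have "0 \<le> (int i - int j) * (int i - int j)" by simp
      moreover have "0 < 3 * int i + 3 * (int j * int j)"
        using z ij by (cases "i = 0") (auto intro: add_pos_nonneg)
      ultimately show ?thesis by (simp add: algebra_simps)
    qed
    ultimately have "(int i * int i + 3 * int i) div 2 - int i * int j + 2 * int j * int j \<noteq> 0" by linarith
    then show "?f z = 0" unfolding ij prod.case by simp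
  qed simp
  also have "\<dots> = 1" by simp
  finally show ?thesis .
qed

theorem theorem1p4:
  fixes q :: complex
  assumes "norm q < 1"
  shows "(S1 q = 3 * (qpoch_inf (q^6) (q^6) * qpoch_inf (q^18) (q^45) * qpoch_inf (q^27) (q^45)
                     * qpoch_inf (q^45) (q^45)) / (qpoch_inf (q^3) (q^3))^2
              - (qpoch_inf (q^4) (q^10) * qpoch_inf (q^6) (q^10) * qpoch_inf (q^10) (q^10)
                 * qpoch_inf q (q^30) * qpoch_inf (q^5) (q^30) * qpoch_inf (q^11) (q^30)
                 * qpoch_inf (q^19) (q^30) * qpoch_inf (q^25) (q^30) * qpoch_inf (q^29) (q^30))
                / (qpoch_inf (q^3) (q^3) * qpoch_inf (q^3) (q^30) * qpoch_inf (q^27) (q^30))) \<and>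
         (S2 q = 3 * q^2 * (qpoch_inf (q^6) (q^6) * qpoch_inf (q^9) (q^45) * qpoch_inf (q^36) (q^45)
                     * qpoch_inf (q^45) (q^45)) / (qpoch_inf (q^3) (q^3))^2
              + (qpoch_inf (q^2) (q^10) * qpoch_inf (q^8) (q^10) * qpoch_inf (q^10) (q^10)
                 * qpoch_inf (q^5) (q^30) * qpoch_inf (q^7) (q^30) * qpoch_inf (q^13) (q^30)
                 * qpoch_inf (q^17) (q^30) * qpoch_inf (q^23) (q^30) * qpoch_inf (q^25) (q^30))
                / (qpoch_inf (q^3) (q^3) * qpoch_inf (q^9) (q^30) * qpoch_inf (q^21) (q^30)))"
proof (cases "q = 0")
  case True
  then show ?thesis by (simp add: S1_0 S2_0)
next
  case False
  \<comment> \<open>A square root makes the half-integer exponents of the argument integral; only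
    \<open>t\<^sup>2 = q\<close> is used about it.\<close>
  define t where "t = csqrt q"
  have q: "q = t\<^sup>2" by (simp add: t_def)
  have t: "t \<noteq> 0" "norm t < 1"
    using False assms by (auto simp: q norm_power power_less_one_iff)
  have t6: "t ^ 6 = q ^ 3" "t ^ 12 = q ^ 6" by (simp_all add: q flip: power_mult)
  let ?Q = "qpoch_inf (q^3) (q^3)" and ?P = "qpoch_inf (q^6) (q^6) / (qpoch_inf (q^3) (q^3))\<^sup>2"
  have nz: "?Q \<noteq> 0" "qpoch_inf (q^3) (q^30) \<noteq> 0" "qpoch_inf (q^27) (q^30) \<noteq> 0"
     "qpoch_inf (q^9) (q^30) \<noteq> 0" "qpoch_inf (q^21) (q^30) \<noteq> 0"
    by (intro qpoch_inf_power_nonzero assms; simp)+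
  \<comment> \<open>Converts the denominator-free identities modulo 30 into the quotients of the
    statement.\<close>
  have aux: "a * c / b\<^sup>2 = n / (b * d)" if "n * b = a * c * d" "b \<noteq> 0" "d \<noteq> 0" for a b c d n :: complex
    using that by (simp add: field_simps power2_eq_square)
  have "S1 q = ?P * (3 * jtheta (q ^ 18) (q ^ 45) - jtheta q (q ^ 5))"
    using S_chi_theta(1)[OF t] chi_theta_0_4[OF False assms] by (simp add: t6 flip: q)
  also have "jtheta (q ^ 18) (q ^ 45) = qpoch_inf (q^18) (q^45) * qpoch_inf (q^27) (q^45) * qpoch_inf (q^45) (q^45)"
    using jtheta_power[OF False assms, of 18 27] by simp
  also have "jtheta q (q ^ 5) = qpoch_inf q (q^5) * qpoch_inf (q^4) (q^5) * qpoch_inf (q^5) (q^5)"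
    using jtheta_power[OF False assms, of 1 4] by simp
  finally have S1: "S1 q = 3 * (qpoch_inf (q^6) (q^6) * qpoch_inf (q^18) (q^45) * qpoch_inf (q^27) (q^45)
                     * qpoch_inf (q^45) (q^45)) / ?Q\<^sup>2
     - qpoch_inf (q^6) (q^6) * (qpoch_inf q (q^5) * qpoch_inf (q^4) (q^5) * qpoch_inf (q^5) (q^5)) / ?Q\<^sup>2"
    by (simp add: algebra_simps diff_divide_distrib)
  have "S2 q = ?P * (3 * q\<^sup>2 * jtheta (q ^ 9) (q ^ 45) + jtheta (q\<^sup>2) (q ^ 5))"
    using S_chi_theta(2)[OF t] unfolding t6 q[symmetric] chi_theta_1_3[OF False assms] .
  also have "jtheta (q ^ 9) (q ^ 45) = qpoch_inf (q^9) (q^45) * qpoch_inf (q^36) (q^45) * qpoch_inf (q^45) (q^45)"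
    using jtheta_power[OF False assms, of 9 36] by simp
  also have "jtheta (q\<^sup>2) (q ^ 5) = qpoch_inf (q^2) (q^5) * qpoch_inf (q^3) (q^5) * qpoch_inf (q^5) (q^5)"
    using jtheta_power[OF False assms, of 2 3] by simp
  finally have S2: "S2 q = 3 * q^2 * (qpoch_inf (q^6) (q^6) * qpoch_inf (q^9) (q^45) * qpoch_inf (q^36) (q^45)
                     * qpoch_inf (q^45) (q^45)) / ?Q\<^sup>2
     + qpoch_inf (q^6) (q^6) * (qpoch_inf (q^2) (q^5) * qpoch_inf (q^3) (q^5) * qpoch_inf (q^5) (q^5)) / ?Q\<^sup>2"
    by (simp add: algebra_simps add_divide_distrib)
  show ?thesis
    unfolding S1 S2
      aux[OF product_mod_30_first[OF assms] nz(1) no_zero_divisors[OF nz(2,3)]]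
      aux[OF product_mod_30_second[OF assms] nz(1) no_zero_divisors[OF nz(4,5)]]
    by (simp only: mult.assoc simp_thms)
qed

end
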